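(* Let $\phi:(\mathbb{P}^1)^3\dashrightarrow\mathbb{P}^3$ be a hexahedral trilinear rational map whose weights are $w_{ijk}=\alpha_i\beta_j\gamma_k\Delta_{ijk}$ ($0\le i,j,k\le1$) for some $(\alpha_0:\alpha_1)\times(\beta_0:\beta_1)\times(\gamma_0:\gamma_1)\in(\mathbb{P}^1_{\mathbb{R}})^3$. Then $\phi^{-1}$ is given by $$(x_0:x_1:x_2:x_3)\mapsto(-\alpha_1\sigma_1:\alpha_0\sigma_0)\times(-\beta_1\tau_1:\beta_0\tau_0)\times(-\gamma_1\upsilon_1:\gamma_0\upsilon_0).$$ Additionally: 1. The base locus of $\phi$ is the curve $C$ in $(\mathbb{P}^1)^3$ defined by the ideal $$\Big(\sum_{0\le j,k\le1}w_{0jk}\langle\boldsymbol{\sigma}_1,\mathbf{P}_{0jk}\rangle\,t_ju_k,\ \sum_{0\le i,k\le1}w_{i0k}\langle\boldsymbol{\tau}_1,\mathbf{P}_{i0k}\rangle\,s_iu_k,\ \sum_{0\le i,j\le1}w_{ij0}\langle\boldsymbol{\upsilon}_1,\mathbf{P}_{ij0}\rangle\,s_it_j\Big).$$ 2. The base locus of $\phi^{-1}$ is the union of the lines $s=\Sigma_0\cap\Sigma_1$, $t=T_0\cap T_1$, and $u=Y_0\cap Y_1$. 3. $\phi$ contracts the surfaces in $(\mathbb{P}^1)^3$ defined by the first, second, and third generators of the ideal in item 1 respectively to the lines $s$, $t$, and $u$. 4. If $s,t$, and $u$ are pairwise skew, $\phi$ blows up $C$ to the unique (smooth) quadric through them.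
   Context: Setting. $\mathbb{P}^n$ is complex and $\mathbb{P}^n_{\mathbb{R}}$ real projective $n$-space. $\phi:\mathbb{P}^1\times\mathbb{P}^1\times\mathbb{P}^1\dashrightarrow\mathbb{P}^3$ is the trilinear rational map given by $$\mathbf{f}=(f_0,f_1,f_2,f_3)=\sum_{0\le i,j,k\le 1} w_{ijk}\,\mathbf{P}_{ijk}\,s_it_ju_k,$$ with control points $\mathbf{P}_{ijk}=(1,x_{ijk},y_{ijk},z_{ijk})\in\mathbb{R}^4$ (identified with points of $\mathbb{P}^3$) and weights $w_{ijk}\in\mathbb{R}$. $\langle\cdot,\cdot\rangle$ is the usual scalar product. Boundary surfaces. $\Sigma_0$ (resp. $\Sigma_1$) is the closure of the image of $\phi$ restricted to $(s_0:s_1)=(1:0)$ (resp. $(0:1)$). $T_0,T_1$ and $Y_0,Y_1$ are defined in the same way using $(t_0:t_1)$ and $(u_0:u_1)$. So $\mathbf{P}_{ijk}\in\Sigma_i\cap T_j\cap Y_k$. Boundary lines: $s_{jk}$ joins $\mathbf{P}_{0jk},\mathbf{P}_{1jk}$; $t_{ik}$ joins $\mathbf{P}_{i0k},\mathbf{P}_{i1k}$; $u_{ij}$ joins $\mathbf{P}_{ij0},\mathbf{P}_{ij1}$ (images of the corresponding coordinate lines). Each boundary surface is a plane or a quadric. Standing nondegeneracy assumption: the surfaces $\Sigma_i,T_j,Y_k$ are smooth surfaces, pairwise distinct, and $s_{jk},t_{ik},u_{ij}$ are lines, pairwise distinct. $\phi$ is hexahedral if all boundary surfaces are planes. Then $\Sigma_i,T_j,Y_k$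 are defined by linear forms $\sigma_i=\boldsymbol{\sigma}_i\cdot\mathbf{x}^T$, $\tau_j=\boldsymbol{\tau}_j\cdot\mathbf{x}^T$, $\upsilon_k=\boldsymbol{\upsilon}_k\cdot\mathbf{x}^T$ in $\mathbf{x}=(x_0,\dots,x_3)$, with $\boldsymbol{\sigma}_i=(\sigma_{0i},\dots,\sigma_{3i})$, $\boldsymbol{\tau}_j=(\tau_{0j},\dots,\tau_{3j})$, $\boldsymbol{\upsilon}_k=(\upsilon_{0k},\dots,\upsilon_{3k})$ in $\mathbb{R}^4$, and $$\Delta_{ijk}=\begin{vmatrix}\sigma_{1i}&\sigma_{2i}&\sigma_{3i}\\ \tau_{1j}&\tau_{2j}&\tau_{3j}\\ \upsilon_{1k}&\upsilon_{2k}&\upsilon_{3k}\end{vmatrix}\neq0,$$ with $\mathbf{P}_{ijk}=\Delta_{ijk}^{-1}\,\boldsymbol{\sigma}_i\wedge\boldsymbol{\tau}_j\wedge\boldsymbol{\upsilon}_k$ (the triple wedge being identified with a vector of $\mathbb{R}^4$). $\phi$ contracts a variety $V\subset(\mathbb{P}^1)^3$ if $\dim V>\dim\phi(V)$; it contracts $V$ to $V'$ if moreover the closure of $\phi(V)$ is $V'$. $\phi$ blows up a subvariety $Z$ of its base locus to a surface $S\subset\mathbb{P}^3$ if $S$ is the image in $\mathbb{P}^3$ of the fibre over $Z$ of the closure of the graph of $\phi$ in $(\mathbb{P}^1)^3\times\mathbb{P}^3$.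
   Formalization: In item 3, the closure of the image of each surface is claimed to equal its line only if that line is disjoint from at least one of the other two; otherwise the image is finite, so only contraction into the line is claimed (e.g. for the unit cube with all weights 1 the image is two points of s). *)

theory Defs
  imports "HOL-Analysis.Analysis"
begin

section \<open>Projective spaces and their products\<close>

text \<open>
  Points of complex projective space, indexed by a finite type: the type \<open>4 cproj\<close> is the set of
  points of the projective 3-space, with homogeneous coordinates \<open>x $ 0, x $ 1, x $ 2, x $ 3\<close>, and
  \<open>2 cproj\<close> is the projective line, with homogeneous coordinates \<open>x $ 0, x $ 1\<close>.  In the index
  types \<open>2\<close> and \<open>4\<close> arithmetic is modular and all indices below are written from \<open>0\<close>.
\<close>

definition prop_rel :: "complex^'n \<Rightarrow> complex^'n \<Rightarrow> bool" where
  "prop_rel x y \<longleftrightarrow> x \<noteq> 0 \<and> (\<exists>c. c \<noteq> 0 \<and> y = c *s x)"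

quotient_type 'n cproj = "complex^'n" / partial: "prop_rel :: complex^'n \<Rightarrow> complex^'n \<Rightarrow> bool"
proof (rule part_equivpI)
  have "prop_rel (axis i 1) (axis i 1 :: complex^'n)" for i :: 'n
    unfolding prop_rel_def by (auto simp: axis_eq_0_iff intro: exI[of _ 1])
  then show "\<exists>x :: complex^'n. prop_rel x x" by blast
  show "symp (prop_rel :: complex^'n \<Rightarrow> complex^'n \<Rightarrow> bool)"
  proof (rule sympI)
    fix x y :: "complex^'n" assume "prop_rel x y"
    then obtain c where "x \<noteq> 0" "c \<noteq> 0" "y = c *s x" unfolding prop_rel_def by blast
    then show "prop_rel y x"
      unfolding prop_rel_def by (auto intro!: exI[of _ "inverse c"])
  qed
  show "transp (prop_rel :: complex^'n \<Rightarrow> complex^'n \<Rightarrow> bool)"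
  proof (rule transpI)
    fix x y z :: "complex^'n" assume "prop_rel x y" "prop_rel y z"
    then obtain c d where "x \<noteq> 0" "c \<noteq> 0" "y = c *s x" "d \<noteq> 0" "z = d *s y"
      unfolding prop_rel_def by blast
    then show "prop_rel x z"
      unfolding prop_rel_def by (auto intro!: exI[of _ "d * c"])
  qed
qed

abbreviation pt :: "complex^'n \<Rightarrow> 'n cproj" where "pt \<equiv> abs_cproj"
abbreviation rep :: "'n cproj \<Rightarrow> complex^'n" where "rep \<equiv> rep_cproj"

type_synonym P3 = "4 cproj"
type_synonym P1_3 = "2 cproj \<times> 2 cproj \<times> 2 cproj"

type_synonym vec_3 = "(complex^2) \<times> (complex^2) \<times> (complex^2)"

fun rep3 :: "P1_3 \<Rightarrow> vec_3" where
  "rep3 (p, q, r) = (rep p, rep q, rep r)"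

fun repG :: "P1_3 \<times> P3 \<Rightarrow> vec_3 \<times> (complex^4)" where
  "repG (p, x) = (rep3 p, rep x)"

text \<open>
  Polynomials over the complex numbers are identified with polynomial functions.  The set
  \<open>poly_funs X\<close> is the algebra of functions generated by the coordinate functions in \<open>X\<close>.
\<close>

inductive_set poly_funs :: "('a \<Rightarrow> complex) set \<Rightarrow> ('a \<Rightarrow> complex) set"
  for X :: "('a \<Rightarrow> complex) set" where
  const: "(\<lambda>_. c) \<in> poly_funs X"
| coord: "f \<in> X \<Longrightarrow> f \<in> poly_funs X"
| add: "f \<in> poly_funs X \<Longrightarrow> g \<in> poly_funs X \<Longrightarrow> (\<lambda>x. f x + g x) \<in> poly_funs X"
| mult: "f \<in> poly_funs X \<Longrightarrow> g \<in> poly_funs X \<Longrightarrow> (\<lambda>x. f x * g x) \<in> poly_funs X"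

definition coords :: "(complex^'n \<Rightarrow> complex) set" where
  "coords = range (\<lambda>i x. x $ i)"

definition coords3 :: "(vec_3 \<Rightarrow> complex) set" where
  "coords3 = range (\<lambda>i (s, t, u). s $ i) \<union> range (\<lambda>i (s, t, u). t $ i) \<union> range (\<lambda>i (s, t, u). u $ i)"

definition coordsG :: "(vec_3 \<times> (complex^4) \<Rightarrow> complex) set" where
  "coordsG = (\<lambda>c (a, x). c a) ` coords3 \<union> (\<lambda>c (a, x). c x) ` coords"

text \<open>\<open>formsG\<close> lives on the product in which the graph of a map lies.\<close>

definition forms :: "nat \<Rightarrow> (complex^'n \<Rightarrow> complex) set" where
  "forms d = {f \<in> poly_funs coords. \<forall>l x. f (l *s x) = l ^ d * f x}"

definition forms3 :: "nat \<Rightarrow> nat \<Rightarrow> nat \<Rightarrow> (vec_3 \<Rightarrow> complex) set" where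
  "forms3 a b c = {f \<in> poly_funs coords3.
     \<forall>l m n s t u. f (l *s s, m *s t, n *s u) = l ^ a * m ^ b * n ^ c * f (s, t, u)}"

definition formsG :: "nat \<Rightarrow> nat \<Rightarrow> nat \<Rightarrow> nat \<Rightarrow> (vec_3 \<times> (complex^4) \<Rightarrow> complex) set" where
  "formsG a b c d = {f \<in> poly_funs coordsG.
     \<forall>l m n k s t u x. f ((l *s s, m *s t, n *s u), k *s x) =
       l ^ a * m ^ b * n ^ c * k ^ d * f ((s, t, u), x)}"

text \<open>
  The Zariski topologies.  The non-vanishing sets of (multi)homogeneous polynomials are closed under
  finite intersections, so they form a basis, and the closed sets of the generated topology are
  exactly the common zero sets of families of such polynomials.
\<close>

definition zariski :: "('n::finite) cproj topology" where
  "zariski = topology_generated_by {{p. f (rep p) \<noteq> 0} | f. \<exists>d. f \<in> forms d}"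

definition zariski3 :: "P1_3 topology" where
  "zariski3 = topology_generated_by {{p. f (rep3 p) \<noteq> 0} | f. \<exists>a b c. f \<in> forms3 a b c}"

definition zariskiG :: "(P1_3 \<times> P3) topology" where
  "zariskiG = topology_generated_by {{p. f (repG p) \<noteq> 0} | f. \<exists>a b c d. f \<in> formsG a b c d}"

section \<open>Dimension\<close>

definition irreducible_closed :: "'a topology \<Rightarrow> 'a set \<Rightarrow> bool" where
  "irreducible_closed X Z \<longleftrightarrow> closedin X Z \<and> Z \<noteq> {} \<and>
     (\<forall>A B. closedin X A \<and> closedin X B \<and> Z = A \<union> B \<longrightarrow> Z = A \<or> Z = B)"

text \<open>Krull dimension.  The empty space gets dimension 0 here.\<close>

definition krull_dim :: "'a topology \<Rightarrow> enat" where
  "krull_dim X = Sup {enat n | n. \<exists>Z :: nat \<Rightarrow> 'a set.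
     (\<forall>i\<le>n. irreducible_closed X (Z i)) \<and> (\<forall>i<n. Z i \<subset> Z (Suc i))}"

definition irreducible_component :: "'a topology \<Rightarrow> 'a set \<Rightarrow> 'a set \<Rightarrow> bool" where
  "irreducible_component X V Z \<longleftrightarrow> irreducible_closed X Z \<and> Z \<subseteq> V \<and>
     (\<forall>Z'. irreducible_closed X Z' \<and> Z \<subseteq> Z' \<and> Z' \<subseteq> V \<longrightarrow> Z' = Z)"

definition pure_dim :: "'a topology \<Rightarrow> 'a set \<Rightarrow> nat \<Rightarrow> bool" where
  "pure_dim X V d \<longleftrightarrow> closedin X V \<and> V \<noteq> {} \<and>
     (\<forall>Z. irreducible_component X V Z \<longrightarrow> krull_dim (subtopology X Z) = enat d)"

section \<open>Lines, planes, quadrics and smooth surfaces in 3-space\<close>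

definition cvec :: "real^'n \<Rightarrow> complex^'n" where
  "cvec v = (\<chi> i. complex_of_real (v $ i))"

definition linear_form :: "real^4 \<Rightarrow> complex^4 \<Rightarrow> complex" where
  "linear_form a x = (\<Sum>m\<in>UNIV. complex_of_real (a $ m) * x $ m)"

definition zeros :: "(complex^4 \<Rightarrow> complex) \<Rightarrow> P3 set" where
  "zeros f = {p. f (rep p) = 0}"

definition is_plane :: "P3 set \<Rightarrow> bool" where
  "is_plane S \<longleftrightarrow> (\<exists>f \<in> forms 1. f \<noteq> (\<lambda>_. 0) \<and> S = zeros f)"

definition is_quadric :: "P3 set \<Rightarrow> bool" where
  "is_quadric S \<longleftrightarrow> (\<exists>f \<in> forms 2. f \<noteq> (\<lambda>_. 0) \<and> S = zeros f)"

definition is_line :: "P3 set \<Rightarrow> bool" where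
  "is_line L \<longleftrightarrow> (\<exists>U. vec.subspace U \<and> vec.dim U = 2 \<and> L = {p. rep p \<in> U})"

definition line_join :: "real^4 \<Rightarrow> real^4 \<Rightarrow> P3 set" where
  "line_join a b = {p. rep p \<in> vec.span {cvec a, cvec b}}"

text \<open>The Jacobian criterion; the gradient condition makes \<open>f\<close> nonzero and square-free.\<close>

definition smooth_surface_of_degree :: "nat \<Rightarrow> P3 set \<Rightarrow> bool" where
  "smooth_surface_of_degree d S \<longleftrightarrow> (\<exists>f \<in> forms d. S = zeros f \<and>
     (\<forall>x. x \<noteq> 0 \<and> f x = 0 \<longrightarrow> (\<exists>i. deriv (\<lambda>z. f (x + z *s axis i 1)) 0 \<noteq> 0)))"

definition smooth_surface :: "P3 set \<Rightarrow> bool" where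
  "smooth_surface S \<longleftrightarrow> (\<exists>d>0. smooth_surface_of_degree d S)"

section \<open>Rational maps\<close>

text \<open>
  A rational map to projective 3-space is given by its coordinate polynomials
  \<open>f :: vec_3 \<Rightarrow> complex^4\<close>; a rational map from projective 3-space to the threefold product of
  projective lines by three pairs of forms \<open>g :: complex^4 \<Rightarrow> vec_3\<close>.  The point maps \<open>rmap f\<close> and
  \<open>rmap_inv g\<close> are meaningful only outside the respective base loci.
\<close>

definition base_locus :: "(vec_3 \<Rightarrow> complex^4) \<Rightarrow> P1_3 set" where
  "base_locus f = {p. f (rep3 p) = 0}"

definition rmap :: "(vec_3 \<Rightarrow> complex^4) \<Rightarrow> P1_3 \<Rightarrow> P3" where
  "rmap f p = pt (f (rep3 p))"

definition rimage :: "(vec_3 \<Rightarrow> complex^4) \<Rightarrow> P1_3 set \<Rightarrow> P3 set" where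
  "rimage f V = rmap f ` (V - base_locus f)"

definition base_locus_inv :: "(complex^4 \<Rightarrow> vec_3) \<Rightarrow> P3 set" where
  "base_locus_inv g = {x. case g (rep x) of (a, b, c) \<Rightarrow> a = 0 \<or> b = 0 \<or> c = 0}"

definition rmap_inv :: "(complex^4 \<Rightarrow> vec_3) \<Rightarrow> P3 \<Rightarrow> P1_3" where
  "rmap_inv g x = (case g (rep x) of (a, b, c) \<Rightarrow> (pt a, pt b, pt c))"

text \<open>
  Mutually inverse birational maps.  Source and target are irreducible, so a nonempty open set is
  dense.
\<close>

definition birational_inverse :: "(vec_3 \<Rightarrow> complex^4) \<Rightarrow> (complex^4 \<Rightarrow> vec_3) \<Rightarrow> bool" where
  "birational_inverse f g \<longleftrightarrow> (\<exists>U W.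
     openin zariski3 U \<and> U \<noteq> {} \<and> U \<inter> base_locus f = {} \<and>
     openin zariski W \<and> W \<noteq> {} \<and> W \<inter> base_locus_inv g = {} \<and>
     rmap f ` U = W \<and> rmap_inv g ` W = U \<and>
     (\<forall>p\<in>U. rmap_inv g (rmap f p) = p) \<and> (\<forall>x\<in>W. rmap f (rmap_inv g x) = x))"

text \<open>
  The first conjunct of \<open>contracts\<close> says that the restriction of the map to \<open>V\<close> is defined somewhere.
\<close>

definition contracts :: "(vec_3 \<Rightarrow> complex^4) \<Rightarrow> P1_3 set \<Rightarrow> bool" where
  "contracts f V \<longleftrightarrow> \<not> V \<subseteq> base_locus f \<and>
     krull_dim (subtopology zariski3 V) > krull_dim (subtopology zariski (rimage f V))"

definition contracts_to :: "(vec_3 \<Rightarrow> complex^4) \<Rightarrow> P1_3 set \<Rightarrow> P3 set \<Rightarrow> bool" where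
  "contracts_to f V V' \<longleftrightarrow> contracts f V \<and> zariski closure_of (rimage f V) = V'"

definition graph_of :: "(vec_3 \<Rightarrow> complex^4) \<Rightarrow> (P1_3 \<times> P3) set" where
  "graph_of f = {(p, rmap f p) | p. p \<notin> base_locus f}"

definition blows_up_to :: "(vec_3 \<Rightarrow> complex^4) \<Rightarrow> P1_3 set \<Rightarrow> P3 set \<Rightarrow> bool" where
  "blows_up_to f Z S \<longleftrightarrow> Z \<subseteq> base_locus f \<and>
     S = {x. \<exists>p\<in>Z. (p, x) \<in> zariskiG closure_of (graph_of f)}"

section \<open>Subschemes of the threefold product of projective lines\<close>

text \<open>
  Closed subschemes correspond to multihomogeneous ideals that are saturated with respect to the
  irrelevant ideal, which is generated by the products \<open>s\<^sub>i t\<^sub>j u\<^sub>k\<close>.  The coordinate ring is Noetherian,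
  so a single exponent \<open>n\<close> on these finitely many generators describes the saturation.
\<close>

definition ideal_gen3 :: "(vec_3 \<Rightarrow> complex) set \<Rightarrow> (vec_3 \<Rightarrow> complex) set" where
  "ideal_gen3 F = {h. \<exists>G c. finite G \<and> G \<subseteq> F \<and> (\<forall>g\<in>G. c g \<in> poly_funs coords3) \<and>
     h = (\<lambda>x. \<Sum>g\<in>G. c g x * g x)}"

definition saturation3 :: "(vec_3 \<Rightarrow> complex) set \<Rightarrow> (vec_3 \<Rightarrow> complex) set" where
  "saturation3 I = {h \<in> poly_funs coords3.
     \<exists>n. \<forall>i j k. (\<lambda>(s, t, u). (s $ i * t $ j * u $ k) ^ n * h (s, t, u)) \<in> I}"

definition same_subscheme3 :: "(vec_3 \<Rightarrow> complex) set \<Rightarrow> (vec_3 \<Rightarrow> complex) set \<Rightarrow> bool" where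
  "same_subscheme3 F G \<longleftrightarrow> saturation3 (ideal_gen3 F) = saturation3 (ideal_gen3 G)"

definition zeros3 :: "(vec_3 \<Rightarrow> complex) set \<Rightarrow> P1_3 set" where
  "zeros3 F = {p. \<forall>f\<in>F. f (rep3 p) = 0}"

section \<open>Trilinear maps\<close>

definition trilinear ::
  "(2 \<Rightarrow> 2 \<Rightarrow> 2 \<Rightarrow> real) \<Rightarrow> (2 \<Rightarrow> 2 \<Rightarrow> 2 \<Rightarrow> real^4) \<Rightarrow> vec_3 \<Rightarrow> complex^4" where
  "trilinear w P = (\<lambda>(s, t, u). \<Sum>i\<in>UNIV. \<Sum>j\<in>UNIV. \<Sum>k\<in>UNIV.
     (complex_of_real (w i j k) * s $ i * t $ j * u $ k) *s cvec (P i j k))"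

text \<open>\<open>vertex 0 = (1 : 0)\<close> and \<open>vertex 1 = (0 : 1)\<close>\<close>

definition vertex :: "2 \<Rightarrow> 2 cproj" where
  "vertex i = pt (axis i 1)"

definition Sigma_surface :: "(vec_3 \<Rightarrow> complex^4) \<Rightarrow> 2 \<Rightarrow> P3 set" where
  "Sigma_surface f i = zariski closure_of (rimage f {(p, q, r). p = vertex i})"

definition T_surface :: "(vec_3 \<Rightarrow> complex^4) \<Rightarrow> 2 \<Rightarrow> P3 set" where
  "T_surface f j = zariski closure_of (rimage f {(p, q, r). q = vertex j})"

definition Y_surface :: "(vec_3 \<Rightarrow> complex^4) \<Rightarrow> 2 \<Rightarrow> P3 set" where
  "Y_surface f k = zariski closure_of (rimage f {(p, q, r). r = vertex k})"

definition boundary_surfaces :: "(vec_3 \<Rightarrow> complex^4) \<Rightarrow> P3 set list" where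
  "boundary_surfaces f = [Sigma_surface f 0, Sigma_surface f 1, T_surface f 0, T_surface f 1,
     Y_surface f 0, Y_surface f 1]"

definition s_line :: "(2 \<Rightarrow> 2 \<Rightarrow> 2 \<Rightarrow> real^4) \<Rightarrow> 2 \<Rightarrow> 2 \<Rightarrow> P3 set" where
  "s_line P j k = line_join (P 0 j k) (P 1 j k)"

definition t_line :: "(2 \<Rightarrow> 2 \<Rightarrow> 2 \<Rightarrow> real^4) \<Rightarrow> 2 \<Rightarrow> 2 \<Rightarrow> P3 set" where
  "t_line P i k = line_join (P i 0 k) (P i 1 k)"

definition u_line :: "(2 \<Rightarrow> 2 \<Rightarrow> 2 \<Rightarrow> real^4) \<Rightarrow> 2 \<Rightarrow> 2 \<Rightarrow> P3 set" where
  "u_line P i j = line_join (P i j 0) (P i j 1)"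

definition boundary_lines :: "(2 \<Rightarrow> 2 \<Rightarrow> 2 \<Rightarrow> real^4) \<Rightarrow> P3 set list" where
  "boundary_lines P =
     [s_line P 0 0, s_line P 0 1, s_line P 1 0, s_line P 1 1,
      t_line P 0 0, t_line P 0 1, t_line P 1 0, t_line P 1 1,
      u_line P 0 0, u_line P 0 1, u_line P 1 0, u_line P 1 1]"

text \<open>
  Besides smoothness and distinctness, the boundary lines are required to be the closures of the
  images of the coordinate lines.  This excludes vanishing weights: if \<open>w 0 j k = 0\<close>, say, then the
  corresponding coordinate line has at most one image point.
\<close>

definition nondegenerate ::
  "(2 \<Rightarrow> 2 \<Rightarrow> 2 \<Rightarrow> real) \<Rightarrow> (2 \<Rightarrow> 2 \<Rightarrow> 2 \<Rightarrow> real^4) \<Rightarrow> bool" where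
  "nondegenerate w P \<longleftrightarrow>
     list_all smooth_surface (boundary_surfaces (trilinear w P)) \<and>
     distinct (boundary_surfaces (trilinear w P)) \<and>
     list_all is_line (boundary_lines P) \<and>
     distinct (boundary_lines P) \<and>
     (\<forall>j k. zariski closure_of
        (rimage (trilinear w P) {(p, q, r). q = vertex j \<and> r = vertex k}) = s_line P j k) \<and>
     (\<forall>i k. zariski closure_of
        (rimage (trilinear w P) {(p, q, r). p = vertex i \<and> r = vertex k}) = t_line P i k) \<and>
     (\<forall>i j. zariski closure_of
        (rimage (trilinear w P) {(p, q, r). p = vertex i \<and> q = vertex j}) = u_line P i j)"

definition hexahedral :: "(vec_3 \<Rightarrow> complex^4) \<Rightarrow> bool" where
  "hexahedral f \<longleftrightarrow> list_all is_plane (boundary_surfaces f)"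

text \<open>The determinant of the last three columns; column \<open>0\<close> is the plane at infinity.\<close>

definition Delta :: "real^4 \<Rightarrow> real^4 \<Rightarrow> real^4 \<Rightarrow> real" where
  "Delta a b c = det (vector [vector [a $ 1, a $ 2, a $ 3],
                              vector [b $ 1, b $ 2, b $ 3],
                              vector [c $ 1, c $ 2, c $ 3]] :: real^3^3)"

text \<open>\<open>hpair a b\<close> has homogeneous coordinates \<open>(a : b)\<close>; \<open>vector [a, b]\<close> would index from 1.\<close>

definition hpair :: "complex \<Rightarrow> complex \<Rightarrow> complex^2" where
  "hpair a b = (\<chi> i. if i = 0 then a else b)"

definition inverse_map ::
  "real^2 \<Rightarrow> real^2 \<Rightarrow> real^2 \<Rightarrow> (2 \<Rightarrow> real^4) \<Rightarrow> (2 \<Rightarrow> real^4) \<Rightarrow> (2 \<Rightarrow> real^4) \<Rightarrow> complex^4 \<Rightarrow> vec_3" where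
  "inverse_map \<alpha> \<beta> \<gamma> \<sigma> \<tau> \<upsilon> = (\<lambda>x.
     (hpair (- of_real (\<alpha> $ 1) * linear_form (\<sigma> 1) x) (of_real (\<alpha> $ 0) * linear_form (\<sigma> 0) x),
      hpair (- of_real (\<beta> $ 1) * linear_form (\<tau> 1) x) (of_real (\<beta> $ 0) * linear_form (\<tau> 0) x),
      hpair (- of_real (\<gamma> $ 1) * linear_form (\<upsilon> 1) x) (of_real (\<gamma> $ 0) * linear_form (\<upsilon> 0) x)))"

text \<open>In the following, \<open>a\<close>, \<open>b\<close>, \<open>c\<close> are the coefficient vectors of the second forms
  \<open>\<sigma> 1\<close>, \<open>\<tau> 1\<close>, \<open>\<upsilon> 1\<close>.\<close>

definition gen_s :: "(2 \<Rightarrow> 2 \<Rightarrow> 2 \<Rightarrow> real) \<Rightarrow> (2 \<Rightarrow> 2 \<Rightarrow> 2 \<Rightarrow> real^4) \<Rightarrow> real^4 \<Rightarrow> vec_3 \<Rightarrow> complex" where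
  "gen_s w P a = (\<lambda>(s, t, u). \<Sum>j\<in>UNIV. \<Sum>k\<in>UNIV. of_real (w 0 j k * (a \<bullet> P 0 j k)) * t $ j * u $ k)"

definition gen_t :: "(2 \<Rightarrow> 2 \<Rightarrow> 2 \<Rightarrow> real) \<Rightarrow> (2 \<Rightarrow> 2 \<Rightarrow> 2 \<Rightarrow> real^4) \<Rightarrow> real^4 \<Rightarrow> vec_3 \<Rightarrow> complex" where
  "gen_t w P b = (\<lambda>(s, t, u). \<Sum>i\<in>UNIV. \<Sum>k\<in>UNIV. of_real (w i 0 k * (b \<bullet> P i 0 k)) * s $ i * u $ k)"

definition gen_u :: "(2 \<Rightarrow> 2 \<Rightarrow> 2 \<Rightarrow> real) \<Rightarrow> (2 \<Rightarrow> 2 \<Rightarrow> 2 \<Rightarrow> real^4) \<Rightarrow> real^4 \<Rightarrow> vec_3 \<Rightarrow> complex" where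
  "gen_u w P c = (\<lambda>(s, t, u). \<Sum>i\<in>UNIV. \<Sum>j\<in>UNIV. of_real (w i j 0 * (c \<bullet> P i j 0)) * s $ i * t $ j)"

end

theory Submission
  imports Defs
begin

text \<open>
  Write \<open>\<sigma>(s) = s\<^sub>0 a\<^sub>0 + s\<^sub>1 a\<^sub>1\<close> with \<open>a\<^sub>i = \<alpha>\<^sub>i \<sigma>\<^sub>i\<close>, and similarly \<open>\<tau>(t)\<close> and \<open>\<upsilon>(u)\<close>.  The condition on the
  weights says precisely that \<open>\<phi>(s, t, u) = \<sigma>(s) \<and> \<tau>(t) \<and> \<upsilon>(u)\<close>, so \<open>\<phi>\<close> sends \<open>(s, t, u)\<close> to the
  intersection point of one plane from each of three pencils, and the inverse reads off the planes
  of the pencils through a given point.  Pairing \<open>\<phi>\<close> with \<open>a\<^sub>0\<close>, \<open>a\<^sub>1\<close> gives \<open>-s\<^sub>1 A\<close>, \<open>s\<^sub>0 A\<close> where \<open>A(t, u)\<close>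
  is, up to a constant, the first generator; hence \<open>A\<close>, \<open>B\<close>, \<open>D\<close> cut out the base scheme, and
  where \<open>A\<close> vanishes the image lies on the axis \<open>a\<^sub>0 = a\<^sub>1 = 0\<close>.  The composition of \<open>\<phi>\<close> with its
  inverse is multiplication by a quadratic form, which defines the quadric through the three axes; a
  point of the quadric is a limit of images along a tangent line that leaves the quadric.

  For the dimensions: a chain of five irreducible closed sets in \<open>(P\<^sup>1)\<^sup>3\<close> would provide more
  linearly independent monomials in four forms than there are points of a cubic grid on which
  polynomials of their degree are determined.  The base curve has no isolated points, because two
  linear relations among vectors of the three pencils yield a line of base points through each of
  them.
\<close>

text \<open>Irreducibility rests on one criterion: a set is irreducible as soon as any two of its
  points are joined inside it by a line \<open>line3\<close>, because forms restrict to polynomials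
  in one variable on such a line. Upper bounds for dimensions come from prolonging a chain inside
  the set to five sets ending with the whole product; lower bounds come from explicit chains.
  Nondegeneracy is converted into four facts about the pencils, collected in the locale
  \<open>pencils\<close>; they are invariant under cyclic permutation, so each claim is proved for
  one pencil and rotated. The obstacle in the contraction claim is that the image of a surface might
  be finite; skewness to one other axis yields infinitely many image points. The obstacle in the
  blow-up is a point of the quadric on an axis, where the inverse is undefined because one parameter
  pair is zero. Along a tangent line this pair is divisible by the line parameter. The composite is
  divisible by its square, so after the division one factor is left to force the limit into the base
  locus, provided that the point lies on no second axis.\<close>

lemma UNIV_type_2: "(UNIV :: 2 set) = {0, 1}"
proof -
  have e: "(2::2) = 0" by simp
  have "(x::2) = 0 \<or> x = 1" for x using exhaust_2[of x] unfolding e by blast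
  then show ?thesis by blast
qed

lemma UNIV_type_4: "(UNIV :: 4 set) = {0, 1, 2, 3}"
proof -
  have e: "(4::4) = 0" by simp
  have "(x::4) = 0 \<or> x = 1 \<or> x = 2 \<or> x = 3" for x using exhaust_4[of x] unfolding e by blast
  then show ?thesis by blast
qed

lemma sum_type_2: "(\<Sum>i\<in>UNIV. f (i::2)) = f 0 + f 1"
  by (simp add: UNIV_type_2)

lemma sum_type_4: "(\<Sum>i\<in>UNIV. f (i::4)) = f 0 + f 1 + f 2 + f 3"
proof -
  have "distinct [0::4, 1, 2, 3]" by simp
  then show ?thesis unfolding UNIV_type_4 by (simp add: add.assoc)
qed

lemma all_type_4: "(\<forall>i::4. P i) \<longleftrightarrow> P 0 \<and> P 1 \<and> P 2 \<and> P 3"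
proof -
  have "(\<forall>i::4. P i) \<longleftrightarrow> (\<forall>i\<in>{0, 1, 2, 3::4}. P i)" unfolding UNIV_type_4[symmetric] by simp
  then show ?thesis by simp
qed

lemma all_type_2: "(\<forall>i::2. P i) \<longleftrightarrow> P 0 \<and> P 1"
proof -
  have "(\<forall>i::2. P i) \<longleftrightarrow> (\<forall>i\<in>{0, 1::2}. P i)" unfolding UNIV_type_2[symmetric] by simp
  then show ?thesis by simp
qed

lemma vec2_eq_iff: "(x :: 'a^2) = y \<longleftrightarrow> x $ 0 = y $ 0 \<and> x $ 1 = y $ 1"
  by (simp add: vec_eq_iff all_type_2)

lemma vec4_eq_iff: "(x :: 'a^4) = y \<longleftrightarrow> x $ 0 = y $ 0 \<and> x $ 1 = y $ 1 \<and> x $ 2 = y $ 2 \<and> x $ 3 = y $ 3"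
  by (simp add: vec_eq_iff all_type_4)

subsection \<open>Points and representatives\<close>

lemma rep_nonzero [simp]: "rep p \<noteq> 0"
  using Quotient3_rep_reflp[OF Quotient3_cproj] by (auto simp: prop_rel_def)

lemma pt_rep [simp]: "pt (rep p) = p"
  using Quotient3_abs_rep[OF Quotient3_cproj] .

lemma pt_eq_iff:
  assumes "x \<noteq> 0" "y \<noteq> 0"
  shows "pt x = pt y \<longleftrightarrow> (\<exists>c. c \<noteq> 0 \<and> y = c *s x)"
proof -
  have r: "prop_rel z z" if "z \<noteq> 0" for z :: "complex^'a"
    using that unfolding prop_rel_def by (auto intro: exI[of _ 1])
  show ?thesis
    using Quotient3_rel[OF Quotient3_cproj, of x y] r assms
    by (auto simp: prop_rel_def)
qed

lemma rep_pt:
  assumes "x \<noteq> 0"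
  obtains c where "c \<noteq> 0" "rep (pt x) = c *s x"
  using pt_eq_iff[OF assms, of "rep (pt x)"] by auto

lemma pt_scale: "c \<noteq> 0 \<Longrightarrow> x \<noteq> 0 \<Longrightarrow> pt (c *s x) = pt x"
  using pt_eq_iff[of x "c *s x"] by auto

fun nz3 :: "vec_3 \<Rightarrow> bool" where
  "nz3 (x, y, z) \<longleftrightarrow> x \<noteq> 0 \<and> y \<noteq> 0 \<and> z \<noteq> 0"

fun pt3 :: "vec_3 \<Rightarrow> P1_3" where
  "pt3 (x, y, z) = (pt x, pt y, pt z)"

text \<open>One parameter moves all three factors at once. Such lines serve twice: joining two
  points proves irreducibility, and restricting a form to one turns it into a polynomial in a single
  variable.\<close>

fun line3 :: "vec_3 \<Rightarrow> vec_3 \<Rightarrow> complex \<Rightarrow> vec_3" where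
  "line3 (x, y, z) (x', y', z') l = (x + l *s x', y + l *s y', z + l *s z')"

lemma nz3_rep3 [simp]: "nz3 (rep3 p)"
  by (cases p) auto

lemma pt3_rep3 [simp]: "pt3 (rep3 p) = p"
  by (cases p) auto

lemma forms3_pt3:
  assumes f: "f \<in> forms3 a b c" and v: "nz3 v"
  shows "f (rep3 (pt3 v)) = 0 \<longleftrightarrow> f v = 0"
proof -
  obtain x y z where v': "v = (x, y, z)" by (cases v) auto
  then obtain l m n where "l \<noteq> 0" "rep (pt x) = l *s x" "m \<noteq> 0" "rep (pt y) = m *s y"
    "n \<noteq> 0" "rep (pt z) = n *s z"
    using v by (auto elim!: rep_pt)
  then show ?thesis using f v' by (simp add: forms3_def)
qed

lemma forms_pt:
  assumes f: "f \<in> forms d" and x: "x \<noteq> 0"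
  shows "f (rep (pt x)) = 0 \<longleftrightarrow> f x = 0"
proof -
  obtain c where "c \<noteq> 0" "rep (pt x) = c *s x" using rep_pt[OF x] .
  then show ?thesis using f by (simp add: forms_def)
qed

lemma formsG_pt:
  assumes f: "f \<in> formsG a b c d" and v: "nz3 v" and x: "x \<noteq> 0"
  shows "f (repG (pt3 v, pt x)) = 0 \<longleftrightarrow> f (v, x) = 0"
proof -
  obtain r y z where v': "v = (r, y, z)" by (cases v) auto
  then obtain l m n k where "l \<noteq> 0" "rep (pt r) = l *s r" "m \<noteq> 0" "rep (pt y) = m *s y"
    "n \<noteq> 0" "rep (pt z) = n *s z" "k \<noteq> 0" "rep (pt x) = k *s x"
    using v x by (auto elim!: rep_pt)
  then show ?thesis using f v' by (simp add: formsG_def)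
qed

subsection \<open>Polynomial functions\<close>

text \<open>The bound \<open>M\<close> stands before the quantifier over \<open>i\<close>, so it
  holds for all lines of a family at once; the count on a grid needs this uniformity.\<close>

lemma poly_funs_compose_poly:
  assumes "f \<in> poly_funs X"
    and "\<And>c. c \<in> X \<Longrightarrow> \<exists>M. \<forall>i. \<exists>p. degree p \<le> M \<and> (\<forall>z. c (h i z) = poly p z)"
  shows "\<exists>M. \<forall>i. \<exists>p. degree p \<le> M \<and> (\<forall>z. f (h i z) = poly p z)"
  using assms(1)
proof induction
  case (const c)
  show ?case by (rule exI[of _ 0], rule allI, rule exI[of _ "[:c:]"]) auto
next
  case (coord f)
  then show ?case using assms(2) by blast
next
  case (add f g)
  then obtain M N where M: "\<And>i. \<exists>p. degree p \<le> M \<and> (\<forall>z. f (h i z) = poly p z)"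
    and N: "\<And>i. \<exists>p. degree p \<le> N \<and> (\<forall>z. g (h i z) = poly p z)" by blast
  have "\<exists>p. degree p \<le> max M N \<and> (\<forall>z. f (h i z) + g (h i z) = poly p z)" for i
  proof -
    obtain p q where "degree p \<le> M" "\<forall>z. f (h i z) = poly p z" "degree q \<le> N"
      "\<forall>z. g (h i z) = poly q z" using M N by blast
    then show ?thesis by (intro exI[of _ "p + q"]) (auto intro!: degree_add_le)
  qed
  then show ?case by blast
next
  case (mult f g)
  then obtain M N where M: "\<And>i. \<exists>p. degree p \<le> M \<and> (\<forall>z. f (h i z) = poly p z)"
    and N: "\<And>i. \<exists>p. degree p \<le> N \<and> (\<forall>z. g (h i z) = poly p z)" by blast
  have "\<exists>p. degree p \<le> M + N \<and> (\<forall>z. f (h i z) * g (h i z) = poly p z)" for i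
  proof -
    obtain p q where "degree p \<le> M" "\<forall>z. f (h i z) = poly p z" "degree q \<le> N"
      "\<forall>z. g (h i z) = poly q z" using M N by blast
    then show ?thesis
      by (intro exI[of _ "p * q"]) (auto intro!: order.trans[OF degree_mult_le])
  qed
  then show ?case by blast
qed

lemma affine_poly: "\<exists>p. degree p \<le> Suc 0 \<and> (\<forall>z::complex. a + z * b = poly p z)"
  by (rule exI[of _ "[:a, b:]"]) auto

lemma poly_on_line3:
  assumes "f \<in> poly_funs coords3"
  shows "\<exists>M. \<forall>v w. \<exists>p. degree p \<le> M \<and> (\<forall>z. f (line3 v w z) = poly p z)"
proof -
  have "\<exists>M. \<forall>i. \<exists>p. degree p \<le> M \<and> (\<forall>z. f ((\<lambda>(v, w). line3 v w) i z) = poly p z)"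
    by (rule poly_funs_compose_poly[OF assms], rule exI[of _ 1])
      (auto simp: coords3_def intro: affine_poly)
  then show ?thesis by (metis (no_types, lifting) case_prod_conv)
qed

lemma poly_on_line:
  assumes "f \<in> poly_funs coords"
  shows "\<exists>p. \<forall>z. f (x + z *s y) = poly p z"
proof -
  have "\<exists>M. \<forall>i. \<exists>p. degree p \<le> M \<and> (\<forall>z. f ((\<lambda>(v, w) z. v + z *s w) i z) = poly p z)"
    by (rule poly_funs_compose_poly[OF assms], rule exI[of _ 1])
      (auto simp: coords_def intro: affine_poly)
  then show ?thesis by (metis (no_types, lifting) case_prod_conv)
qed

lemma poly_on_lineG:
  assumes "f \<in> poly_funs coordsG"
  shows "\<exists>p. \<forall>z. f (line3 v w z, x + z *s y) = poly p z"
proof -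
  have "\<exists>M. \<forall>i. \<exists>p. degree p \<le> M \<and>
      (\<forall>z. f ((\<lambda>((v, w), (x, y)) z. (line3 v w z, x + z *s y)) i z) = poly p z)"
    by (rule poly_funs_compose_poly[OF assms], rule exI[of _ 1])
      (auto simp: coordsG_def coords3_def coords_def intro: affine_poly)
  then show ?thesis by (metis (no_types, lifting) case_prod_conv)
qed

lemma poly_funs_diff:
  assumes "f \<in> poly_funs X" "g \<in> poly_funs X"
  shows "(\<lambda>x. f x - g x) \<in> poly_funs X"
  using poly_funs.add[OF assms(1) poly_funs.mult[OF poly_funs.const[of "-1"] assms(2)]] by simp

lemma poly_funs_sum:
  assumes "\<And>i. i \<in> I \<Longrightarrow> f i \<in> poly_funs X"
  shows "(\<lambda>x. \<Sum>i\<in>I. f i x) \<in> poly_funs X"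
  using assms
proof (induction I rule: infinite_finite_induct)
  case (insert i I)
  then show ?case by (auto intro!: poly_funs.add)
qed (auto intro: poly_funs.const)

lemma poly_funs_coord3:
  "(\<lambda>(s, t, u). s $ i) \<in> poly_funs coords3" "(\<lambda>(s, t, u). t $ i) \<in> poly_funs coords3"
  "(\<lambda>(s, t, u). u $ i) \<in> poly_funs coords3"
  by (rule poly_funs.coord, auto simp: coords3_def)+

lemma poly_funs_coord: "(\<lambda>x. x $ i) \<in> poly_funs coords"
  by (rule poly_funs.coord, auto simp: coords_def)

lemma poly_funs_coordG:
  assumes "f \<in> poly_funs coords3"
  shows "(\<lambda>(v, x). f v) \<in> poly_funs coordsG"
  using assms
proof induction
  case (coord f)
  then show ?case by (intro poly_funs.coord) (auto simp: coordsG_def)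
qed (auto simp: case_prod_unfold intro: poly_funs.intros)

lemma poly_funs_coordG':
  assumes "f \<in> poly_funs coords"
  shows "(\<lambda>(v, x). f x) \<in> poly_funs coordsG"
  using assms
proof induction
  case (coord f)
  then show ?case by (intro poly_funs.coord) (auto simp: coordsG_def)
qed (auto simp: case_prod_unfold intro: poly_funs.intros)

lemma forms3_mult:
  "f \<in> forms3 a b c \<Longrightarrow> g \<in> forms3 a' b' c' \<Longrightarrow> (\<lambda>x. f x * g x) \<in> forms3 (a + a') (b + b') (c + c')"
  by (auto simp: forms3_def power_add intro: poly_funs.mult)

lemma forms_mult: "f \<in> forms a \<Longrightarrow> g \<in> forms b \<Longrightarrow> (\<lambda>x. f x * g x) \<in> forms (a + b)"
  by (auto simp: forms_def power_add intro: poly_funs.mult)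

lemma formsG_mult:
  "f \<in> formsG a b c d \<Longrightarrow> g \<in> formsG a' b' c' d' \<Longrightarrow>
    (\<lambda>x. f x * g x) \<in> formsG (a + a') (b + b') (c + c') (d + d')"
  by (auto simp: formsG_def power_add intro: poly_funs.mult)

subsection \<open>Zariski topologies\<close>

text \<open>All three topologies have this shape, with \<open>r\<close> choosing representatives and
  \<open>\<Phi>\<close> the admissible forms, so their open sets, closed sets and closures are
  described only once.\<close>

definition zariski_of :: "('p \<Rightarrow> 'v) \<Rightarrow> (('v \<Rightarrow> complex) \<Rightarrow> bool) \<Rightarrow> 'p topology" where
  "zariski_of r \<Phi> = topology_generated_by {{p. f (r p) \<noteq> 0} | f. \<Phi> f}"

context
  fixes r :: "'p \<Rightarrow> 'v" and \<Phi> :: "('v \<Rightarrow> complex) \<Rightarrow> bool"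
  assumes one: "\<Phi> (\<lambda>_. 1)" and mult: "\<And>f g. \<Phi> f \<Longrightarrow> \<Phi> g \<Longrightarrow> \<Phi> (\<lambda>x. f x * g x)"
begin

text \<open>A product of admissible forms is admissible and is nonzero exactly where both factors
  are, so the basic sets survive intersections and a single form suffices at every point.\<close>

lemma openin_zariski_of:
  "openin (zariski_of r \<Phi>) T \<longleftrightarrow> (\<forall>x\<in>T. \<exists>f. \<Phi> f \<and> f (r x) \<noteq> 0 \<and> (\<forall>p. f (r p) \<noteq> 0 \<longrightarrow> p \<in> T))"
proof
  assume "openin (zariski_of r \<Phi>) T"
  then have "generate_topology_on {{p. f (r p) \<noteq> 0} | f. \<Phi> f} T"
    unfolding zariski_of_def openin_topology_generated_by_iff .
  then show "\<forall>x\<in>T. \<exists>f. \<Phi> f \<and> f (r x) \<noteq> 0 \<and> (\<forall>p. f (r p) \<noteq> 0 \<longrightarrow> p \<in> T)"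
  proof induction
    case (Int A B)
    show ?case
    proof
      fix x assume "x \<in> A \<inter> B"
      then obtain f g where "\<Phi> f" "f (r x) \<noteq> 0" "\<forall>p. f (r p) \<noteq> 0 \<longrightarrow> p \<in> A"
        "\<Phi> g" "g (r x) \<noteq> 0" "\<forall>p. g (r p) \<noteq> 0 \<longrightarrow> p \<in> B" using Int by blast
      then show "\<exists>f. \<Phi> f \<and> f (r x) \<noteq> 0 \<and> (\<forall>p. f (r p) \<noteq> 0 \<longrightarrow> p \<in> A \<inter> B)"
        by (intro exI[of _ "\<lambda>x. f x * g x"]) (auto intro: mult)
    qed
  next
    case (UN K)
    then show ?case by (meson Union_iff)
  qed auto
next
  assume T: "\<forall>x\<in>T. \<exists>f. \<Phi> f \<and> f (r x) \<noteq> 0 \<and> (\<forall>p. f (r p) \<noteq> 0 \<longrightarrow> p \<in> T)"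
  then have "T = \<Union>{{p. f (r p) \<noteq> 0} | f. \<Phi> f \<and> (\<forall>p. f (r p) \<noteq> 0 \<longrightarrow> p \<in> T)}"
    by blast
  moreover have "openin (zariski_of r \<Phi>) \<dots>"
    unfolding zariski_of_def
    by (intro openin_Union) (auto intro!: topology_generated_by_Basis)
  ultimately show "openin (zariski_of r \<Phi>) T" by simp
qed

lemma topspace_zariski_of: "topspace (zariski_of r \<Phi>) = UNIV"
proof -
  have "openin (zariski_of r \<Phi>) UNIV"
    unfolding openin_zariski_of using one by force
  then show ?thesis using openin_subset by blast
qed

lemma closedin_zariski_of:
  "closedin (zariski_of r \<Phi>) Z \<longleftrightarrow> (\<forall>x. x \<notin> Z \<longrightarrow> (\<exists>f. \<Phi> f \<and> f (r x) \<noteq> 0 \<and> (\<forall>p\<in>Z. f (r p) = 0)))"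
  unfolding closedin_def topspace_zariski_of openin_zariski_of by blast

lemma closure_zariski_of:
  "x \<in> zariski_of r \<Phi> closure_of S \<longleftrightarrow> (\<forall>f. \<Phi> f \<and> (\<forall>p\<in>S. f (r p) = 0) \<longrightarrow> f (r x) = 0)"
proof -
  have "x \<in> zariski_of r \<Phi> closure_of S \<longleftrightarrow>
      (\<forall>T. x \<in> T \<and> (\<forall>x\<in>T. \<exists>f. \<Phi> f \<and> f (r x) \<noteq> 0 \<and> (\<forall>p. f (r p) \<noteq> 0 \<longrightarrow> p \<in> T)) \<longrightarrow> (\<exists>y\<in>S. y \<in> T))"
    unfolding in_closure_of topspace_zariski_of openin_zariski_of Bex_def by simp
  also have "\<dots> \<longleftrightarrow> (\<forall>f. \<Phi> f \<and> (\<forall>p\<in>S. f (r p) = 0) \<longrightarrow> f (r x) = 0)" (is "?L \<longleftrightarrow> ?R")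
  proof
    assume L: ?L
    show ?R
    proof (intro allI impI, rule ccontr)
      fix f assume f: "\<Phi> f \<and> (\<forall>p\<in>S. f (r p) = 0)" "f (r x) \<noteq> 0"
      then show False using L[rule_format, of "{p. f (r p) \<noteq> 0}"] by blast
    qed
  next
    assume R: ?R
    show ?L
    proof (intro allI impI)
      fix T assume T: "x \<in> T \<and> (\<forall>x\<in>T. \<exists>f. \<Phi> f \<and> f (r x) \<noteq> 0 \<and> (\<forall>p. f (r p) \<noteq> 0 \<longrightarrow> p \<in> T))"
      then obtain f where "\<Phi> f" "f (r x) \<noteq> 0" "\<forall>p. f (r p) \<noteq> 0 \<longrightarrow> p \<in> T" by blast
      then show "\<exists>y\<in>S. y \<in> T" using R by blast
    qed
  qed
  finally show ?thesis .
qed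

end

lemma one_forms3: "(\<lambda>_. 1) \<in> forms3 0 0 0" by (auto simp: forms3_def intro: poly_funs.const)
lemma one_forms: "(\<lambda>_. 1) \<in> forms 0" by (auto simp: forms_def intro: poly_funs.const)
lemma one_formsG: "(\<lambda>_. 1) \<in> formsG 0 0 0 0" by (auto simp: formsG_def intro: poly_funs.const)

lemma forms3_closed:
  "\<exists>a b c. (\<lambda>_. 1) \<in> forms3 a b c"
  "(\<exists>a b c. f \<in> forms3 a b c) \<Longrightarrow> (\<exists>a b c. g \<in> forms3 a b c) \<Longrightarrow>
    \<exists>a b c. (\<lambda>x. f x * g x) \<in> forms3 a b c"
  by (intro exI, rule one_forms3) (elim exE, intro exI, rule forms3_mult)

lemma forms_closed:
  "\<exists>d. (\<lambda>_. 1) \<in> forms d"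
  "(\<exists>d. f \<in> forms d) \<Longrightarrow> (\<exists>d. g \<in> forms d) \<Longrightarrow> \<exists>d. (\<lambda>x. f x * g x) \<in> forms d"
  by (intro exI, rule one_forms) (elim exE, intro exI, rule forms_mult)

lemma formsG_closed:
  "\<exists>a b c d. (\<lambda>_. 1) \<in> formsG a b c d"
  "(\<exists>a b c d. f \<in> formsG a b c d) \<Longrightarrow> (\<exists>a b c d. g \<in> formsG a b c d) \<Longrightarrow>
    \<exists>a b c d. (\<lambda>x. f x * g x) \<in> formsG a b c d"
  by (intro exI, rule one_formsG) (elim exE, intro exI, rule formsG_mult)

lemma zariski3_eq: "zariski3 = zariski_of rep3 (\<lambda>f. \<exists>a b c. f \<in> forms3 a b c)"
  by (simp add: zariski3_def zariski_of_def)

lemma zariski_eq: "zariski = zariski_of rep (\<lambda>f. \<exists>d. f \<in> forms d)"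
  by (simp add: zariski_def zariski_of_def)

lemma zariskiG_eq: "zariskiG = zariski_of repG (\<lambda>f. \<exists>a b c d. f \<in> formsG a b c d)"
  by (simp add: zariskiG_def zariski_of_def)

lemma closedin_zariski3:
  "closedin zariski3 Z \<longleftrightarrow>
    (\<forall>x. x \<notin> Z \<longrightarrow> (\<exists>f. (\<exists>a b c. f \<in> forms3 a b c) \<and> f (rep3 x) \<noteq> 0 \<and> (\<forall>p\<in>Z. f (rep3 p) = 0)))"
  unfolding zariski3_eq
  by (rule closedin_zariski_of[OF forms3_closed])

lemma topspace_zariski3 [simp]: "topspace zariski3 = UNIV"
  unfolding zariski3_eq
  by (rule topspace_zariski_of[OF forms3_closed])

lemma closedin_zariski:
  "closedin zariski Z \<longleftrightarrow>
    (\<forall>x. x \<notin> Z \<longrightarrow> (\<exists>f. (\<exists>d. f \<in> forms d) \<and> f (rep x) \<noteq> 0 \<and> (\<forall>p\<in>Z. f (rep p) = 0)))"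
  unfolding zariski_eq
  by (rule closedin_zariski_of[OF forms_closed])

lemma openin_zariski:
  "openin zariski T \<longleftrightarrow>
    (\<forall>x\<in>T. \<exists>f. (\<exists>d. f \<in> forms d) \<and> f (rep x) \<noteq> 0 \<and> (\<forall>p. f (rep p) \<noteq> 0 \<longrightarrow> p \<in> T))"
  unfolding zariski_eq
  by (rule openin_zariski_of[OF forms_closed])

lemma topspace_zariski [simp]: "topspace zariski = UNIV"
  unfolding zariski_eq
  by (rule topspace_zariski_of[OF forms_closed])

lemma closure_zariskiG:
  "x \<in> zariskiG closure_of S \<longleftrightarrow>
    (\<forall>f. (\<exists>a b c d. f \<in> formsG a b c d) \<and> (\<forall>p\<in>S. f (repG p) = 0) \<longrightarrow> f (repG x) = 0)"
  unfolding zariskiG_eq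
  by (rule closure_zariski_of[OF formsG_closed])

lemma closedin_zeros3:
  assumes "\<And>f. f \<in> F \<Longrightarrow> \<exists>a b c. f \<in> forms3 a b c"
  shows "closedin zariski3 (zeros3 F)"
  unfolding closedin_zariski3 zeros3_def using assms by blast

lemma closedin_zeros:
  assumes "f \<in> forms d"
  shows "closedin zariski (zeros f)"
  unfolding closedin_zariski zeros_def using assms by blast

lemma proportional_vec:
  fixes x y :: "complex^'n"
  assumes "x \<noteq> 0" "y \<noteq> 0" "\<And>i j. x $ i * y $ j = x $ j * y $ i"
  shows "pt x = pt y"
proof -
  obtain i where i: "x $ i \<noteq> 0" using assms(1) by (auto simp: vec_eq_iff)
  have "y = (y $ i / x $ i) *s x"
    using i assms(3)[of i] by (auto simp: vec_eq_iff field_simps)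
  moreover from this have "y $ i / x $ i \<noteq> 0" using assms(2) by auto
  ultimately show ?thesis using assms pt_eq_iff by blast
qed

lemma closedin_zariski_sing: "closedin zariski {p}"
  unfolding closedin_zariski
proof (intro allI impI)
  fix x assume "x \<notin> {p}"
  then have "\<exists>i j. rep x $ i * rep p $ j \<noteq> rep x $ j * rep p $ i"
    using proportional_vec[of "rep x" "rep p"] by auto
  then obtain i j where ij: "rep x $ i * rep p $ j \<noteq> rep x $ j * rep p $ i" by blast
  let ?f = "\<lambda>v. v $ i * rep p $ j - (v $ j * rep p $ i)"
  have "?f \<in> forms 1"
    by (auto simp: forms_def algebra_simps intro!: poly_funs_diff poly_funs.mult poly_funs.const poly_funs_coord)
  then show "\<exists>f. (\<exists>d. f \<in> forms d) \<and> f (rep x) \<noteq> 0 \<and> (\<forall>p\<in>{p}. f (rep p) = 0)"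
    using ij by (intro exI[of _ ?f]) (auto simp: mult.commute)
qed

lemma linear_forms3:
  "(\<lambda>(s, t, u). x * s $ i - y * s $ j) \<in> forms3 1 0 0"
  "(\<lambda>(s, t, u). x * t $ i - y * t $ j) \<in> forms3 0 1 0"
  "(\<lambda>(s, t, u). x * u $ i - y * u $ j) \<in> forms3 0 0 1"
  unfolding forms3_def case_prod_unfold mem_Collect_eq
  by (intro conjI poly_funs_diff poly_funs.mult poly_funs.const
      poly_funs_coord3[unfolded case_prod_unfold]; simp add: algebra_simps)+

lemma closedin_zariski3_sing: "closedin zariski3 {p}"
  unfolding closedin_zariski3
proof (intro allI impI)
  fix x assume x: "x \<notin> {p}"
  obtain x1 x2 x3 p1 p2 p3 where xp: "x = (x1, x2, x3)" "p = (p1, p2, p3)" by (cases x, cases p) auto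
  have ne: "\<exists>i j. rep b $ j * rep a $ i - rep b $ i * rep a $ j \<noteq> 0" if "a \<noteq> b" for a b :: "2 cproj"
    using proportional_vec[of "rep a" "rep b"] that by (auto simp: mult.commute)
  have *: "\<exists>f. (\<exists>a b c. f \<in> forms3 a b c) \<and> f (rep3 x) \<noteq> 0 \<and> (\<forall>p\<in>{p}. f (rep3 p) = 0)"
    if "f \<in> forms3 a b c" "f (rep3 x) \<noteq> 0" "f (rep3 p) = 0" for f a b c
    using that by blast
  consider "x1 \<noteq> p1" | "x2 \<noteq> p2" | "x3 \<noteq> p3" using x xp by auto
  then show "\<exists>f. (\<exists>a b c. f \<in> forms3 a b c) \<and> f (rep3 x) \<noteq> 0 \<and> (\<forall>p\<in>{p}. f (rep3 p) = 0)"
  proof cases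
    case 1
    obtain i j where "rep p1 $ j * rep x1 $ i - rep p1 $ i * rep x1 $ j \<noteq> 0" using ne[OF 1] by blast
    then show ?thesis
      by (intro *[OF linear_forms3(1)[of "rep p1 $ j" i "rep p1 $ i" j]]) (simp_all add: xp)
  next
    case 2
    obtain i j where "rep p2 $ j * rep x2 $ i - rep p2 $ i * rep x2 $ j \<noteq> 0" using ne[OF 2] by blast
    then show ?thesis
      by (intro *[OF linear_forms3(2)[of "rep p2 $ j" i "rep p2 $ i" j]]) (simp_all add: xp)
  next
    case 3
    obtain i j where "rep p3 $ j * rep x3 $ i - rep p3 $ i * rep x3 $ j \<noteq> 0" using ne[OF 3] by blast
    then show ?thesis
      by (intro *[OF linear_forms3(3)[of "rep p3 $ j" i "rep p3 $ i" j]]) (simp_all add: xp)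
  qed
qed

subsection \<open>Irreducible closed sets\<close>

lemma finite_affine_zeros:
  fixes a b :: complex
  assumes "a + z0 * b \<noteq> 0"
  shows "finite {z. a + z * b = 0}"
proof -
  have "[:a, b:] \<noteq> 0" using assms by auto
  from poly_roots_finite[OF this] show ?thesis by simp
qed

lemma finite_affine_vec_zeros:
  fixes x y :: "complex^'n"
  assumes "x + z0 *s y \<noteq> 0"
  shows "finite {z. x + z *s y = 0}"
proof -
  obtain i where "x $ i + z0 * y $ i \<noteq> 0" using assms by (auto simp: vec_eq_iff)
  then have "finite {z. x $ i + z * y $ i = 0}" by (rule finite_affine_zeros)
  then show ?thesis by (rule finite_subset[rotated]) (auto simp: vec_eq_iff)
qed

lemma finite_not_nz3_line:
  assumes "nz3 (line3 v w z0)"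
  shows "finite {z. \<not> nz3 (line3 v w z)}"
proof -
  obtain x y z x' y' z' where vw: "v = (x, y, z)" "w = (x', y', z')" by (cases v, cases w) auto
  have "{z. \<not> nz3 (line3 v w z)} = {l. x + l *s x' = 0} \<union> {l. y + l *s y' = 0} \<union> {l. z + l *s z' = 0}"
    by (auto simp: vw)
  then show ?thesis using assms by (auto simp: vw intro: finite_affine_vec_zeros)
qed

lemma finite_zeros_line:
  assumes "f \<in> poly_funs coords3" "f (line3 v w z0) \<noteq> 0"
  shows "finite {z. f (line3 v w z) = 0}"
proof -
  obtain p where p: "\<And>z. f (line3 v w z) = poly p z"
    using poly_on_line3[OF assms(1)] by metis
  then have "p \<noteq> 0" using assms(2) by auto
  from poly_roots_finite[OF this] show ?thesis by (simp add: p)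
qed

lemma forms3_poly: "f \<in> forms3 a b c \<Longrightarrow> f \<in> poly_funs coords3"
  by (simp add: forms3_def)

lemma ex_not_in_finite: "finite (S :: complex set) \<Longrightarrow> \<exists>z. z \<notin> S"
  using ex_new_if_finite infinite_UNIV_char_0 by blast

lemma line3_0 [simp]: "line3 v w 0 = v"
  by (cases v; cases w) auto

text \<open>If closed sets \<open>A\<close> and \<open>B\<close> covered the closure with neither
  being all of it, there would be \<open>p\<close> in \<open>G\<close> outside \<open>A\<close> and
  \<open>q\<close> in \<open>G\<close> outside \<open>B\<close>, witnessed by forms \<open>f\<close>
  and \<open>g\<close>. Along the line from \<open>p\<close> to \<open>q\<close> both restrict to
  nonzero polynomials, so some point of the line, still in \<open>G\<close>, avoids both zero
  sets.\<close>

lemma irreducible_closure_lines: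
  assumes ne: "G \<noteq> {}"
    and line: "\<And>p q. p \<in> G \<Longrightarrow> q \<in> G \<Longrightarrow> \<exists>v w. nz3 v \<and> nz3 (line3 v w 1) \<and> pt3 v = p \<and>
      pt3 (line3 v w 1) = q \<and> (\<forall>z. nz3 (line3 v w z) \<longrightarrow> pt3 (line3 v w z) \<in> G)"
  shows "irreducible_closed zariski3 (zariski3 closure_of G)"
proof -
  let ?K = "zariski3 closure_of G"
  have sub: "G \<subseteq> ?K" by (simp add: closure_of_subset)
  have "?K = A \<or> ?K = B" if A: "closedin zariski3 A" and B: "closedin zariski3 B" and AB: "?K = A \<union> B" for A B
  proof (rule ccontr)
    assume "\<not> (?K = A \<or> ?K = B)"
    then have "\<not> G \<subseteq> A" "\<not> G \<subseteq> B"
      using closure_of_minimal[OF _ A, of G] closure_of_minimal[OF _ B, of G] AB by auto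
    then obtain p q where p: "p \<in> G" "p \<notin> A" and q: "q \<in> G" "q \<notin> B" by blast
    obtain f a b c where f: "f \<in> forms3 a b c" "f (rep3 p) \<noteq> 0" "\<forall>x\<in>A. f (rep3 x) = 0"
      using A p closedin_zariski3 by blast
    obtain g a' b' c' where g: "g \<in> forms3 a' b' c'" "g (rep3 q) \<noteq> 0" "\<forall>x\<in>B. g (rep3 x) = 0"
      using B q closedin_zariski3 by blast
    obtain v w where vw: "nz3 v" "nz3 (line3 v w 1)" "pt3 v = p" "pt3 (line3 v w 1) = q"
      "\<forall>z. nz3 (line3 v w z) \<longrightarrow> pt3 (line3 v w z) \<in> G" using line[OF p(1) q(1)] by blast
    have f0: "f (line3 v w 0) \<noteq> 0" using forms3_pt3[OF f(1) vw(1)] f(2) vw(3) by simp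
    have g1: "g (line3 v w 1) \<noteq> 0" using forms3_pt3[OF g(1) vw(2)] g(2) vw(4) by simp
    \<comment> \<open>Besides the zeros of both polynomials, the parameters at which one factor
      becomes the zero vector must be avoided, since they give no point.\<close>
    have "finite ({z. f (line3 v w z) = 0} \<union> {z. g (line3 v w z) = 0} \<union> {z. \<not> nz3 (line3 v w z)})"
      by (intro finite_UnI finite_zeros_line[OF forms3_poly[OF f(1)] f0]
          finite_zeros_line[OF forms3_poly[OF g(1)] g1] finite_not_nz3_line[OF vw(2)])
    from ex_not_in_finite[OF this] obtain z
      where z: "f (line3 v w z) \<noteq> 0" "g (line3 v w z) \<noteq> 0" "nz3 (line3 v w z)" by auto
    have "pt3 (line3 v w z) \<in> A \<union> B" using vw(5) z(3) sub AB by blast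
    then show False
    proof
      assume "pt3 (line3 v w z) \<in> A"
      then show False using f(3) forms3_pt3[OF f(1) z(3)] z(1) by blast
    next
      assume "pt3 (line3 v w z) \<in> B"
      then show False using g(3) forms3_pt3[OF g(1) z(3)] z(2) by blast
    qed
  qed
  then show ?thesis unfolding irreducible_closed_def using ne sub by auto
qed

lemma irreducible_closed_sing:
  assumes "closedin X {p}"
  shows "irreducible_closed X {p}"
  unfolding irreducible_closed_def using assms by blast

text \<open>Forms restricted to an irreducible set have no zero divisors, because the zero sets of
  \<open>f\<close> and \<open>g\<close> would split \<open>Z\<close>.\<close>

lemma irreducible_forms3_mult:
  assumes Z: "irreducible_closed zariski3 Z" and f: "f \<in> forms3 a b c" and g: "g \<in> forms3 a' b' c'"
    and fg: "\<And>p. p \<in> Z \<Longrightarrow> f (rep3 p) * g (rep3 p) = 0"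
  shows "(\<forall>p\<in>Z. f (rep3 p) = 0) \<or> (\<forall>p\<in>Z. g (rep3 p) = 0)"
proof -
  have "closedin zariski3 (Z \<inter> zeros3 {f})" "closedin zariski3 (Z \<inter> zeros3 {g})"
    using Z f g closedin_zeros3[of "{f}"] closedin_zeros3[of "{g}"]
    by (auto simp: irreducible_closed_def intro!: closedin_Int)
  moreover have "Z = (Z \<inter> zeros3 {f}) \<union> (Z \<inter> zeros3 {g})" using fg by (auto simp: zeros3_def)
  ultimately have "Z = Z \<inter> zeros3 {f} \<or> Z = Z \<inter> zeros3 {g}"
    using Z unfolding irreducible_closed_def by blast
  then show ?thesis by (auto simp: zeros3_def)
qed

lemma irreducible_closed_UNIV: "irreducible_closed zariski3 UNIV"
proof -
  have "irreducible_closed zariski3 (zariski3 closure_of UNIV)"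
  proof (rule irreducible_closure_lines)
    fix p q :: P1_3
    obtain p1 p2 p3 q1 q2 q3 where pq: "p = (p1, p2, p3)" "q = (q1, q2, q3)" by (cases p, cases q) auto
    show "\<exists>v w. nz3 v \<and> nz3 (line3 v w 1) \<and> pt3 v = p \<and> pt3 (line3 v w 1) = q \<and>
        (\<forall>z. nz3 (line3 v w z) \<longrightarrow> pt3 (line3 v w z) \<in> UNIV)"
      by (rule exI[of _ "rep3 p"], rule exI[of _ "(rep q1 - rep p1, rep q2 - rep p2, rep q3 - rep p3)"])
        (simp add: pq)
  qed simp
  then show ?thesis using closure_of_topspace[of zariski3] by simp
qed

subsection \<open>Krull dimension\<close>

lemma krull_dim_le:
  assumes "\<And>Z. (\<forall>i\<le>Suc n. irreducible_closed X (Z i)) \<Longrightarrow> (\<forall>i<Suc n. Z i \<subset> Z (Suc i)) \<Longrightarrow> False"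
  shows "krull_dim X \<le> enat n"
  unfolding krull_dim_def
proof (rule Sup_least)
  fix x assume "x \<in> {enat n |n. \<exists>Z. (\<forall>i\<le>n. irreducible_closed X (Z i)) \<and> (\<forall>i<n. Z i \<subset> Z (Suc i))}"
  then obtain m Z where m: "x = enat m" "\<forall>i\<le>m. irreducible_closed X (Z i)" "\<forall>i<m. Z i \<subset> Z (Suc i)" by auto
  have "m \<le> n"
  proof (rule ccontr)
    assume "\<not> m \<le> n"
    then show False using assms[of Z] m(2,3) by auto
  qed
  then show "x \<le> enat n" using m(1) by simp
qed

lemma le_krull_dim:
  assumes "\<forall>i\<le>n. irreducible_closed X (Z i)" "\<forall>i<n. Z i \<subset> Z (Suc i)"
  shows "enat n \<le> krull_dim X"
  unfolding krull_dim_def by (rule Sup_upper) (use assms in auto)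

lemma irreducible_closed_subtopology:
  assumes "closedin X S"
  shows "irreducible_closed (subtopology X S) Z \<longleftrightarrow> irreducible_closed X Z \<and> Z \<subseteq> S"
  unfolding irreducible_closed_def closedin_closed_subtopology[OF assms] by blast

section \<open>Independence of monomials along a chain of irreducible sets\<close>

lemma linear_system_nontrivial:
  fixes a :: "'j \<Rightarrow> 'i \<Rightarrow> 'f::field"
  assumes "finite J" "finite I" "card J < card I"
  shows "\<exists>c. (\<exists>i\<in>I. c i \<noteq> 0) \<and> (\<forall>j\<in>J. (\<Sum>i\<in>I. a j i * c i) = 0)"
  using assms
proof (induction J arbitrary: I a rule: finite_induct)
  case empty
  then have "I \<noteq> {}" by auto
  then show ?case by (intro exI[of _ "\<lambda>_. 1"]) auto
next
  case (insert j J)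
  show ?case
  proof (cases "\<forall>i\<in>I. a j i = 0")
    case True
    obtain c where "\<exists>i\<in>I. c i \<noteq> 0" "\<forall>k\<in>J. (\<Sum>i\<in>I. a k i * c i) = 0"
      using insert.IH[of I a] insert.prems insert.hyps by auto
    then show ?thesis using True by (intro exI[of _ c]) auto
  next
    case False
    then obtain i0 where i0: "i0 \<in> I" "a j i0 \<noteq> 0" by blast
    define I' where "I' = I - {i0}"
    \<comment> \<open>Elimination with pivot \<open>a j i0\<close>: row \<open>j\<close> removes the
      unknown \<open>i0\<close> from the other rows.\<close>
    define b where "b k i = a k i - a k i0 * a j i / a j i0" for k i
    have "card J < card I'" using insert.prems insert.hyps i0 by (simp add: I'_def)
    then obtain c where c: "\<exists>i\<in>I'. c i \<noteq> 0" "\<forall>k\<in>J. (\<Sum>i\<in>I'. b k i * c i) = 0"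
      using insert.IH[of I' b] insert.prems by (auto simp: I'_def)
    \<comment> \<open>Back substitution: the value at \<open>i0\<close> is the one that makes row
      \<open>j\<close> vanish.\<close>
    define c' where "c' i = (if i = i0 then - (\<Sum>i\<in>I'. a j i * c i) / a j i0 else c i)" for i
    have I: "I = insert i0 I'" "i0 \<notin> I'" "finite I'" using i0 insert.prems by (auto simp: I'_def)
    have s: "(\<Sum>i\<in>I. a k i * c' i) = (\<Sum>i\<in>I'. a k i * c i) - a k i0 * (\<Sum>i\<in>I'. a j i * c i) / a j i0" for k
    proof -
      have "(\<Sum>i\<in>I'. a k i * c' i) = (\<Sum>i\<in>I'. a k i * c i)"
        using I(2) by (intro sum.cong) (auto simp: c'_def)
      then show ?thesis using I by (simp add: c'_def)
    qed
    have "(\<Sum>i\<in>I. a k i * c' i) = 0" if "k \<in> insert j J" for k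
    proof (cases "k = j")
      case True
      then show ?thesis using i0 by (simp add: s)
    next
      case False
      then have "0 = (\<Sum>i\<in>I'. b k i * c i)" using c(2) that by auto
      also have "\<dots> = (\<Sum>i\<in>I'. a k i * c i) - a k i0 * (\<Sum>i\<in>I'. a j i * c i) / a j i0"
        by (simp add: b_def sum_subtractf sum_distrib_left sum_divide_distrib algebra_simps)
      finally show ?thesis by (simp add: s)
    qed
    moreover have "\<exists>i\<in>I. c' i \<noteq> 0" using c(1) I by (auto simp: c'_def)
    ultimately show ?thesis by blast
  qed
qed

text \<open>The monomials of degree at most \<open>N\<close> in each \<open>f i\<close>, homogenised by \<open>h\<close>.\<close>

fun mon :: "(nat \<Rightarrow> 'v \<Rightarrow> complex) \<Rightarrow> ('v \<Rightarrow> complex) \<Rightarrow> nat \<Rightarrow> nat list \<Rightarrow> 'v \<Rightarrow> complex" where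
  "mon f h N [] v = 1"
| "mon f h N (k # e) v = f (length e) v ^ k * h v ^ (N - k) * mon f h N e v"

definition exponents :: "nat \<Rightarrow> nat \<Rightarrow> nat list set" where
  "exponents N n = {e. set e \<subseteq> {..N} \<and> length e = n}"

lemma finite_exponents [simp]: "finite (exponents N n)"
  by (simp add: exponents_def finite_lists_length_eq)

lemma card_exponents: "card (exponents N n) = (N + 1) ^ n"
  by (simp add: exponents_def card_lists_length_eq)

text \<open>By the recursion of \<open>mon\<close> the head of an exponent list belongs to the form
  with the largest index. Splitting it off writes a combination of monomials as a polynomial in
  \<open>f n\<close>.\<close>

lemma sum_exponents_Suc: "sum F (exponents N (Suc n)) = (\<Sum>k\<le>N. \<Sum>e\<in>exponents N n. F (k # e))"
proof -
  have inj: "inj_on (\<lambda>(e, k). k # e) (exponents N n \<times> {..N})"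
    by (rule inj_onI) (simp only: case_prod_unfold list.inject prod_eq_iff)
  have "exponents N (Suc n) = (\<lambda>(e, k). k # e) ` (exponents N n \<times> {..N})"
    unfolding exponents_def by (rule lists_length_Suc_eq)
  then have "sum F (exponents N (Suc n)) = (\<Sum>(e, k)\<in>exponents N n \<times> {..N}. F (k # e))"
    using sum.reindex[OF inj, of F] by (simp only: o_def case_prod_unfold)
  also have "\<dots> = (\<Sum>e\<in>exponents N n. \<Sum>k\<le>N. F (k # e))"
    by (rule sum.cartesian_product[symmetric])
  also have "\<dots> = (\<Sum>k\<le>N. \<Sum>e\<in>exponents N n. F (k # e))" by (rule sum.swap)
  finally show ?thesis .
qed

lemma forms3_power:
  assumes "f \<in> forms3 a b c"
  shows "(\<lambda>x. f x ^ n) \<in> forms3 (n * a) (n * b) (n * c)"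
proof (induction n)
  case 0
  show ?case using one_forms3 by simp
next
  case (Suc n)
  from forms3_mult[OF assms Suc.IH] show ?case by (simp only: power_Suc mult_Suc)
qed

lemma forms3_scale:
  assumes "f \<in> forms3 a b c"
  shows "(\<lambda>x. l * f x) \<in> forms3 a b c"
proof -
  have "(\<lambda>_. l) \<in> forms3 0 0 0" by (simp add: forms3_def poly_funs.const)
  from forms3_mult[OF this assms] show ?thesis by simp
qed

lemma forms3_sum:
  assumes "\<And>i. i \<in> I \<Longrightarrow> f i \<in> forms3 a b c"
  shows "(\<lambda>x. \<Sum>i\<in>I. f i x) \<in> forms3 a b c"
  using assms by (auto simp: forms3_def sum_distrib_left intro!: poly_funs_sum)

text \<open>The complementary powers of \<open>h\<close> make every entry of \<open>e\<close>
  contribute degree \<open>N * d\<close>, whatever its value; thus all monomials have the same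
  multidegree and may be added.\<close>

lemma mon_forms3:
  assumes "\<And>i. i < length e \<Longrightarrow> f i \<in> forms3 d d d" "h \<in> forms3 d d d" "set e \<subseteq> {..N}"
  shows "mon f h N e \<in> forms3 (length e * N * d) (length e * N * d) (length e * N * d)"
  using assms
proof (induction e)
  case Nil
  then show ?case using one_forms3 by simp
next
  case (Cons k e)
  have "f (length e) \<in> forms3 d d d" using Cons.prems(1) by simp
  from forms3_mult[OF forms3_mult[OF forms3_power[OF this] forms3_power[OF Cons.prems(2)]] Cons.IH]
  have "(\<lambda>v. f (length e) v ^ k * h v ^ (N - k) * mon f h N e v) \<in>
    forms3 (k * d + (N - k) * d + length e * N * d) (k * d + (N - k) * d + length e * N * d)
      (k * d + (N - k) * d + length e * N * d)" using Cons.prems by simp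
  moreover have "k * d + (N - k) * d + length e * N * d = length (k # e) * N * d"
    using Cons.prems(3) by (simp add: algebra_simps flip: add_mult_distrib)
  moreover have "mon f h N (k # e) = (\<lambda>v. f (length e) v ^ k * h v ^ (N - k) * mon f h N e v)"
    by (rule ext) simp
  ultimately show ?case by (simp only:)
qed

text \<open>Regard a relation on \<open>Z (Suc n)\<close> as a polynomial in \<open>f n\<close> with
  coefficients \<open>G k\<close>. Since \<open>f n\<close> vanishes on \<open>Z n\<close> but not
  on the irreducible \<open>Z (Suc n)\<close>, its powers can be cancelled there, and restricting to
  \<open>Z n\<close> then isolates the lowest coefficient. So all \<open>G k\<close> vanish on
  \<open>Z n\<close>, where the induction hypothesis applies.\<close>

lemma monomials_independent:
  assumes irr: "\<And>i. i \<le> n \<Longrightarrow> irreducible_closed zariski3 (Z i)"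
    and sub: "\<And>i. i < n \<Longrightarrow> Z i \<subseteq> Z (Suc i)"
    and f: "\<And>i. i < n \<Longrightarrow> f i \<in> forms3 d d d"
    and fz: "\<And>i p. i < n \<Longrightarrow> p \<in> Z i \<Longrightarrow> f i (rep3 p) = 0"
    and fnz: "\<And>i. i < n \<Longrightarrow> \<exists>p\<in>Z (Suc i). f i (rep3 p) \<noteq> 0"
    and h: "h \<in> forms3 d d d" and hnz: "\<exists>p\<in>Z 0. h (rep3 p) \<noteq> 0"
    and zero: "\<And>p. p \<in> Z n \<Longrightarrow> (\<Sum>e\<in>exponents N n. c e * mon f h N e (rep3 p)) = 0"
    and e: "e \<in> exponents N n"
  shows "c e = 0"
  using irr sub f fz fnz zero e
proof (induction n arbitrary: c e)
  case 0
  then have "e = []" by (simp add: exponents_def)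
  moreover have "exponents N 0 = {[]}" by (auto simp: exponents_def)
  ultimately show ?case using 0(6) hnz by auto
next
  case (Suc n)
  define G where "G k v = (\<Sum>e\<in>exponents N n. c (k # e) * mon f h N e v)" for k v
  have G: "G k \<in> forms3 (n * N * d) (n * N * d) (n * N * d)" for k
    unfolding G_def
  proof (rule forms3_sum, rule forms3_scale)
    fix e assume "e \<in> exponents N n"
    then have e: "length e = n" "set e \<subseteq> {..N}" by (simp_all add: exponents_def)
    have "f i \<in> forms3 d d d" if "i < length e" for i using Suc.prems(3) e(1) that by simp
    from mon_forms3[OF this h e(2)]
    show "mon f h N e \<in> forms3 (n * N * d) (n * N * d) (n * N * d)" unfolding e(1) .
  qed
  have total: "(\<Sum>k\<le>N. f n (rep3 p) ^ k * h (rep3 p) ^ (N - k) * G k (rep3 p)) = 0" if "p \<in> Z (Suc n)" for p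
  proof -
    have "(\<Sum>k\<le>N. \<Sum>e\<in>exponents N n. c (k # e) * mon f h N (k # e) (rep3 p)) = 0"
      using Suc.prems(6)[OF that] by (simp only: sum_exponents_Suc)
    also have "(\<Sum>k\<le>N. \<Sum>e\<in>exponents N n. c (k # e) * mon f h N (k # e) (rep3 p)) =
      (\<Sum>k\<le>N. f n (rep3 p) ^ k * h (rep3 p) ^ (N - k) * G k (rep3 p))"
    proof (rule sum.cong[OF refl])
      fix k
      show "(\<Sum>e\<in>exponents N n. c (k # e) * mon f h N (k # e) (rep3 p)) =
          f n (rep3 p) ^ k * h (rep3 p) ^ (N - k) * G k (rep3 p)"
        unfolding G_def sum_distrib_left
        by (rule sum.cong[OF refl]) (simp add: exponents_def)
    qed
    finally show ?thesis .
  qed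
  have Zn: "irreducible_closed zariski3 (Z n)" "irreducible_closed zariski3 (Z (Suc n))"
    using Suc.prems(1) by auto
  have "Z 0 \<subseteq> Z i" if "i \<le> n" for i
    using that
  proof (induction i)
    case (Suc i)
    then show ?case using Suc.prems Suc.IH \<open>\<And>i. i < Suc n \<Longrightarrow> Z i \<subseteq> Z (Suc i)\<close>[of i] by simp
  qed simp
  then have hn: "\<exists>p\<in>Z n. h (rep3 p) \<noteq> 0" using hnz by blast
  have "\<forall>e\<in>exponents N n. c (k # e) = 0" if "k \<le> N" for k
    using that
  proof (induction k rule: less_induct)
    case (less k)
    \<comment> \<open>What remains of the relation once the coefficients below \<open>k\<close> are
      known to be zero and \<open>f n ^ k\<close> is divided out.\<close>
    define R where "R v = (\<Sum>j\<in>{k..N}. f n v ^ (j - k) * h v ^ (N - j) * G j v)" for v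
    have R: "R \<in> forms3 ((N - k) * d + n * N * d) ((N - k) * d + n * N * d) ((N - k) * d + n * N * d)"
      unfolding R_def
    proof (rule forms3_sum)
      fix j assume j: "j \<in> {k..N}"
      have "(j - k) * d + (N - j) * d = (N - k) * d" using j by (simp flip: add_mult_distrib)
      then show "(\<lambda>v. f n v ^ (j - k) * h v ^ (N - j) * G j v) \<in>
          forms3 ((N - k) * d + n * N * d) ((N - k) * d + n * N * d) ((N - k) * d + n * N * d)"
        using forms3_mult[OF forms3_mult[OF forms3_power[OF Suc.prems(3)[of n]] forms3_power[OF h]] G,
            of "j - k" "N - j" j] by simp
    qed
    have "f n (rep3 p) ^ k * R (rep3 p) = 0" if "p \<in> Z (Suc n)" for p
    proof -
      have "0 = (\<Sum>j\<le>N. f n (rep3 p) ^ j * h (rep3 p) ^ (N - j) * G j (rep3 p))"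
        using total[OF that] by simp
      also have "\<dots> = (\<Sum>j\<in>{k..N}. f n (rep3 p) ^ j * h (rep3 p) ^ (N - j) * G j (rep3 p))"
      proof (rule sum.mono_neutral_right)
        show "\<forall>j\<in>{..N} - {k..N}. f n (rep3 p) ^ j * h (rep3 p) ^ (N - j) * G j (rep3 p) = 0"
          using less.IH by (auto simp: G_def)
      qed auto
      also have "\<dots> = (\<Sum>j\<in>{k..N}. f n (rep3 p) ^ k * (f n (rep3 p) ^ (j - k) * h (rep3 p) ^ (N - j) * G j (rep3 p)))"
        by (intro sum.cong refl) (simp add: mult.assoc[symmetric] flip: power_add)
      also have "\<dots> = f n (rep3 p) ^ k * R (rep3 p)"
        unfolding R_def sum_distrib_left ..
      finally show ?thesis by simp
    qed
    from irreducible_forms3_mult[OF Zn(2) forms3_power[OF Suc.prems(3)[of n]] R this]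
    have "\<forall>p\<in>Z (Suc n). R (rep3 p) = 0"
      using Suc.prems(5)[of n] by auto
    then have "h (rep3 p) ^ (N - k) * G k (rep3 p) = 0" if "p \<in> Z n" for p
    proof -
      have "0 = R (rep3 p)" using \<open>\<forall>p\<in>Z (Suc n). R (rep3 p) = 0\<close> that Suc.prems(2)[of n] by auto
      \<comment> \<open>On \<open>Z n\<close> the form \<open>f n\<close> is zero, so only the
        summand \<open>j = k\<close>, in which its exponent is 0, survives.\<close>
      also have "\<dots> = (\<Sum>j\<in>{k}. f n (rep3 p) ^ (j - k) * h (rep3 p) ^ (N - j) * G j (rep3 p))"
        unfolding R_def using less.prems Suc.prems(4)[of n p] that
        by (intro sum.mono_neutral_right) auto
      finally show ?thesis by simp
    qed
    from irreducible_forms3_mult[OF Zn(1) forms3_power[OF h] G this]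
    have "\<forall>p\<in>Z n. G k (rep3 p) = 0" using hn by auto
    then show ?case using Suc.IH[of "\<lambda>e. c (k # e)"] Suc.prems by (simp add: G_def)
  qed
  then show ?case using Suc.prems(7) by (cases e) (auto simp: exponents_def)
qed

section \<open>Interpolation on a grid and the length of chains\<close>

lemma poly_zero_if_many_zeros:
  fixes p :: "complex poly"
  assumes "degree p \<le> M" "\<And>i. i \<le> M \<Longrightarrow> poly p (of_nat i) = 0"
  shows "p = 0"
proof (rule ccontr)
  assume "p \<noteq> 0"
  have "of_nat ` {..M} \<subseteq> {x. poly p x = 0}" using assms(2) by auto
  then have "card (of_nat ` {..M} :: complex set) \<le> card {x. poly p x = 0}"
    using poly_roots_finite[OF \<open>p \<noteq> 0\<close>] by (rule card_mono[rotated])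
  also have "\<dots> \<le> degree p" by (rule card_poly_roots_bound[OF \<open>p \<noteq> 0\<close>])
  finally have "card {..M} \<le> degree p" by (simp add: card_image inj_on_def)
  then show False using assms(1) by simp
qed

text \<open>The grid has \<open>M + 1\<close> values in each direction, more than a nonzero
  polynomial of degree \<open>M\<close> has zeros, so the three variables can be freed one after the
  other.\<close>

lemma vanishes_off_grid:
  fixes F :: "complex \<Rightarrow> complex \<Rightarrow> complex \<Rightarrow> complex"
  assumes x: "\<And>y z. \<exists>p. degree p \<le> M \<and> (\<forall>x. F x y z = poly p x)"
    and y: "\<And>x z. \<exists>p. degree p \<le> M \<and> (\<forall>y. F x y z = poly p y)"
    and z: "\<And>x y. \<exists>p. degree p \<le> M \<and> (\<forall>z. F x y z = poly p z)"
    and grid: "\<And>i j k. i \<le> M \<Longrightarrow> j \<le> M \<Longrightarrow> k \<le> M \<Longrightarrow> F (of_nat i) (of_nat j) (of_nat k) = 0"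
  shows "F a b c = 0"
proof -
  have 1: "F a (of_nat j) (of_nat k) = 0" if jk: "j \<le> M" "k \<le> M" for j k
  proof -
    obtain p where p: "degree p \<le> M" "\<And>x. F x (of_nat j) (of_nat k) = poly p x"
      using x[of "of_nat j" "of_nat k"] by blast
    have "p = 0" by (rule poly_zero_if_many_zeros[OF p(1)]) (simp add: grid jk flip: p(2))
    then show ?thesis by (simp add: p(2))
  qed
  have 2: "F a b (of_nat k) = 0" if k: "k \<le> M" for k
  proof -
    obtain p where p: "degree p \<le> M" "\<And>y. F a y (of_nat k) = poly p y"
      using y[of a "of_nat k"] by blast
    have "p = 0" by (rule poly_zero_if_many_zeros[OF p(1)]) (simp add: 1 k flip: p(2))
    then show ?thesis by (simp add: p(2))
  qed
  obtain p where p: "degree p \<le> M" "\<And>z. F a b z = poly p z" using z[of a b] by blast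
  have "p = 0" by (rule poly_zero_if_many_zeros[OF p(1)]) (simp add: 2 flip: p(2))
  then show ?thesis by (simp add: p(2))
qed

definition chart :: "complex \<Rightarrow> complex \<Rightarrow> complex \<Rightarrow> vec_3" where
  "chart x y z = (hpair 1 x, hpair 1 y, hpair 1 z)"

lemma hpair_nth [simp]: "hpair a b $ 0 = a" "hpair a b $ 1 = b"
  by (simp_all add: hpair_def)

lemma chart_line:
  "chart x y z = line3 (chart 0 y z) (hpair 0 1, 0, 0) x"
  "chart x y z = line3 (chart x 0 z) (0, hpair 0 1, 0) y"
  "chart x y z = line3 (chart x y 0) (0, 0, hpair 0 1) z"
  by (simp_all add: chart_def vec2_eq_iff)

text \<open>Adding \<open>z\<close> to the first coordinate in every factor makes these coordinates
  nonzero for almost all \<open>z\<close>, and homogeneity rescales the result into the chart. If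
  \<open>F v\<close> were nonzero, \<open>F\<close> would still be nonzero for almost all
  \<open>z\<close>.\<close>

lemma forms3_vanish_chart:
  assumes F: "F \<in> forms3 a b c" and chart: "\<And>x y z. F (chart x y z) = 0"
  shows "F v = 0"
proof (rule ccontr)
  assume nz: "F v \<noteq> 0"
  obtain r q u where v: "v = (r, q, u)" by (cases v) auto
  let ?e = "hpair 1 0"
  have "finite {z. F (line3 v (?e, ?e, ?e) z) = 0}"
    by (rule finite_zeros_line[OF forms3_poly[OF F], of _ _ 0]) (simp add: nz)
  then have "finite ({z. F (line3 v (?e, ?e, ?e) z) = 0} \<union> {- (r $ 0), - (q $ 0), - (u $ 0)})" by simp
  from ex_not_in_finite[OF this] obtain z where z: "F (line3 v (?e, ?e, ?e) z) \<noteq> 0"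
    "r $ 0 + z \<noteq> 0" "q $ 0 + z \<noteq> 0" "u $ 0 + z \<noteq> 0" by (auto simp: eq_neg_iff_add_eq_0 add.commute)
  have e: "x + z *s ?e = (x $ 0 + z) *s hpair 1 (x $ 1 / (x $ 0 + z))" if "x $ 0 + z \<noteq> 0" for x
  proof -
    have "c *s hpair 1 (y / c) = hpair c y" if "c \<noteq> 0" for c y
      using that by (simp add: vec2_eq_iff)
    from this[OF that] show ?thesis by (simp add: vec2_eq_iff)
  qed
  have "F (line3 v (?e, ?e, ?e) z) = 0"
  proof -
    have "F (l *s x, m *s y, n *s t) = l ^ a * m ^ b * n ^ c * F (x, y, t)" for l m n x y t
      using F by (simp add: forms3_def)
    then show ?thesis
      unfolding v line3.simps e[OF z(2)] e[OF z(3)] e[OF z(4)]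
      by (simp only: chart[unfolded chart_def] mult_zero_right)
  qed
  then show False using z(1) by simp
qed

text \<open>An exponent \<open>k\<close> contributes degree at most \<open>k * K\<close> from its
  form and \<open>(N - k) * K\<close> from the power of \<open>h\<close>, so the bound does not
  depend on the exponents.\<close>

lemma mon_line:
  assumes "\<And>i v w. i < length e \<Longrightarrow> \<exists>p. degree p \<le> K \<and> (\<forall>z. f i (line3 v w z) = poly p z)"
    and "\<And>v w. \<exists>p. degree p \<le> K \<and> (\<forall>z. h (line3 v w z) = poly p z)"
    and "set e \<subseteq> {..N}"
  shows "\<exists>p. degree p \<le> length e * N * K \<and> (\<forall>z. mon f h N e (line3 v w z) = poly p z)"
  using assms
proof (induction e)
  case Nil
  show ?case by (rule exI[of _ 1]) simp
next
  case (Cons k e)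
  obtain p where p: "degree p \<le> K" "\<And>z. f (length e) (line3 v w z) = poly p z"
    using Cons.prems(1)[of "length e" v w] by auto
  obtain q where q: "degree q \<le> K" "\<And>z. h (line3 v w z) = poly q z"
    using Cons.prems(2)[of v w] by auto
  have "\<exists>p. degree p \<le> length e * N * K \<and> (\<forall>z. mon f h N e (line3 v w z) = poly p z)"
    using Cons.prems by (intro Cons.IH) auto
  then obtain r where r: "degree r \<le> length e * N * K" "\<And>z. mon f h N e (line3 v w z) = poly r z"
    by blast
  have "degree (p ^ k * q ^ (N - k) * r) \<le> (degree p * k + degree q * (N - k)) + degree r"
    by (intro order.trans[OF degree_mult_le] add_mono degree_power_le order.refl)
  also have "\<dots> \<le> (K * k + K * (N - k)) + length e * N * K"
    by (intro add_mono mult_mono p q r) auto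
  also have "\<dots> = length (k # e) * N * K"
  proof -
    have "K * k + K * (N - k) = K * (k + (N - k))" by (rule add_mult_distrib2[symmetric])
    also have "k + (N - k) = N" using Cons.prems(3) by simp
    finally show ?thesis by (simp add: algebra_simps)
  qed
  finally show ?case by (intro exI[of _ "p ^ k * q ^ (N - k) * r"]) (simp add: p q r)
qed

lemma coord_forms3:
  "(\<lambda>(s, t, u). s $ i) \<in> forms3 1 0 0" "(\<lambda>(s, t, u). t $ i) \<in> forms3 0 1 0"
  "(\<lambda>(s, t, u). u $ i) \<in> forms3 0 0 1"
  unfolding forms3_def by (simp_all add: poly_funs_coord3)

text \<open>The grid size \<open>M\<close> grows linearly with \<open>N\<close>, so
  \<open>(N + 1) ^ 4\<close> monomials eventually outnumber \<open>(M + 1) ^ 3\<close> grid points.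
  What has to be arranged is that the four separating forms and \<open>h\<close> share one
  multidegree \<open>D\<close> and one degree bound \<open>K\<close> on lines.\<close>

lemma no_irreducible_chain_4:
  assumes irr: "\<And>i. i \<le> 4 \<Longrightarrow> irreducible_closed zariski3 (Z i)"
    and sub: "\<And>i. i < 4 \<Longrightarrow> Z i \<subset> Z (Suc i)"
  shows False
proof -
  have "Z 0 \<noteq> {}" using irr[of 0] by (simp add: irreducible_closed_def)
  then obtain q0 q1 q2 where p0: "(q0, q1, q2) \<in> Z 0" by auto
  obtain i0 i1 i2 where i: "rep q0 $ i0 \<noteq> 0" "rep q1 $ i1 \<noteq> 0" "rep q2 $ i2 \<noteq> 0"
    using rep_nonzero[of q0] rep_nonzero[of q1] rep_nonzero[of q2] by (auto simp: vec_eq_iff)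
  \<comment> \<open>Coordinates that do not vanish at a chosen point of \<open>Z 0\<close>, hence
    not identically on any member of the chain; their powers serve to raise multidegrees.\<close>
  define h0 :: "vec_3 \<Rightarrow> complex" where "h0 = (\<lambda>(s, t, u). s $ i0)"
  define h1 :: "vec_3 \<Rightarrow> complex" where "h1 = (\<lambda>(s, t, u). t $ i1)"
  define h2 :: "vec_3 \<Rightarrow> complex" where "h2 = (\<lambda>(s, t, u). u $ i2)"
  have h: "h0 \<in> forms3 1 0 0" "h1 \<in> forms3 0 1 0" "h2 \<in> forms3 0 0 1"
    unfolding h0_def h1_def h2_def by (rule coord_forms3)+
  have Z0: "Z 0 \<subseteq> Z i" if "i \<le> 4" for i
    using that
  proof (induction i)
    case (Suc i)
    then show ?case using sub[of i] by auto
  qed simp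
  have hnz: "\<exists>p\<in>Z i. h0 (rep3 p) \<noteq> 0" "\<exists>p\<in>Z i. h1 (rep3 p) \<noteq> 0" "\<exists>p\<in>Z i. h2 (rep3 p) \<noteq> 0"
    if "i \<le> 4" for i
    using Z0[OF that] p0 i by (force simp: h0_def h1_def h2_def)+
  have ex: "\<exists>D0. \<forall>D\<ge>D0. \<exists>g\<in>forms3 D D D. (\<forall>p\<in>Z i. g (rep3 p) = 0) \<and> (\<exists>p\<in>Z (Suc i). g (rep3 p) \<noteq> 0)"
    if i4: "i < 4" for i
  proof -
    have Zi: "closedin zariski3 (Z i)" using irr[of i] i4 by (simp add: irreducible_closed_def)
    have ZS: "irreducible_closed zariski3 (Z (Suc i))" using irr[of "Suc i"] i4 by simp
    obtain p where p: "p \<in> Z (Suc i)" "p \<notin> Z i" using sub[OF i4] by blast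
    obtain g a b c where g: "g \<in> forms3 a b c" "g (rep3 p) \<noteq> 0" "\<forall>x\<in>Z i. g (rep3 x) = 0"
      using Zi p(2) unfolding closedin_zariski3 by blast
    \<comment> \<open>The bound \<open>a + b + c\<close> makes all three exponents
      \<open>D - a\<close>, \<open>D - b\<close>, \<open>D - c\<close> genuine differences.\<close>
    have "\<exists>g\<in>forms3 D D D. (\<forall>p\<in>Z i. g (rep3 p) = 0) \<and> (\<exists>p\<in>Z (Suc i). g (rep3 p) \<noteq> 0)"
      if D: "D \<ge> a + b + c" for D
    proof -
      let ?k = "\<lambda>v. h0 v ^ (D - a) * h1 v ^ (D - b) * h2 v ^ (D - c)"
      have k01: "(\<lambda>v. h0 v ^ (D - a) * h1 v ^ (D - b)) \<in> forms3 (D - a) (D - b) 0"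
        using forms3_mult[OF forms3_power[OF h(1), of "D - a"] forms3_power[OF h(2), of "D - b"]] by simp
      have k: "?k \<in> forms3 (D - a) (D - b) (D - c)"
        using forms3_mult[OF k01 forms3_power[OF h(3), of "D - c"]] by simp
      have gk: "(\<lambda>v. g v * ?k v) \<in> forms3 D D D" using forms3_mult[OF g(1) k] D by simp
      have "\<exists>p\<in>Z (Suc i). g (rep3 p) * ?k (rep3 p) \<noteq> 0"
      proof (rule ccontr)
        assume "\<not> ?thesis"
        then have "\<And>p. p \<in> Z (Suc i) \<Longrightarrow> g (rep3 p) * ?k (rep3 p) = 0" by blast
        from irreducible_forms3_mult[OF ZS g(1) k this] p(1) g(2)
        have "\<And>p. p \<in> Z (Suc i) \<Longrightarrow>
            (h0 (rep3 p) ^ (D - a) * h1 (rep3 p) ^ (D - b)) * h2 (rep3 p) ^ (D - c) = 0" by blast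
        from irreducible_forms3_mult[OF ZS k01 forms3_power[OF h(3), of "D - c"] this]
        have "\<And>p. p \<in> Z (Suc i) \<Longrightarrow> h0 (rep3 p) ^ (D - a) * h1 (rep3 p) ^ (D - b) = 0"
          using hnz(3)[of "Suc i"] i4 by auto
        from irreducible_forms3_mult[OF ZS forms3_power[OF h(1)] forms3_power[OF h(2)] this]
        show False using hnz(1,2)[of "Suc i"] i4 by auto
      qed
      then show ?thesis using gk g(3) by (intro bexI[of _ "\<lambda>v. g v * ?k v"]) auto
    qed
    then show ?thesis by blast
  qed
  then obtain D0 where D0: "\<And>i D. i < 4 \<Longrightarrow> D0 i \<le> D \<Longrightarrow>
      \<exists>g\<in>forms3 D D D. (\<forall>p\<in>Z i. g (rep3 p) = 0) \<and> (\<exists>p\<in>Z (Suc i). g (rep3 p) \<noteq> 0)"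
    by metis
  define D where "D = (\<Sum>i<4. D0 i)"
  have "\<exists>g. g \<in> forms3 D D D \<and> (\<forall>p\<in>Z i. g (rep3 p) = 0) \<and> (\<exists>p\<in>Z (Suc i). g (rep3 p) \<noteq> 0)"
    if "i < 4" for i
    using D0[OF that, of D] that member_le_sum[of i "{..<4}" D0] unfolding D_def by auto
  then obtain f where f: "\<And>i. i < 4 \<Longrightarrow> f i \<in> forms3 D D D"
    "\<And>i p. i < 4 \<Longrightarrow> p \<in> Z i \<Longrightarrow> f i (rep3 p) = 0"
    "\<And>i. i < 4 \<Longrightarrow> \<exists>p\<in>Z (Suc i). f i (rep3 p) \<noteq> 0"
    by metis
  define h where "h = (\<lambda>v. h0 v ^ D * h1 v ^ D * h2 v ^ D)"
  have hD: "h \<in> forms3 D D D"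
    unfolding h_def using forms3_mult[OF forms3_mult[OF forms3_power[OF h(1), of D] forms3_power[OF h(2), of D]]
        forms3_power[OF h(3), of D]] by simp
  have hD0: "\<exists>p\<in>Z 0. h (rep3 p) \<noteq> 0"
    using p0 i by (intro bexI[OF _ p0]) (simp add: h_def h0_def h1_def h2_def)
  have "\<exists>K. \<forall>v w. \<exists>p. degree p \<le> K \<and> (\<forall>z. f i (line3 v w z) = poly p z)" if "i < 4" for i
    using poly_on_line3[OF forms3_poly[OF f(1)[OF that]]] .
  then obtain Kf where Kf: "\<And>i v w. i < 4 \<Longrightarrow> \<exists>p. degree p \<le> Kf i \<and> (\<forall>z. f i (line3 v w z) = poly p z)"
    by metis
  obtain Kh where Kh: "\<And>v w. \<exists>p. degree p \<le> Kh \<and> (\<forall>z. h (line3 v w z) = poly p z)"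
    using poly_on_line3[OF forms3_poly[OF hD]] by blast
  define K where "K = Kh + (\<Sum>i<4. Kf i)"
  have K1: "\<exists>p. degree p \<le> K \<and> (\<forall>z. f i (line3 v w z) = poly p z)" if "i < 4" for i v w
  proof -
    have "Kf i \<le> K" using that member_le_sum[of i "{..<4}" Kf] by (simp add: K_def)
    then show ?thesis using Kf[OF that, of v w] by (meson order.trans)
  qed
  have K2: "\<exists>p. degree p \<le> K \<and> (\<forall>z. h (line3 v w z) = poly p z)" for v w
    using Kh[of v w] by (auto simp: K_def intro: trans_le_add1)
  \<comment> \<open>Chosen so that \<open>M + 1 \<le> N * (4 * K + 1)\<close> gives
    \<open>(M + 1) ^ 3 \<le> N ^ 3 * N\<close>; here \<open>M\<close> bounds the degree on lines of
    a monomial in four forms.\<close>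
  define N where "N = (4 * K + 1) ^ 3"
  define M where "M = 4 * N * K"
  define J where "J = {..M} \<times> {..M} \<times> {..M}"
  have "N \<ge> 1" by (simp add: N_def)
  then have "M + 1 \<le> N * (4 * K + 1)" by (simp add: M_def algebra_simps)
  then have "(M + 1) ^ 3 \<le> (N * (4 * K + 1)) ^ 3" by (rule power_mono) simp
  also have "\<dots> = N ^ 3 * N" by (simp only: power_mult_distrib N_def)
  also have "\<dots> < (N + 1) ^ 4" using power_strict_mono[of N "N + 1" 4] by (simp add: eval_nat_numeral)
  finally have lt: "(M + 1) ^ 3 < (N + 1) ^ 4" .
  have finJ: "finite J" by (simp add: J_def)
  have cardJ: "card J = (M + 1) ^ 3"
    unfolding J_def card_cartesian_product power3_eq_cube mult.assoc by simp
  have "card J < card (exponents N 4)" unfolding card_exponents cardJ by (rule lt)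
  \<comment> \<open>One equation for each grid point, one unknown for each monomial.\<close>
  from linear_system_nontrivial[OF finJ finite_exponents this,
      of "\<lambda>j e. case j of (x, y, z) \<Rightarrow> mon f h N e (chart (of_nat x) (of_nat y) (of_nat z))"]
  obtain c where c: "\<exists>e\<in>exponents N 4. c e \<noteq> 0"
    "\<forall>j\<in>J. (\<Sum>e\<in>exponents N 4. (case j of (x, y, z) \<Rightarrow> mon f h N e (chart (of_nat x) (of_nat y) (of_nat z))) * c e) = 0"
    by (elim exE conjE)
  define F where "F v = (\<Sum>e\<in>exponents N 4. c e * mon f h N e v)" for v
  have F: "F \<in> forms3 (4 * N * D) (4 * N * D) (4 * N * D)"
    unfolding F_def
  proof (rule forms3_sum, rule forms3_scale)
    fix e assume "e \<in> exponents N 4"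
    then have e: "length e = 4" "set e \<subseteq> {..N}" by (simp_all add: exponents_def)
    have "f i \<in> forms3 D D D" if "i < length e" for i using f(1) e(1) that by simp
    from mon_forms3[OF this hD e(2)]
    show "mon f h N e \<in> forms3 (4 * N * D) (4 * N * D) (4 * N * D)" unfolding e(1) .
  qed
  have Fline: "\<exists>p. degree p \<le> M \<and> (\<forall>z. F (line3 v w z) = poly p z)" for v w
  proof -
    have "\<exists>p. degree p \<le> M \<and> (\<forall>z. mon f h N e (line3 v w z) = poly p z)" if e: "e \<in> exponents N 4" for e
    proof -
      have e: "length e = 4" "set e \<subseteq> {..N}" using e by (simp_all add: exponents_def)
      have "\<exists>p. degree p \<le> K \<and> (\<forall>z. f i (line3 v w z) = poly p z)" if "i < length e" for i v w
        using K1 e(1) that by simp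
      from mon_line[OF this K2 e(2)] show ?thesis unfolding e(1) M_def .
    qed
    then obtain p where p: "\<And>e. e \<in> exponents N 4 \<Longrightarrow> degree (p e) \<le> M"
      "\<And>e z. e \<in> exponents N 4 \<Longrightarrow> mon f h N e (line3 v w z) = poly (p e) z" by metis
    show ?thesis
      by (rule exI[of _ "\<Sum>e\<in>exponents N 4. smult (c e) (p e)"])
        (auto simp: F_def p poly_sum intro!: degree_sum_le order.trans[OF degree_smult_le])
  qed
  have "F (chart x y z) = 0" for x y z
  proof (rule vanishes_off_grid[of M "\<lambda>x y z. F (chart x y z)"])
    fix i j k assume "i \<le> M" "j \<le> M" "k \<le> M"
    then have "(i, j, k) \<in> J" by (simp add: J_def)
    then show "F (chart (of_nat i) (of_nat j) (of_nat k)) = 0"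
      using c(2)[rule_format, of "(i, j, k)"] by (simp add: F_def mult.commute)
  next
    show "\<exists>p. degree p \<le> M \<and> (\<forall>x. F (chart x y z) = poly p x)" for y z
      by (subst chart_line(1)) (rule Fline)
    show "\<exists>p. degree p \<le> M \<and> (\<forall>y. F (chart x y z) = poly p y)" for x z
      by (subst chart_line(2)) (rule Fline)
    show "\<exists>p. degree p \<le> M \<and> (\<forall>z. F (chart x y z) = poly p z)" for x y
      by (subst chart_line(3)) (rule Fline)
  qed
  then have "F v = 0" for v using forms3_vanish_chart[OF F] by blast
  then have F0: "(\<Sum>e\<in>exponents N 4. c e * mon f h N e (rep3 p)) = 0" for p by (simp add: F_def)
  from c(1) obtain e where e: "e \<in> exponents N 4" "c e \<noteq> 0" by (elim bexE)
  have "c e = 0"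
  proof (rule monomials_independent[where n = 4 and Z = Z and f = f and h = h and c = c and e = e and N = N and d = D])
    show "Z i \<subseteq> Z (Suc i)" if "i < 4" for i using sub[OF that] by (rule psubset_imp_subset)
  qed (rule F0 e(1) | fact irr f hD hD0)+
  with e(2) show False by (rule notE)
qed

text \<open>A chain of four irreducible closed sets inside a proper closed set is prolonged by the
  whole product to a chain of five.\<close>

lemma krull_dim_zariski3_le_2:
  assumes S: "closedin zariski3 S" "S \<noteq> UNIV"
  shows "krull_dim (subtopology zariski3 S) \<le> 2"
proof -
  have "krull_dim (subtopology zariski3 S) \<le> enat 2"
  proof (rule krull_dim_le)
    fix Z assume Z: "\<forall>i\<le>Suc 2. irreducible_closed (subtopology zariski3 S) (Z i)" "\<forall>i<Suc 2. Z i \<subset> Z (Suc i)"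
    have Zi: "irreducible_closed zariski3 (Z i)" "Z i \<subseteq> S" if "i \<le> 3" for i
      using Z(1)[rule_format, of i] that irreducible_closed_subtopology[OF S(1)] by simp_all
    define Z' where "Z' i = (if i \<le> 3 then Z i else UNIV)" for i
    show False
    proof (rule no_irreducible_chain_4[of Z'])
      show "irreducible_closed zariski3 (Z' i)" for i
        using Zi(1)[of i] irreducible_closed_UNIV by (simp add: Z'_def)
      show "Z' i \<subset> Z' (Suc i)" if "i < 4" for i
      proof (cases "i = 3")
        case True
        have "Z 3 \<noteq> UNIV" using Zi(2)[of 3] S(2) by blast
        then show ?thesis unfolding True Z'_def by (simp add: psubset_eq)
      next
        case False
        then show ?thesis using Z(2)[rule_format, of i] that by (simp add: Z'_def)
      qed
    qed
  qed
  then show ?thesis by (simp add: numeral_eq_enat)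
qed

text \<open>A chain of three sets is prolonged twice, by a proper irreducible set strictly above it
  and by the whole product.\<close>

lemma krull_dim_zariski3_le_1:
  assumes S: "closedin zariski3 S"
    and surf: "\<And>Z. irreducible_closed zariski3 Z \<Longrightarrow> Z \<subseteq> S \<Longrightarrow>
      \<exists>Y. irreducible_closed zariski3 Y \<and> Z \<subset> Y \<and> Y \<noteq> UNIV"
  shows "krull_dim (subtopology zariski3 S) \<le> 1"
proof -
  have "krull_dim (subtopology zariski3 S) \<le> enat 1"
  proof (rule krull_dim_le)
    fix Z assume Z: "\<forall>i\<le>Suc 1. irreducible_closed (subtopology zariski3 S) (Z i)" "\<forall>i<Suc 1. Z i \<subset> Z (Suc i)"
    have Z2: "irreducible_closed zariski3 (Z i)" "Z i \<subseteq> S" if "i \<le> 2" for i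
      using Z(1)[rule_format, of i] that irreducible_closed_subtopology[OF S] by simp_all
    obtain Y where Y: "irreducible_closed zariski3 Y" "Z 2 \<subset> Y" "Y \<noteq> UNIV"
      using surf[OF Z2(1)[of 2] Z2(2)[of 2]] by auto
    define Z' where "Z' i = (if i \<le> 2 then Z i else if i = 3 then Y else UNIV)" for i
    show False
    proof (rule no_irreducible_chain_4[of Z'])
      show "irreducible_closed zariski3 (Z' i)" for i
        using Z2(1)[of i] Y(1) irreducible_closed_UNIV by (simp add: Z'_def)
      show "Z' i \<subset> Z' (Suc i)" if "i < 4" for i
      proof -
        consider "i < 2" | "i = 2" | "i = 3" using \<open>i < 4\<close> by linarith
        then show ?thesis
        proof cases
          case 1
          then show ?thesis using Z(2)[rule_format, of i] by (simp add: Z'_def)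
        next
          case 2
          show ?thesis unfolding 2 Z'_def using Y(2) by simp
        next
          case 3
          show ?thesis unfolding 3 Z'_def using Y(3) by (simp add: psubset_eq)
        qed
      qed
    qed
  qed
  then show ?thesis by (simp add: one_enat_def)
qed

subsection \<open>The triple wedge product\<close>

definition dot :: "complex^4 \<Rightarrow> complex^4 \<Rightarrow> complex" where
  "dot a x = (\<Sum>m\<in>UNIV. a $ m * x $ m)"

definition minor2 :: "complex^4 \<Rightarrow> complex^4 \<Rightarrow> 4 \<Rightarrow> 4 \<Rightarrow> complex" where
  "minor2 a b i j = a $ i * b $ j - a $ j * b $ i"

definition minor3 :: "complex^4 \<Rightarrow> complex^4 \<Rightarrow> complex^4 \<Rightarrow> 4 \<Rightarrow> 4 \<Rightarrow> 4 \<Rightarrow> complex" where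
  "minor3 a b c i j k = a $ i * minor2 b c j k - b $ i * minor2 a c j k + c $ i * minor2 a b j k"

text \<open>The vector of signed maximal minors: \<open>dot d (wedge a b c)\<close> is the
  determinant with rows \<open>d\<close>, \<open>a\<close>, \<open>b\<close>, \<open>c\<close>.
  Entry \<open>0\<close> omits the column at infinity and therefore matches
  \<open>Delta\<close>.\<close>

definition wedge :: "complex^4 \<Rightarrow> complex^4 \<Rightarrow> complex^4 \<Rightarrow> complex^4" where
  "wedge a b c = (\<chi> m. if m = 0 then minor3 a b c 1 2 3 else if m = 1 then - minor3 a b c 0 2 3
     else if m = 2 then minor3 a b c 0 1 3 else - minor3 a b c 0 1 2)"

lemma dot_eq: "dot a x = a $ 0 * x $ 0 + a $ 1 * x $ 1 + a $ 2 * x $ 2 + a $ 3 * x $ 3"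
  by (simp add: dot_def sum_type_4)

lemma wedge_nth [simp]:
  "wedge a b c $ 0 = minor3 a b c 1 2 3" "wedge a b c $ 1 = - minor3 a b c 0 2 3"
  "wedge a b c $ 2 = minor3 a b c 0 1 3" "wedge a b c $ 3 = - minor3 a b c 0 1 2"
  by (simp_all add: wedge_def)

lemma minor3_add [simp]:
  "minor3 (a + a') b c i j k = minor3 a b c i j k + minor3 a' b c i j k"
  "minor3 a (b + b') c i j k = minor3 a b c i j k + minor3 a b' c i j k"
  "minor3 a b (c + c') i j k = minor3 a b c i j k + minor3 a b c' i j k"
  by (simp_all add: minor3_def minor2_def algebra_simps)

lemma minor3_scale [simp]:
  "minor3 (l *s a) b c i j k = l * minor3 a b c i j k"
  "minor3 a (l *s b) c i j k = l * minor3 a b c i j k"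
  "minor3 a b (l *s c) i j k = l * minor3 a b c i j k"
  by (simp_all add: minor3_def minor2_def algebra_simps)

lemma minor3_cyc: "minor3 b c a i j k = minor3 a b c i j k"
  by (simp add: minor3_def minor2_def algebra_simps)

lemma minor3_same_index: "minor3 a b c i i j = 0" "minor3 a b c i j i = 0" "minor3 a b c i j j = 0"
  by (simp_all add: minor3_def minor2_def algebra_simps)

lemma minor3_swap_index:
  "minor3 a b c j i k = - minor3 a b c i j k" "minor3 a b c i k j = - minor3 a b c i j k"
  by (simp_all add: minor3_def minor2_def algebra_simps)

lemma minor3_same: "minor3 a a b i j k = 0" "minor3 a b a i j k = 0" "minor3 a b b i j k = 0"
  by (simp_all add: minor3_def minor2_def algebra_simps)

lemma wedge_add:
  "wedge (a + a') b c = wedge a b c + wedge a' b c"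
  "wedge a (b + b') c = wedge a b c + wedge a b' c"
  "wedge a b (c + c') = wedge a b c + wedge a b c'"
  by (simp_all add: vec4_eq_iff)

lemma wedge_scale:
  "wedge (l *s a) b c = l *s wedge a b c" "wedge a (l *s b) c = l *s wedge a b c"
  "wedge a b (l *s c) = l *s wedge a b c"
  by (simp_all add: vec4_eq_iff)

lemma wedge_zero [simp]: "wedge 0 b c = 0" "wedge a 0 c = 0" "wedge a b 0 = 0"
  by (simp_all add: vec4_eq_iff minor3_def minor2_def)

lemma wedge_cyc: "wedge b c a = wedge a b c"
  using minor3_cyc[of b c a] by (simp add: vec4_eq_iff)

lemma wedge_same: "wedge a a b = 0" "wedge a b a = 0" "wedge a b b = 0"
  by (simp_all add: vec4_eq_iff minor3_same)

lemma dot_add: "dot (a + b) x = dot a x + dot b x" "dot a (x + y) = dot a x + dot a y"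
  by (simp_all add: dot_eq algebra_simps)

lemma dot_diff: "dot (a - b) x = dot a x - dot b x" "dot a (x - y) = dot a x - dot a y"
  by (simp_all add: dot_eq algebra_simps)

lemma dot_scale: "dot (l *s a) x = l * dot a x" "dot a (l *s x) = l * dot a x"
  by (simp_all add: dot_eq algebra_simps)

lemma dot_zero [simp]: "dot a 0 = 0" "dot 0 a = 0"
  by (simp_all add: dot_eq)

lemma dot_wedge_self: "dot a (wedge a b c) = 0" "dot b (wedge a b c) = 0" "dot c (wedge a b c) = 0"
  by (simp_all add: dot_eq minor3_def minor2_def algebra_simps)

lemma dot_wedge_swap:
  "dot a (wedge d b c) = - dot d (wedge a b c)"
  "dot b (wedge a d c) = - dot d (wedge a b c)"
  "dot c (wedge a b d) = - dot d (wedge a b c)"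
  by (simp_all add: dot_eq minor3_def minor2_def algebra_simps)

text \<open>Laplace expansion of the 3x3 determinant whose first column consists of the values of
  \<open>a\<close>, \<open>b\<close>, \<open>c\<close> at \<open>x\<close> and whose other columns
  are columns \<open>k\<close> and \<open>l\<close>.\<close>

lemma sum_minor3:
  "x $ 0 * minor3 a b c 0 k l + x $ 1 * minor3 a b c 1 k l + x $ 2 * minor3 a b c 2 k l + x $ 3 * minor3 a b c 3 k l =
    dot a x * minor2 b c k l - dot b x * minor2 a c k l + dot c x * minor2 a b k l"
  by (simp add: minor3_def dot_eq algebra_simps)

text \<open>Cramer's rule: \<open>sum_minor3\<close> vanishes for each of the six pairs of columns,
  and each instance involves only two coordinates of \<open>x\<close>, since minors with a repeated
  index are zero.\<close>

lemma wedge_unique: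
  assumes "dot a x = 0" "dot b x = 0" "dot c x = 0"
  shows "x $ m * wedge a b c $ n = x $ n * wedge a b c $ m"
proof -
  have s: "x $ 0 * minor3 a b c 0 k l + x $ 1 * minor3 a b c 1 k l + x $ 2 * minor3 a b c 2 k l
      + x $ 3 * minor3 a b c 3 k l = 0" for k l
    using sum_minor3[of x a b c k l] assms by simp
  have e: "x $ 0 * minor3 a b c 0 2 3 + x $ 1 * minor3 a b c 1 2 3 = 0"
    "x $ 0 * minor3 a b c 0 1 3 - x $ 2 * minor3 a b c 1 2 3 = 0"
    "x $ 0 * minor3 a b c 0 1 2 + x $ 3 * minor3 a b c 1 2 3 = 0"
    "x $ 1 * minor3 a b c 0 1 3 + x $ 2 * minor3 a b c 0 2 3 = 0"
    "x $ 1 * minor3 a b c 0 1 2 - x $ 3 * minor3 a b c 0 2 3 = 0"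
    "x $ 2 * minor3 a b c 0 1 2 + x $ 3 * minor3 a b c 0 1 3 = 0"
    using s[of 2 3] s[of 1 3] s[of 1 2] s[of 0 3] s[of 0 2] s[of 0 1]
    by (simp_all add: minor3_def minor2_def algebra_simps)
  have "\<forall>m n. x $ m * wedge a b c $ n = x $ n * wedge a b c $ m"
    unfolding all_type_4 wedge_nth using e by (simp add: algebra_simps add_eq_0_iff)
  then show ?thesis by blast
qed

text \<open>The scalar stands on the side of \<open>x\<close>, so that dependent covectors, whose
  wedge is zero, are covered with \<open>k = 0\<close>.\<close>

lemma wedge_unique_scale:
  assumes "dot a x = 0" "dot b x = 0" "dot c x = 0" "x \<noteq> 0"
  obtains k where "wedge a b c = k *s x"
proof -
  obtain m where m: "x $ m \<noteq> 0" using assms(4) by (auto simp: vec_eq_iff)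
  have "wedge a b c $ n = (wedge a b c $ m / x $ m) * x $ n" for n
    using wedge_unique[OF assms(1-3), of m n] m by (simp add: eq_divide_eq mult.commute)
  then have "wedge a b c = (wedge a b c $ m / x $ m) *s x"
    unfolding vec_eq_iff vector_smult_component by blast
  then show ?thesis by (rule that)
qed

lemma dual_zero:
  assumes "dot d (wedge a b c) \<noteq> 0" "dot a x = 0" "dot b x = 0" "dot c x = 0" "dot d x = 0"
  shows "x = 0"
proof (rule ccontr)
  assume "x \<noteq> 0"
  then obtain k where k: "wedge a b c = k *s x" using wedge_unique_scale[OF assms(2-4)] by blast
  show False using assms(1,5) unfolding k dot_scale by simp
qed

text \<open>If all 3x3 minors vanish, cofactor expansion along any two columns is a linear relation
  whose coefficients are 2x2 minors. If those vanish too, already \<open>a\<close> and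
  \<open>b\<close> are proportional.\<close>

lemma wedge_zero_dependent:
  assumes "wedge a b c = 0"
  shows "\<exists>l m n. (l \<noteq> 0 \<or> m \<noteq> 0 \<or> n \<noteq> 0) \<and> l *s a + m *s b + n *s c = 0"
proof -
  have 0: "minor3 a b c 1 2 3 = 0" "minor3 a b c 0 2 3 = 0" "minor3 a b c 0 1 3 = 0" "minor3 a b c 0 1 2 = 0"
    using assms wedge_nth[of a b c] by simp_all
  \<comment> \<open>Cyclic shifts and transpositions carry the four increasing index triples to all
    triples of distinct indices.\<close>
  have sw: "minor3 a b c k i j = 0" if "minor3 a b c i j k = 0" for i j k
    using that by (simp only: minor3_swap_index(1)[where i = i and j = k and k = j]
        minor3_swap_index(2)[where i = i and j = j and k = k] minus_zero)
  have sw2: "minor3 a b c j i k = 0" if "minor3 a b c i j k = 0" for i j k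
    using that by (simp only: minor3_swap_index(1)[where i = i and j = j and k = k] minus_zero)
  have "\<forall>i j k. minor3 a b c i j k = 0"
    unfolding all_type_4 minor3_same_index
    using 0 sw[OF 0(1)] sw[OF 0(2)] sw[OF 0(3)] sw[OF 0(4)]
      sw[OF sw[OF 0(1)]] sw[OF sw[OF 0(2)]] sw[OF sw[OF 0(3)]] sw[OF sw[OF 0(4)]]
      sw2[OF 0(1)] sw2[OF 0(2)] sw2[OF 0(3)] sw2[OF 0(4)]
      sw2[OF sw[OF 0(1)]] sw2[OF sw[OF 0(2)]] sw2[OF sw[OF 0(3)]] sw2[OF sw[OF 0(4)]]
      sw2[OF sw[OF sw[OF 0(1)]]] sw2[OF sw[OF sw[OF 0(2)]]] sw2[OF sw[OF sw[OF 0(3)]]] sw2[OF sw[OF sw[OF 0(4)]]]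
    by simp
  then have rel: "minor2 b c i j *s a + (- minor2 a c i j) *s b + minor2 a b i j *s c = 0" for i j
    by (simp add: vec_eq_iff minor3_def algebra_simps)
  show ?thesis
  proof (cases "\<exists>i j. minor2 b c i j \<noteq> 0 \<or> minor2 a c i j \<noteq> 0 \<or> minor2 a b i j \<noteq> 0")
    case True
    then obtain i j where "minor2 b c i j \<noteq> 0 \<or> minor2 a c i j \<noteq> 0 \<or> minor2 a b i j \<noteq> 0" by blast
    then show ?thesis using rel[of i j]
      by (intro exI[of _ "minor2 b c i j"] exI[of _ "- minor2 a c i j"] exI[of _ "minor2 a b i j"]) simp
  next
    case False
    then have z: "minor2 a b i j = 0" for i j by blast
    show ?thesis
    proof (cases "a = 0")
      case True
      then show ?thesis by (intro exI[of _ 1] exI[of _ 0]) simp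
    next
      case a: False
      then obtain i where i: "a $ i \<noteq> 0" by (auto simp: vec_eq_iff)
      have "(b $ i) *s a + (- (a $ i)) *s b + 0 *s c = 0"
        using z[of i] by (simp add: vec_eq_iff minor2_def algebra_simps)
      then show ?thesis using i by (intro exI[of _ "b $ i"] exI[of _ "- (a $ i)"] exI[of _ 0]) simp
    qed
  qed
qed

subsection \<open>Three pencils of planes\<close>

definition lc :: "(2 \<Rightarrow> complex^4) \<Rightarrow> complex^2 \<Rightarrow> complex^4" where
  "lc a s = s $ 0 *s a 0 + s $ 1 *s a 1"

lemma lc_add: "lc a (s + t) = lc a s + lc a t"
  by (simp add: lc_def algebra_simps vector_sadd_rdistrib)

lemma lc_scale: "lc a (l *s s) = l *s lc a s"
  by (simp add: lc_def vec4_eq_iff algebra_simps)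

text \<open>The intersection point of a plane of each pencil.\<close>

definition meet :: "(2 \<Rightarrow> complex^4) \<Rightarrow> (2 \<Rightarrow> complex^4) \<Rightarrow> (2 \<Rightarrow> complex^4) \<Rightarrow> vec_3 \<Rightarrow> complex^4" where
  "meet a b c = (\<lambda>(s, t, u). wedge (lc a s) (lc b t) (lc c u))"

text \<open>Vanishes if the planes \<open>lc b t\<close> and \<open>lc c u\<close> intersect on the axis of the pencil \<open>a\<close>.\<close>

definition axis_form :: "(2 \<Rightarrow> complex^4) \<Rightarrow> (2 \<Rightarrow> complex^4) \<Rightarrow> (2 \<Rightarrow> complex^4) \<Rightarrow> complex^2 \<Rightarrow> complex^2 \<Rightarrow> complex" where
  "axis_form a b c t u = dot (a 1) (wedge (a 0) (lc b t) (lc c u))"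

text \<open>The parameter of the plane of the pencil \<open>a\<close> through \<open>x\<close>.\<close>

definition param :: "(2 \<Rightarrow> complex^4) \<Rightarrow> complex^4 \<Rightarrow> complex^2" where
  "param a x = hpair (- dot (a 1) x) (dot (a 0) x)"

text \<open>A cyclic permutation of three covectors is even; this is what lets statements about the
  first pencil be rotated.\<close>

lemma meet_rotate: "meet b c a (t, u, s) = meet a b c (s, t, u)"
  by (simp add: meet_def wedge_cyc)

text \<open>\<open>lc a s\<close> is a combination of \<open>a 0\<close> and \<open>a 1\<close>;
  pairing with one of them kills the term that contains it twice and leaves the other, with the sign
  of a transposition.\<close>

lemma dot_meet:
  "dot (a 0) (meet a b c (s, t, u)) = - (s $ 1) * axis_form a b c t u"
  "dot (a 1) (meet a b c (s, t, u)) = s $ 0 * axis_form a b c t u"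
  using dot_wedge_swap(1)[of "a 0" "a 1" "lc b t" "lc c u"]
  by (simp_all add: meet_def axis_form_def lc_def[of a] wedge_add wedge_scale dot_add dot_scale dot_wedge_self)

lemma param_meet: "param a (meet a b c (s, t, u)) = (- axis_form a b c t u) *s s"
  by (simp add: param_def dot_meet vec2_eq_iff)

lemma dot_lc_param: "dot (lc a (param a x)) x = 0"
  by (simp add: lc_def param_def dot_add dot_diff dot_scale)

text \<open>The point \<open>x\<close> lies on the three planes with its own parameters, so their
  meet is a multiple of \<open>x\<close>; pairing with \<open>a 0\<close> and \<open>a 1\<close>
  determines the factor.\<close>

lemma meet_param:
  "meet a b c (param a x, param b x, param c x) = (- axis_form a b c (param b x) (param c x)) *s x"
proof (cases "x = 0")
  case True
  then show ?thesis by (simp add: meet_def param_def lc_def)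
next
  case False
  then obtain k where k: "meet a b c (param a x, param b x, param c x) = k *s x"
    using wedge_unique_scale[OF dot_lc_param[of a x] dot_lc_param[of b x] dot_lc_param[of c x]]
    by (auto simp: meet_def)
  let ?g = "axis_form a b c (param b x) (param c x)"
  have eq: "k * dot (a 0) x = - dot (a 0) x * ?g" "k * dot (a 1) x = - dot (a 1) x * ?g"
    using dot_meet[of a b c "param a x" "param b x" "param c x"]
    unfolding k dot_scale by (simp_all add: param_def)
  show ?thesis
  proof (cases "dot (a 0) x = 0 \<and> dot (a 1) x = 0")
    case True
    \<comment> \<open>On the axis of \<open>a\<close> the pairing says nothing about
      \<open>k\<close>. There the plane \<open>lc a (param a x)\<close> degenerates to 0, and the
      four covectors in \<open>axis_form\<close> have the nonzero common zero \<open>x\<close>, so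
      both sides vanish.\<close>
    have "?g = 0"
    proof (rule ccontr)
      assume "?g \<noteq> 0"
      then show False
        using dual_zero[of "a 1" "a 0" "lc b (param b x)" "lc c (param c x)" x] True False
        by (simp add: axis_form_def dot_lc_param)
    qed
    moreover have "lc a (param a x) = 0" using True by (simp add: lc_def param_def)
    ultimately show ?thesis by (simp add: meet_def)
  next
    case False
    moreover have "dot (a 0) x * (k + ?g) = 0" "dot (a 1) x * (k + ?g) = 0"
      using eq by (simp_all add: algebra_simps)
    ultimately have "k = - ?g" by (auto simp: eq_neg_iff_add_eq_0)
    then show ?thesis using k by simp
  qed
qed

lemma axis_form_bilinear:
  "axis_form a b c t u = (\<Sum>j\<in>UNIV. \<Sum>k\<in>UNIV. dot (a 1) (wedge (a 0) (b j) (c k)) * t $ j * u $ k)"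
  by (simp add: axis_form_def lc_def wedge_add wedge_scale dot_add dot_scale sum_type_2 algebra_simps)

subsection \<open>Surfaces defined by a bilinear form\<close>

lemma pt_eq_2:
  fixes x y :: "complex^2"
  assumes "x \<noteq> 0" "y \<noteq> 0"
  shows "pt x = pt y \<longleftrightarrow> x $ 0 * y $ 1 = x $ 1 * y $ 0"
proof
  assume "pt x = pt y"
  then obtain c where "y = c *s x" using pt_eq_iff[OF assms] by blast
  then show "x $ 0 * y $ 1 = x $ 1 * y $ 0" by simp
next
  assume *: "x $ 0 * y $ 1 = x $ 1 * y $ 0"
  have "\<forall>i j. x $ i * y $ j = x $ j * y $ i"
    unfolding all_type_2 using * by (simp add: mult.commute)
  then show "pt x = pt y" using proportional_vec[OF assms] by blast
qed

lemma pt_eq_rep: "p = q \<longleftrightarrow> rep p $ 0 * rep q $ 1 = rep p $ 1 * rep q $ 0"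
  for p q :: "2 cproj"
  using pt_eq_2[of "rep p" "rep q"] by simp

lemma parallel_2:
  fixes x y :: "complex^2"
  assumes "x \<noteq> 0" "x $ 0 * y $ 1 = x $ 1 * y $ 0"
  shows "\<exists>k. y = k *s x"
proof (cases "y = 0")
  case True
  then show ?thesis by (intro exI[of _ 0]) simp
next
  case False
  then show ?thesis using pt_eq_2[OF assms(1) False] pt_eq_iff[OF assms(1) False] assms(2) by blast
qed

lemma closedin_second: "closedin zariski3 {(p, q, r). q = q0}"
proof -
  have "{(p, q, r). q = q0} = zeros3 {\<lambda>(s, t, u). rep q0 $ 1 * t $ 0 - rep q0 $ 0 * t $ 1}"
    by (auto simp: zeros3_def pt_eq_rep mult.commute)
  moreover have "closedin zariski3 \<dots>"
    by (rule closedin_zeros3) (use linear_forms3(2) in blast)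
  ultimately show ?thesis by simp
qed

lemma closedin_third: "closedin zariski3 {(p, q, r). r = r0}"
proof -
  have "{(p, q, r). r = r0} = zeros3 {\<lambda>(s, t, u). rep r0 $ 1 * u $ 0 - rep r0 $ 0 * u $ 1}"
    by (auto simp: zeros3_def pt_eq_rep mult.commute)
  moreover have "closedin zariski3 \<dots>"
    by (rule closedin_zeros3) (use linear_forms3(3) in blast)
  ultimately show ?thesis by simp
qed

lemma irreducible_closed_lines:
  assumes G: "closedin zariski3 G" "G \<noteq> {}"
    and line: "\<And>p q. p \<in> G \<Longrightarrow> q \<in> G \<Longrightarrow> \<exists>v w. nz3 v \<and> nz3 (line3 v w 1) \<and> pt3 v = p \<and>
      pt3 (line3 v w 1) = q \<and> (\<forall>z. nz3 (line3 v w z) \<longrightarrow> pt3 (line3 v w z) \<in> G)"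
  shows "irreducible_closed zariski3 G"
  using irreducible_closure_lines[OF G(2) line] closure_of_closedin[OF G(1)] by simp

lemma irreducible_closed_second: "irreducible_closed zariski3 {(p, q, r). q = q0}"
proof (rule irreducible_closed_lines[OF closedin_second])
  fix x y :: P1_3 assume "x \<in> {(p, q, r). q = q0}" "y \<in> {(p, q, r). q = q0}"
  then obtain p r p' r' where xy: "x = (p, q0, r)" "y = (p', q0, r')" by auto
  show "\<exists>v w. nz3 v \<and> nz3 (line3 v w 1) \<and> pt3 v = x \<and> pt3 (line3 v w 1) = y \<and>
      (\<forall>z. nz3 (line3 v w z) \<longrightarrow> pt3 (line3 v w z) \<in> {(p, q, r). q = q0})"
    by (rule exI[of _ "(rep p, rep q0, rep r)"], rule exI[of _ "(rep p' - rep p, 0, rep r' - rep r)"])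
      (simp add: xy)
qed simp

lemma irreducible_closed_third: "irreducible_closed zariski3 {(p, q, r). r = r0}"
proof (rule irreducible_closed_lines[OF closedin_third])
  fix x y :: P1_3 assume "x \<in> {(p, q, r). r = r0}" "y \<in> {(p, q, r). r = r0}"
  then obtain p q p' q' where xy: "x = (p, q, r0)" "y = (p', q', r0)" by auto
  show "\<exists>v w. nz3 v \<and> nz3 (line3 v w 1) \<and> pt3 v = x \<and> pt3 (line3 v w 1) = y \<and>
      (\<forall>z. nz3 (line3 v w z) \<longrightarrow> pt3 (line3 v w z) \<in> {(p, q, r). r = r0})"
    by (rule exI[of _ "(rep p, rep q, rep r0)"], rule exI[of _ "(rep p' - rep p, rep q' - rep q, 0)"])
      (simp add: xy)
qed simp

lemma irreducible_closed_second_third: "irreducible_closed zariski3 {(p, q, r). q = q0 \<and> r = r0}"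
proof (rule irreducible_closed_lines)
  have "{(p, q, r). q = q0 \<and> r = r0} = {(p, q, r). q = q0} \<inter> ({(p, q, r). r = r0} :: P1_3 set)" by auto
  then show "closedin zariski3 {(p, q, r). q = q0 \<and> r = r0}"
    using closedin_Int[OF closedin_second[of q0] closedin_third[of r0]] by simp
  fix x y :: P1_3 assume "x \<in> {(p, q, r). q = q0 \<and> r = r0}" "y \<in> {(p, q, r). q = q0 \<and> r = r0}"
  then obtain p p' where xy: "x = (p, q0, r0)" "y = (p', q0, r0)" by auto
  show "\<exists>v w. nz3 v \<and> nz3 (line3 v w 1) \<and> pt3 v = x \<and> pt3 (line3 v w 1) = y \<and>
      (\<forall>z. nz3 (line3 v w z) \<longrightarrow> pt3 (line3 v w z) \<in> {(p, q, r). q = q0 \<and> r = r0})"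
    by (rule exI[of _ "(rep p, rep q0, rep r0)"], rule exI[of _ "(rep p' - rep p, 0, 0)"])
      (simp add: xy)
qed simp

definition bil :: "(2 \<Rightarrow> 2 \<Rightarrow> complex) \<Rightarrow> complex^2 \<Rightarrow> complex^2 \<Rightarrow> complex" where
  "bil g x y = (\<Sum>j\<in>UNIV. \<Sum>k\<in>UNIV. g j k * x $ j * y $ k)"

lemma bil_eq: "bil g x y = g 0 0 * x $ 0 * y $ 0 + g 0 1 * x $ 0 * y $ 1 + g 1 0 * x $ 1 * y $ 0 + g 1 1 * x $ 1 * y $ 1"
  by (simp add: bil_def sum_type_2)

lemma bil_forms3:
  "(\<lambda>(s, t, u). bil g t u) \<in> forms3 0 1 1" "(\<lambda>(s, t, u). bil g s u) \<in> forms3 1 0 1"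
  "(\<lambda>(s, t, u). bil g s t) \<in> forms3 1 1 0"
  unfolding forms3_def bil_def case_prod_unfold mem_Collect_eq
  by (intro conjI poly_funs_sum poly_funs.mult poly_funs.const poly_funs_coord3[unfolded case_prod_unfold];
      simp add: sum_type_2 algebra_simps)+

lemma bil_swap: "bil g x y = bil (\<lambda>j k. g k j) y x"
  by (simp add: bil_eq)

text \<open>Only the last two factors occur. The surfaces for the other two pairs are images of this
  one under the cyclic shift \<open>rot3\<close> and its square.\<close>

definition bil_surface :: "(2 \<Rightarrow> 2 \<Rightarrow> complex) \<Rightarrow> P1_3 set" where
  "bil_surface g = {(p, q, r). bil g (rep q) (rep r) = 0}"

lemma closedin_bil_surface: "closedin zariski3 (bil_surface g)"
proof -
  have "bil_surface g = zeros3 {\<lambda>(s, t, u). bil g t u}" by (auto simp: bil_surface_def zeros3_def)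
  moreover have "closedin zariski3 \<dots>"
    by (rule closedin_zeros3) (use bil_forms3(1) in blast)
  ultimately show ?thesis by simp
qed

lemma pt3_in_bil_surface:
  assumes "nz3 (s, t, u)"
  shows "pt3 (s, t, u) \<in> bil_surface g \<longleftrightarrow> bil g t u = 0"
  using forms3_pt3[OF bil_forms3(1)[of g] assms] by (simp add: bil_surface_def)

text \<open>A form of rank two determines the third factor from the second by an invertible linear
  map, so the surface is a graph and lines in the first two factors lift to lines on it.\<close>

lemma bil_surface_graph:
  assumes det: "g 0 0 * g 1 1 \<noteq> g 0 1 * g 1 0"
  shows "irreducible_closed zariski3 (bil_surface g)"
    and "\<exists>r. \<forall>p. (p, q, r) \<in> bil_surface g"
proof -
  \<comment> \<open>\<open>M x\<close> is the solution \<open>y\<close> of the linear equation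
    \<open>bil g x y = 0\<close>, unique up to scaling.\<close>
  define M where "M x = hpair (- (g 0 1 * x $ 0 + g 1 1 * x $ 1)) (g 0 0 * x $ 0 + g 1 0 * x $ 1)" for x :: "complex^2"
  have M0: "M x \<noteq> 0" if "x \<noteq> 0" for x
  proof
    assume "M x = 0"
    then have "M x $ 0 = 0" "M x $ 1 = 0" by simp_all
    then have e: "g 0 1 * x $ 0 + g 1 1 * x $ 1 = 0" "g 0 0 * x $ 0 + g 1 0 * x $ 1 = 0"
      unfolding M_def hpair_nth by (simp_all only: neg_equal_0_iff_equal)
    have "(g 0 0 * g 1 1 - g 0 1 * g 1 0) * x $ 0 =
        g 1 1 * (g 0 0 * x $ 0 + g 1 0 * x $ 1) - g 1 0 * (g 0 1 * x $ 0 + g 1 1 * x $ 1)"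
      by (simp add: algebra_simps)
    then have x0: "x $ 0 = 0" using det e by simp
    have "(g 0 0 * g 1 1 - g 0 1 * g 1 0) * x $ 1 =
        g 0 0 * (g 0 1 * x $ 0 + g 1 1 * x $ 1) - g 0 1 * (g 0 0 * x $ 0 + g 1 0 * x $ 1)"
      by (simp add: algebra_simps)
    then have "x $ 1 = 0" using det e by simp
    then show False using that x0 by (simp add: vec2_eq_iff)
  qed
  have bM: "bil g x (M x) = 0" for x by (simp add: bil_eq M_def algebra_simps)
  have Madd: "M (x + z *s y) = M x + z *s M y" for x y z
    by (simp add: M_def vec2_eq_iff algebra_simps)
  have r: "r = pt (M (rep q))" if "bil g (rep q) (rep r) = 0" for q r
  proof -
    have "M (rep q) $ 0 * rep r $ 1 - M (rep q) $ 1 * rep r $ 0 = - bil g (rep q) (rep r)"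
      by (simp add: M_def bil_eq algebra_simps)
    then have "M (rep q) $ 0 * rep r $ 1 = M (rep q) $ 1 * rep r $ 0" using that by simp
    then have "pt (M (rep q)) = pt (rep r)" by (rule pt_eq_2[THEN iffD2, OF M0[OF rep_nonzero] rep_nonzero])
    then show ?thesis by simp
  qed
  show "\<exists>r. \<forall>p. (p, q, r) \<in> bil_surface g"
  proof (intro exI allI)
    fix p
    show "(p, q, pt (M (rep q))) \<in> bil_surface g"
      using pt3_in_bil_surface[of "rep p" "rep q" "M (rep q)" g] M0 bM by simp
  qed
  then have "bil_surface g \<noteq> {}" by blast
  then show "irreducible_closed zariski3 (bil_surface g)"
  proof (rule irreducible_closed_lines[OF closedin_bil_surface])
    fix x y assume "x \<in> bil_surface g" "y \<in> bil_surface g"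
    then obtain p q p' q' where xy: "x = (p, q, pt (M (rep q)))" "y = (p', q', pt (M (rep q')))"
      using r by (auto simp: bil_surface_def)
    have e: "line3 (rep p, rep q, M (rep q)) (rep p' - rep p, rep q' - rep q, M (rep q') - M (rep q)) z =
      (rep p + z *s (rep p' - rep p), rep q + z *s (rep q' - rep q), M (rep q + z *s (rep q' - rep q)))" for z
    proof -
      have "M (rep q') - M (rep q) = M (rep q' - rep q)" using Madd[of "rep q'" "-1" "rep q"] by simp
      then show ?thesis by (simp only: line3.simps Madd)
    qed
    show "\<exists>v w. nz3 v \<and> nz3 (line3 v w 1) \<and> pt3 v = x \<and> pt3 (line3 v w 1) = y \<and>
        (\<forall>z. nz3 (line3 v w z) \<longrightarrow> pt3 (line3 v w z) \<in> bil_surface g)"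
    proof (rule exI[of _ "(rep p, rep q, M (rep q))"],
        rule exI[of _ "(rep p' - rep p, rep q' - rep q, M (rep q') - M (rep q))"], intro conjI allI impI)
      fix z
      assume "nz3 (line3 (rep p, rep q, M (rep q)) (rep p' - rep p, rep q' - rep q, M (rep q') - M (rep q)) z)"
      then show "pt3 (line3 (rep p, rep q, M (rep q)) (rep p' - rep p, rep q' - rep q, M (rep q') - M (rep q)) z)
          \<in> bil_surface g"
        unfolding e by (simp only: pt3_in_bil_surface bM)
    qed (simp_all add: xy M0)
  qed
qed

text \<open>All 2x2 minors vanish, so each entry is the product of an entry in the column of the
  pivot \<open>g j0 k0\<close> and one in its row, divided by the pivot.\<close>

lemma bil_rank_1:
  assumes g: "g j0 k0 \<noteq> 0" and det: "g 0 0 * g 1 1 = g 0 1 * g 1 0"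
  obtains l m :: "complex^2" where "l \<noteq> 0" "m \<noteq> 0"
    "\<And>x y. bil g x y = (l $ 0 * x $ 0 + l $ 1 * x $ 1) * (m $ 0 * y $ 0 + m $ 1 * y $ 1)"
proof -
  have "\<forall>i n j k. g i n * g j k = g i k * g j n"
    unfolding all_type_2 using det by (simp add: mult.commute)
  then have e: "g i n = g i k0 * (g j0 n / g j0 k0)" for i n
    using g by (simp add: eq_divide_eq)
  define l :: "complex^2" where "l = hpair (g 0 k0) (g 1 k0)"
  define m :: "complex^2" where "m = hpair (g j0 0 / g j0 k0) (g j0 1 / g j0 k0)"
  have lm: "g i n = l $ i * m $ n" for i n
  proof -
    have "\<forall>i. l $ i = g i k0" "\<forall>n. m $ n = g j0 n / g j0 k0" unfolding all_type_2 l_def m_def by simp_all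
    then show ?thesis using e[of i n] by simp
  qed
  have "l \<noteq> 0" "m \<noteq> 0" using lm[of j0 k0] g by auto
  then show ?thesis
  proof (rule that)
    show "bil g x y = (l $ 0 * x $ 0 + l $ 1 * x $ 1) * (m $ 0 * y $ 0 + m $ 1 * y $ 1)" for x y
      unfolding bil_eq lm by (simp add: algebra_simps)
  qed
qed

lemma linear_form_zero_2:
  fixes l :: "complex^2"
  assumes "l \<noteq> 0"
  shows "l $ 0 * rep q $ 0 + l $ 1 * rep q $ 1 = 0 \<longleftrightarrow> q = pt (hpair (- (l $ 1)) (l $ 0))"
proof -
  have n: "hpair (- (l $ 1)) (l $ 0) \<noteq> 0" using assms by (auto simp: vec2_eq_iff)
  have "q = pt (hpair (- (l $ 1)) (l $ 0)) \<longleftrightarrow> rep q $ 0 * l $ 0 = rep q $ 1 * - (l $ 1)"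
    using pt_eq_2[OF rep_nonzero n, of q] by simp
  also have "\<dots> \<longleftrightarrow> l $ 0 * rep q $ 0 + l $ 1 * rep q $ 1 = 0"
    by (simp add: mult.commute eq_neg_iff_add_eq_0)
  finally show ?thesis by blast
qed

text \<open>Rank two gives one irreducible surface, listed twice; rank one factors the form and
  gives a surface with constant \<open>q\<close> and one with constant \<open>r\<close>. The last
  property, that whole lines in the first factor lie over every \<open>q\<close> or over every
  \<open>r\<close>, serves both the dimension count and the comparison with the base curve.\<close>

lemma bil_surface_components:
  assumes g: "bil g x y \<noteq> 0"
  obtains Y1 Y2 where "bil_surface g = Y1 \<union> Y2"
    "\<And>Y. Y \<in> {Y1, Y2} \<Longrightarrow> irreducible_closed zariski3 Y"
    "\<And>Y. Y \<in> {Y1, Y2} \<Longrightarrow> (\<forall>q. \<exists>r. \<forall>p. (p, q, r) \<in> Y) \<or> (\<forall>r. \<exists>q. \<forall>p. (p, q, r) \<in> Y)"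
proof (cases "g 0 0 * g 1 1 = g 0 1 * g 1 0")
  case False
  show ?thesis
    by (rule that[of "bil_surface g" "bil_surface g"]) (use bil_surface_graph[of g, OF False] in auto)
next
  case True
  have "\<exists>j k. g j k \<noteq> 0"
  proof (rule ccontr)
    assume "\<nexists>j k. g j k \<noteq> 0"
    then show False using g by (simp add: bil_eq)
  qed
  then obtain j k where jk: "g j k \<noteq> 0" by blast
  show ?thesis
  proof (rule bil_rank_1[of g j k, OF jk True])
    fix l m :: "complex^2"
    assume lm: "l \<noteq> 0" "m \<noteq> 0"
      "\<And>x y. bil g x y = (l $ 0 * x $ 0 + l $ 1 * x $ 1) * (m $ 0 * y $ 0 + m $ 1 * y $ 1)"
    let ?q = "pt (hpair (- (l $ 1)) (l $ 0))" and ?r = "pt (hpair (- (m $ 1)) (m $ 0))"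
    show ?thesis
    proof (rule that[of "{(p, q, r). q = ?q}" "{(p, q, r). r = ?r}"])
      show "bil_surface g = {(p, q, r). q = ?q} \<union> {(p, q, r). r = ?r}"
        unfolding bil_surface_def lm(3) mult_eq_0_iff linear_form_zero_2[OF lm(1)] linear_form_zero_2[OF lm(2)]
        by blast
    next
      fix Y :: "P1_3 set" assume Y: "Y \<in> {{(p, q, r). q = ?q}, {(p, q, r). r = ?r}}"
      then show "irreducible_closed zariski3 Y"
        using irreducible_closed_second[of ?q] irreducible_closed_third[of ?r] by blast
      show "(\<forall>q. \<exists>r. \<forall>p. (p, q, r) \<in> Y) \<or> (\<forall>r. \<exists>q. \<forall>p. (p, q, r) \<in> Y)"
        using Y by auto
    qed
  qed
qed

lemma bil_surface_not_UNIV: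
  assumes g: "bil g x y \<noteq> 0"
  shows "bil_surface g \<noteq> UNIV"
proof
  assume U: "bil_surface g = UNIV"
  have "nz3 (hpair 1 0, x, y)" using g by (auto simp: bil_eq vec2_eq_iff)
  then show False using pt3_in_bil_surface[of "hpair 1 0" x y g] g U by simp
qed

lemma ex_other_point: "\<exists>q. q \<noteq> (p :: 2 cproj)"
proof -
  have "pt (hpair 1 0) \<noteq> pt (hpair 0 1)" using pt_eq_2[of "hpair 1 0" "hpair 0 1"] by (auto simp: vec2_eq_iff)
  then show ?thesis by metis
qed

text \<open>The chain consists of a point and a line in the first factor through it. The line is not
  all of \<open>Y\<close>, because \<open>Y\<close> has such lines over at least two parameter
  values.\<close>

lemma surface_chain:
  assumes "(\<forall>q. \<exists>r. \<forall>p. (p, q, r) \<in> Y) \<or> (\<forall>r. \<exists>q. \<forall>p. (p, q, r) \<in> Y)"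
  shows "\<exists>Z0 Z1. irreducible_closed zariski3 Z0 \<and> irreducible_closed zariski3 Z1 \<and> Z0 \<subset> Z1 \<and> Z1 \<subset> Y"
proof -
  have "\<exists>q0 r0. (\<forall>p. (p, q0, r0) \<in> Y) \<and> (\<exists>p q r. (p, q, r) \<in> Y \<and> (q, r) \<noteq> (q0, r0))"
    using assms
  proof
    assume *: "\<forall>q. \<exists>r. \<forall>p. (p, q, r) \<in> Y"
    obtain q0 q1 :: "2 cproj" where "q1 \<noteq> q0" using ex_other_point by blast
    moreover obtain r0 where "\<forall>p. (p, q0, r0) \<in> Y" using * by blast
    moreover obtain r1 where "\<forall>p. (p, q1, r1) \<in> Y" using * by blast
    ultimately show ?thesis by blast
  next
    assume *: "\<forall>r. \<exists>q. \<forall>p. (p, q, r) \<in> Y"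
    obtain r0 r1 :: "2 cproj" where "r1 \<noteq> r0" using ex_other_point by blast
    moreover obtain q0 where "\<forall>p. (p, q0, r0) \<in> Y" using * by blast
    moreover obtain q1 where "\<forall>p. (p, q1, r1) \<in> Y" using * by blast
    ultimately show ?thesis by blast
  qed
  then obtain q0 r0 p1 q1 r1 where *: "\<And>p. (p, q0, r0) \<in> Y" "(p1, q1, r1) \<in> Y" "(q1, r1) \<noteq> (q0, r0)" by blast
  obtain p0 p0' :: "2 cproj" where p0: "p0' \<noteq> p0" using ex_other_point by blast
  let ?L = "{(p, q, r). q = q0 \<and> r = r0}"
  have "{(p0, q0, r0)} \<subset> ?L"
  proof
    show "{(p0, q0, r0)} \<subseteq> ?L" by simp
    have "(p0', q0, r0) \<in> ?L" "(p0', q0, r0) \<notin> {(p0, q0, r0)}" using p0 by auto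
    then show "{(p0, q0, r0)} \<noteq> ?L" by blast
  qed
  moreover have "?L \<subset> Y"
  proof
    show "?L \<subseteq> Y" using *(1) by auto
    have "(p1, q1, r1) \<notin> ?L" using *(3) by simp
    then show "?L \<noteq> Y" using *(2) by blast
  qed
  ultimately show ?thesis
    using irreducible_closed_second_third[of q0 r0] irreducible_closed_sing[OF closedin_zariski3_sing]
    by (intro exI[of _ "{(p0, q0, r0)}"] exI[of _ ?L] conjI)
qed

lemma irreducible_in_union:
  assumes "irreducible_closed X Z" "closedin X A" "closedin X B" "Z \<subseteq> A \<union> B"
  shows "Z \<subseteq> A \<or> Z \<subseteq> B"
proof -
  have "closedin X (Z \<inter> A)" "closedin X (Z \<inter> B)" "Z = (Z \<inter> A) \<union> (Z \<inter> B)"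
    using assms unfolding irreducible_closed_def by (auto intro: closedin_Int)
  then have "Z = Z \<inter> A \<or> Z = Z \<inter> B" using assms(1) unfolding irreducible_closed_def by blast
  then show ?thesis by blast
qed

text \<open>The map \<open>f\<close> stands for a power of the cyclic shift, so that all three pairs
  of factors are covered. The upper bound is the one for proper closed sets, the lower bound comes
  from \<open>surface_chain\<close>.\<close>

lemma pure_dim_bil_surface:
  assumes g: "bil g x y \<noteq> 0"
    and f: "\<And>Z. irreducible_closed zariski3 Z \<Longrightarrow> irreducible_closed zariski3 (f ` Z)" "bij f"
  shows "pure_dim zariski3 (f ` bil_surface g) 2"
    and "krull_dim (subtopology zariski3 (f ` bil_surface g)) = 2"
proof -
  obtain Y1 Y2 where Y: "bil_surface g = Y1 \<union> Y2"
    "\<And>Y. Y \<in> {Y1, Y2} \<Longrightarrow> irreducible_closed zariski3 Y"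
    "\<And>Y. Y \<in> {Y1, Y2} \<Longrightarrow> (\<forall>q. \<exists>r. \<forall>p. (p, q, r) \<in> Y) \<or> (\<forall>r. \<exists>q. \<forall>p. (p, q, r) \<in> Y)"
    using bil_surface_components[OF g] by metis
  have fY: "irreducible_closed zariski3 (f ` Y1)" "irreducible_closed zariski3 (f ` Y2)"
    using Y(2) f(1) by blast+
  then have cl: "closedin zariski3 (f ` Y1)" "closedin zariski3 (f ` Y2)" "f ` Y1 \<noteq> {}"
    by (auto simp: irreducible_closed_def)
  have V: "f ` bil_surface g = f ` Y1 \<union> f ` Y2" unfolding Y(1) by (rule image_Un)
  have VU: "f ` bil_surface g \<noteq> UNIV"
  proof
    assume "f ` bil_surface g = UNIV"
    then have "f ` bil_surface g = f ` UNIV" using bij_is_surj[OF f(2)] by simp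
    then have "bil_surface g = UNIV" using inj_image_eq_iff[OF bij_is_inj[OF f(2)]] by blast
    then show False using bil_surface_not_UNIV[OF g] by blast
  qed
  have clV: "closedin zariski3 (f ` bil_surface g)" unfolding V using cl by (intro closedin_Un)
  have le2: "krull_dim (subtopology zariski3 (f ` bil_surface g)) \<le> 2"
    by (rule krull_dim_zariski3_le_2[OF clV VU])
  have chain: "enat 2 \<le> krull_dim (subtopology zariski3 S)"
    if Y': "Y \<in> {Y1, Y2}" "f ` Y \<subseteq> S" and S: "closedin zariski3 S" for Y S
  proof -
    have fY': "irreducible_closed zariski3 (f ` Y)" using f(1) Y(2) Y'(1) by blast
    obtain Z0 Z1 where Z: "irreducible_closed zariski3 Z0" "irreducible_closed zariski3 Z1" "Z0 \<subset> Z1" "Z1 \<subset> Y"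
      using surface_chain[OF Y(3)[OF Y'(1)]] by blast
    define Z where "Z i = f ` (if i = 0 then Z0 else if i = 1 then Z1 else Y)" for i :: nat
    show ?thesis
    proof (rule le_krull_dim[of _ _ Z])
      have "irreducible_closed zariski3 (Z i) \<and> Z i \<subseteq> S" for i
        using f(1)[OF Z(1)] f(1)[OF Z(2)] fY' Z(3,4) Y'(2) by (auto simp: Z_def)
      then show "\<forall>i\<le>2. irreducible_closed (subtopology zariski3 S) (Z i)"
        using irreducible_closed_subtopology[OF S] by blast
      have "f ` Z0 \<subset> f ` Z1" "f ` Z1 \<subset> f ` Y"
        using Z(3,4) image_strict_mono[OF inj_on_subset[OF bij_is_inj[OF f(2)] subset_UNIV]] by blast+
      then have "Z i \<subset> Z (Suc i)" if "i < 2" for i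
      proof -
        have "i = 0 \<or> i = 1" using that by linarith
        then show ?thesis using \<open>f ` Z0 \<subset> f ` Z1\<close> \<open>f ` Z1 \<subset> f ` Y\<close> by (elim disjE) (simp_all add: Z_def)
      qed
      then show "\<forall>i<2. Z i \<subset> Z (Suc i)" by blast
    qed
  qed
  have dim: "krull_dim (subtopology zariski3 (f ` Y)) = enat 2" if Y': "Y \<in> {Y1, Y2}" for Y
  proof -
    have fY': "irreducible_closed zariski3 (f ` Y)" using f(1) Y(2) Y' by blast
    then have cl': "closedin zariski3 (f ` Y)" by (simp add: irreducible_closed_def)
    have "krull_dim (subtopology zariski3 (f ` Y)) \<le> 2"
    proof (rule krull_dim_zariski3_le_2)
      show "closedin zariski3 (f ` Y)" by (rule cl')
      show "f ` Y \<noteq> UNIV" using VU Y' unfolding V by blast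
    qed
    moreover have "enat 2 \<le> krull_dim (subtopology zariski3 (f ` Y))"
      by (rule chain[OF Y' order.refl cl'])
    ultimately show ?thesis by (simp add: numeral_eq_enat order_antisym)
  qed
  have "enat 2 \<le> krull_dim (subtopology zariski3 (f ` bil_surface g))"
    by (rule chain[OF _ _ clV, of Y1]) (simp_all add: V)
  then show "krull_dim (subtopology zariski3 (f ` bil_surface g)) = 2"
    using le2 by (simp add: numeral_eq_enat order_antisym)
  show "pure_dim zariski3 (f ` bil_surface g) 2"
    unfolding pure_dim_def
  proof (intro conjI allI impI)
    show "closedin zariski3 (f ` bil_surface g)" by (rule clV)
    show "f ` bil_surface g \<noteq> {}" unfolding V using cl(3) by blast
    fix Z assume Z: "irreducible_component zariski3 (f ` bil_surface g) Z"
    then have Zi: "irreducible_closed zariski3 Z" "Z \<subseteq> f ` Y1 \<union> f ` Y2"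
      unfolding irreducible_component_def V by blast+
    have "Z = f ` Y1 \<or> Z = f ` Y2"
      using irreducible_in_union[OF Zi(1) cl(1,2) Zi(2)]
    proof
      assume "Z \<subseteq> f ` Y1"
      then show ?thesis using Z fY unfolding irreducible_component_def V by blast
    next
      assume "Z \<subseteq> f ` Y2"
      then show ?thesis using Z fY unfolding irreducible_component_def V by blast
    qed
    then show "krull_dim (subtopology zariski3 Z) = enat 2" using dim by blast
  qed
qed

section \<open>Cyclic permutation of the three factors\<close>

fun rot3 :: "P1_3 \<Rightarrow> P1_3" where
  "rot3 (p, q, r) = (q, r, p)"

lemma bij_rot3: "bij rot3"
proof (rule bijI')
  fix x y show "rot3 x = rot3 y \<longleftrightarrow> x = y" by (cases x; cases y) auto
next
  fix y :: P1_3
  obtain p q r where "y = (p, q, r)" by (cases y) auto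
  then show "\<exists>x. y = rot3 x" by (intro exI[of _ "(r, p, q)"]) simp
qed

lemma poly_funs_rotate:
  assumes "f \<in> poly_funs coords3"
  shows "(\<lambda>(s, t, u). f (t, u, s)) \<in> poly_funs coords3"
  using assms
proof induction
  case (coord f)
  then show ?case by (intro poly_funs.coord) (auto simp: coords3_def fun_eq_iff)
qed (auto simp: case_prod_unfold intro: poly_funs.intros)

lemma forms3_rotate:
  assumes "f \<in> forms3 a b c"
  shows "(\<lambda>(s, t, u). f (t, u, s)) \<in> forms3 c a b"
proof -
  have "f (l *s s, m *s t, n *s u) = l ^ a * m ^ b * n ^ c * f (s, t, u)" for l m n s t u
    using assms by (simp add: forms3_def)
  then show ?thesis using assms poly_funs_rotate[of f] by (simp add: forms3_def)
qed

lemma closedin_rot3_vimage: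
  assumes "closedin zariski3 Z"
  shows "closedin zariski3 (rot3 -` Z)"
  unfolding closedin_zariski3
proof (intro allI impI)
  fix x assume "x \<notin> rot3 -` Z"
  then have "rot3 x \<notin> Z" by simp
  from assms[unfolded closedin_zariski3, rule_format, OF this]
  obtain f a b c where f: "f \<in> forms3 a b c" "f (rep3 (rot3 x)) \<noteq> 0" "\<forall>p\<in>Z. f (rep3 p) = 0"
    by (elim exE conjE)
  have e: "(\<lambda>(s, t, u). f (t, u, s)) (rep3 p) = f (rep3 (rot3 p))" for p by (cases p) simp
  show "\<exists>f. (\<exists>a b c. f \<in> forms3 a b c) \<and> f (rep3 x) \<noteq> 0 \<and> (\<forall>p\<in>rot3 -` Z. f (rep3 p) = 0)"
    by (rule exI[of _ "\<lambda>(s, t, u). f (t, u, s)"]) (use forms3_rotate[OF f(1)] f(2,3) in \<open>auto simp only: e vimage_eq\<close>)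
qed

lemma rot3_rot3_rot3 [simp]: "rot3 (rot3 (rot3 x)) = x"
  by (cases x) simp

lemma closedin_rot3:
  assumes "closedin zariski3 Z"
  shows "closedin zariski3 (rot3 ` Z)"
proof -
  have "rot3 ` Z = rot3 -` rot3 -` Z"
  proof (intro equalityI subsetI)
    fix y assume "y \<in> rot3 -` rot3 -` Z"
    then show "y \<in> rot3 ` Z" by (intro image_eqI[of _ _ "rot3 (rot3 y)"]) auto
  qed auto
  then show ?thesis using closedin_rot3_vimage[OF closedin_rot3_vimage[OF assms]] by simp
qed

lemma irreducible_closed_rot3:
  assumes Z: "irreducible_closed zariski3 Z"
  shows "irreducible_closed zariski3 (rot3 ` Z)"
  unfolding irreducible_closed_def
proof (intro conjI allI impI)
  show "closedin zariski3 (rot3 ` Z)" "rot3 ` Z \<noteq> {}"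
    using Z closedin_rot3 by (auto simp: irreducible_closed_def)
  fix A B assume AB: "closedin zariski3 A \<and> closedin zariski3 B \<and> rot3 ` Z = A \<union> B"
  then have "Z = rot3 -` A \<union> rot3 -` B"
    using inj_vimage_image_eq[OF bij_is_inj[OF bij_rot3], of Z] by auto
  moreover have "closedin zariski3 (rot3 -` A)" "closedin zariski3 (rot3 -` B)"
    using AB closedin_rot3_vimage by blast+
  ultimately have "Z = rot3 -` A \<or> Z = rot3 -` B"
    using Z[unfolded irreducible_closed_def] by (elim conjE) (erule allE, erule allE, erule impE, simp, simp)
  moreover have "rot3 ` rot3 -` S = S" for S
    by (rule surj_image_vimage_eq[OF bij_is_surj[OF bij_rot3]])
  ultimately show "rot3 ` Z = A \<or> rot3 ` Z = B" by (elim disjE) simp_all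
qed

lemma pure_dim_bil:
  assumes g: "bil g x y \<noteq> 0"
  shows "pure_dim zariski3 {(p, q, r). bil g (rep q) (rep r) = 0} 2"
    and "pure_dim zariski3 {(p, q, r). bil g (rep r) (rep p) = 0} 2"
    and "pure_dim zariski3 {(p, q, r). bil g (rep p) (rep q) = 0} 2"
    and "krull_dim (subtopology zariski3 {(p, q, r). bil g (rep q) (rep r) = 0}) = 2"
    and "krull_dim (subtopology zariski3 {(p, q, r). bil g (rep r) (rep p) = 0}) = 2"
    and "krull_dim (subtopology zariski3 {(p, q, r). bil g (rep p) (rep q) = 0}) = 2"
proof -
  have 0: "id ` bil_surface g = {(p, q, r). bil g (rep q) (rep r) = 0}" by (simp add: bil_surface_def)
  show "pure_dim zariski3 {(p, q, r). bil g (rep q) (rep r) = 0} 2"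
    "krull_dim (subtopology zariski3 {(p, q, r). bil g (rep q) (rep r) = 0}) = 2"
    using pure_dim_bil_surface[OF g _ bij_id] unfolding 0 by simp_all
  have 1: "rot3 ` bil_surface g = {(p, q, r). bil g (rep p) (rep q) = 0}"
  proof (intro equalityI subsetI)
    fix x :: P1_3 assume "x \<in> {(p, q, r). bil g (rep p) (rep q) = 0}"
    then show "x \<in> rot3 ` bil_surface g"
      by (intro image_eqI[of _ _ "rot3 (rot3 x)"]) (auto simp: bil_surface_def)
  qed (auto simp: bil_surface_def)
  show "pure_dim zariski3 {(p, q, r). bil g (rep p) (rep q) = 0} 2"
    "krull_dim (subtopology zariski3 {(p, q, r). bil g (rep p) (rep q) = 0}) = 2"
    using pure_dim_bil_surface[OF g irreducible_closed_rot3 bij_rot3] unfolding 1 by simp_all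
  have 2: "(rot3 \<circ> rot3) ` bil_surface g = {(p, q, r). bil g (rep r) (rep p) = 0}"
  proof (intro equalityI subsetI)
    fix x :: P1_3 assume "x \<in> {(p, q, r). bil g (rep r) (rep p) = 0}"
    then show "x \<in> (rot3 \<circ> rot3) ` bil_surface g"
      by (intro image_eqI[of _ _ "rot3 x"]) (auto simp: bil_surface_def)
  qed (auto simp: bil_surface_def)
  have irr: "irreducible_closed zariski3 ((rot3 \<circ> rot3) ` Z)" if "irreducible_closed zariski3 Z" for Z
    unfolding image_comp[symmetric] by (intro irreducible_closed_rot3 that)
  show "pure_dim zariski3 {(p, q, r). bil g (rep r) (rep p) = 0} 2"
    "krull_dim (subtopology zariski3 {(p, q, r). bil g (rep r) (rep p) = 0}) = 2"
    using pure_dim_bil_surface[OF g irr bij_comp[OF bij_rot3 bij_rot3]] unfolding 2 by simp_all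
qed

subsection \<open>The base curve\<close>

lemma axis_form_bil: "axis_form a b c = bil (\<lambda>j k. dot (a 1) (wedge (a 0) (b j) (c k)))"
  by (intro ext) (simp add: axis_form_bilinear bil_def)

lemma wedge_dependent:
  assumes "l *s a + m *s b + n *s c = 0" "l \<noteq> 0 \<or> m \<noteq> 0 \<or> n \<noteq> 0"
  shows "wedge a b c = 0"
proof -
  have *: "wedge a b c = 0" if "l *s a + m *s b + n *s c = 0" "l \<noteq> 0" for a b c l m n
  proof -
    have "0 = wedge (l *s a + m *s b + n *s c) b c" using that(1) by simp
    also have "\<dots> = l *s wedge a b c" by (simp only: wedge_add wedge_scale wedge_same) simp
    finally show ?thesis using that(2) by simp
  qed
  consider "l \<noteq> 0" | "m \<noteq> 0" | "n \<noteq> 0" using assms(2) by blast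
  then show ?thesis
  proof cases
    case 1
    then show ?thesis using *[OF assms(1)] by blast
  next
    case 2
    have "m *s b + n *s c + l *s a = 0" using assms(1) by (simp add: algebra_simps)
    from *[OF this 2] show ?thesis by (simp add: wedge_cyc)
  next
    case 3
    have "n *s c + l *s a + m *s b = 0" using assms(1) by (simp add: algebra_simps)
    from *[OF this 3] show ?thesis by (simp add: wedge_cyc)
  qed
qed

lemma meet_dependent:
  assumes "l *s lc a s + m *s lc b t + n *s lc c u = 0" "l \<noteq> 0 \<or> m \<noteq> 0 \<or> n \<noteq> 0"
  shows "meet a b c (s, t, u) = 0"
  unfolding meet_def using wedge_dependent[OF assms] by simp

text \<open>Six unknowns against four equations and one normalisation.\<close>

lemma lc_relation:
  "\<exists>x y z. (x \<noteq> 0 \<or> y \<noteq> 0 \<or> z \<noteq> 0) \<and> lc a x + lc b y + lc c z = 0 \<and> x $ i0 = 0"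
proof -
  let ?I = "{0, 1, 2 :: nat} \<times> (UNIV :: 2 set)" and ?J = "UNIV :: 4 option set"
  define M where "M j = (\<lambda>(k :: nat, i). case j of
      Some m \<Rightarrow> (if k = 0 then a i else if k = 1 then b i else c i) $ m
    | None \<Rightarrow> (if k = 0 \<and> i = i0 then 1 else 0))" for j :: "4 option"
  have "card ?J < card ?I" by (simp add: card_cartesian_product UNIV_option_conv card_image)
  from linear_system_nontrivial[OF _ _ this, of M]
  obtain f where f: "\<exists>p\<in>?I. f p \<noteq> 0" "\<forall>j\<in>?J. (\<Sum>p\<in>?I. M j p * f p) = 0" by auto
  have s: "(\<Sum>p\<in>?I. M j p * f p) = (\<Sum>i\<in>UNIV. M j (0, i) * f (0, i)) + (\<Sum>i\<in>UNIV. M j (1, i) * f (1, i))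
      + (\<Sum>i\<in>UNIV. M j (2, i) * f (2, i))" for j
  proof -
    have "(\<Sum>p\<in>?I. M j p * f p) = (\<Sum>k\<in>{0, 1, 2}. \<Sum>i\<in>UNIV. M j (k, i) * f (k, i))"
      by (simp only: sum.cartesian_product case_prod_unfold prod.collapse)
    then show ?thesis by (simp add: add.assoc)
  qed
  define x :: "complex^2" where "x = (\<chi> i. f (0, i))"
  define y :: "complex^2" where "y = (\<chi> i. f (1, i))"
  define z :: "complex^2" where "z = (\<chi> i. f (2, i))"
  have "x \<noteq> 0 \<or> y \<noteq> 0 \<or> z \<noteq> 0"
    using f(1) by (auto simp: x_def y_def z_def vec_eq_iff)
  moreover have "lc a x + lc b y + lc c z = 0"
  proof -
    have "(lc a x + lc b y + lc c z) $ m = 0" for m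
      using f(2)[rule_format, of "Some m"] unfolding s
      by (simp add: M_def x_def y_def z_def lc_def sum_type_2 algebra_simps)
    then show ?thesis by (simp add: vec_eq_iff)
  qed
  moreover have "x $ i0 = 0"
  proof -
    have "(\<Sum>i\<in>UNIV. M None (0, i) * f (0, i)) = 0"
      using f(2)[rule_format, of None] unfolding s by (simp add: M_def)
    moreover have "(\<Sum>i\<in>UNIV. M None (0, i) * f (0, i)) = f (0, i0)"
      by (simp add: M_def if_distrib[of "\<lambda>x. x * _"] cong: if_cong)
    ultimately show ?thesis by (simp add: x_def)
  qed
  ultimately show ?thesis by blast
qed

lemma ex_other_vec:
  fixes s :: "complex^2"
  assumes "s \<noteq> 0"
  shows "\<exists>s' :: complex^2. s $ 0 * s' $ 1 \<noteq> s $ 1 * s' $ 0"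
proof (cases "s $ 0 = 0")
  case True
  then have "s $ 1 \<noteq> 0" using assms by (simp add: vec2_eq_iff)
  then show ?thesis using True by (intro exI[of _ "hpair 1 0"]) simp
next
  case False
  then show ?thesis by (intro exI[of _ "hpair 0 1"]) simp
qed

lemma pt_add_other:
  fixes s :: "complex^2"
  assumes "s \<noteq> 0" "s $ 0 * s' $ 1 \<noteq> s $ 1 * s' $ 0"
  shows "s + s' \<noteq> 0" "pt (s + s') \<noteq> pt s"
proof -
  show *: "s + s' \<noteq> 0"
  proof
    assume "s + s' = 0"
    then have "s' = - s" by (simp add: eq_neg_iff_add_eq_0 add.commute)
    then show False using assms(2) by simp
  qed
  have "s $ 0 * (s + s') $ 1 \<noteq> s $ 1 * (s + s') $ 0" using assms(2) by (simp add: algebra_simps)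
  then show "pt (s + s') \<noteq> pt s" using pt_eq_2[OF assms(1) *] by metis
qed

text \<open>A relation in which one pencil does not occur stays valid when the parameter of that
  pencil moves freely, which gives a coordinate line of base points.\<close>

lemma meet_zero_line:
  assumes v: "nz3 (s, t, u)"
    and rel: "l *s lc a s + m *s lc b t + n *s lc c u = 0"
    and some: "l = 0 \<or> m = 0 \<or> n = 0" "l \<noteq> 0 \<or> m \<noteq> 0 \<or> n \<noteq> 0"
  shows "\<exists>w. (\<forall>z. nz3 (line3 (s, t, u) w z) \<longrightarrow> meet a b c (line3 (s, t, u) w z) = 0) \<and>
    (\<exists>z. nz3 (line3 (s, t, u) w z) \<and> pt3 (line3 (s, t, u) w z) \<noteq> pt3 (s, t, u))"
  using some(1)
proof (elim disjE)
  assume 0: "l = 0"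
  obtain s' :: "complex^2" where s': "s $ 0 * s' $ 1 \<noteq> s $ 1 * s' $ 0" using ex_other_vec[of s] v by auto
  show ?thesis
  proof (rule exI[of _ "(s', 0, 0)"], intro conjI allI impI)
    show "meet a b c (line3 (s, t, u) (s', 0, 0) z) = 0" for z
      using meet_dependent[of 0 a "s + z *s s'" m b t n c u] rel some(2) 0 by simp
    show "\<exists>z. nz3 (line3 (s, t, u) (s', 0, 0) z) \<and> pt3 (line3 (s, t, u) (s', 0, 0) z) \<noteq> pt3 (s, t, u)"
      using pt_add_other[of s s'] s' v by (intro exI[of _ 1]) simp
  qed
next
  assume 0: "m = 0"
  obtain s' :: "complex^2" where s': "t $ 0 * s' $ 1 \<noteq> t $ 1 * s' $ 0" using ex_other_vec[of t] v by auto
  show ?thesis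
  proof (rule exI[of _ "(0, s', 0)"], intro conjI allI impI)
    show "meet a b c (line3 (s, t, u) (0, s', 0) z) = 0" for z
      using meet_dependent[of l a s 0 b "t + z *s s'" n c u] rel some(2) 0 by simp
    show "\<exists>z. nz3 (line3 (s, t, u) (0, s', 0) z) \<and> pt3 (line3 (s, t, u) (0, s', 0) z) \<noteq> pt3 (s, t, u)"
      using pt_add_other[of t s'] s' v by (intro exI[of _ 1]) simp
  qed
next
  assume 0: "n = 0"
  obtain s' :: "complex^2" where s': "u $ 0 * s' $ 1 \<noteq> u $ 1 * s' $ 0" using ex_other_vec[of u] v by auto
  show ?thesis
  proof (rule exI[of _ "(0, 0, s')"], intro conjI allI impI)
    show "meet a b c (line3 (s, t, u) (0, 0, s') z) = 0" for z
      using meet_dependent[of l a s m b t 0 c "u + z *s s'"] rel some(2) 0 by simp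
    show "\<exists>z. nz3 (line3 (s, t, u) (0, 0, s') z) \<and> pt3 (line3 (s, t, u) (0, 0, s') z) \<noteq> pt3 (s, t, u)"
      using pt_add_other[of u s'] s' v by (intro exI[of _ 1]) simp
  qed
qed

lemma pt_line_const:
  fixes s s' :: "complex^2"
  assumes "s \<noteq> 0" "s + z *s s' \<noteq> 0" "pt (s + z *s s') = pt s" "z \<noteq> 0"
  shows "\<exists>k. s' = k *s s"
proof -
  have "s $ 0 * (s + z *s s') $ 1 = s $ 1 * (s + z *s s') $ 0"
    using pt_eq_2[OF assms(1,2)] assms(3) by metis
  then have "z * (s $ 0 * s' $ 1 - s $ 1 * s' $ 0) = 0" by (simp add: algebra_simps)
  then have "s $ 0 * s' $ 1 = s $ 1 * s' $ 0" using assms(4) by simp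
  then show ?thesis by (rule parallel_2[OF assms(1)])
qed

text \<open>The vanishing wedge gives a relation with coefficients \<open>l\<close>,
  \<open>m\<close>, \<open>n\<close>. If none is zero, a second relation \<open>x\<close>,
  \<open>y\<close>, \<open>z\<close>, divided by them, is a direction along which the same
  coefficients keep working.\<close>

lemma meet_zero_curve:
  assumes v: "nz3 v" and zero: "meet a b c v = 0"
  shows "\<exists>w. (\<forall>z. nz3 (line3 v w z) \<longrightarrow> meet a b c (line3 v w z) = 0) \<and>
    (\<exists>z. nz3 (line3 v w z) \<and> pt3 (line3 v w z) \<noteq> pt3 v)"
proof -
  obtain s t u where stu: "v = (s, t, u)" by (cases v) auto
  have "wedge (lc a s) (lc b t) (lc c u) = 0" using zero by (simp add: stu meet_def)
  then obtain l m n where lmn: "l \<noteq> 0 \<or> m \<noteq> 0 \<or> n \<noteq> 0"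
    "l *s lc a s + m *s lc b t + n *s lc c u = 0" using wedge_zero_dependent by blast
  show ?thesis
  proof (cases "l = 0 \<or> m = 0 \<or> n = 0")
    case True
    then show ?thesis using meet_zero_line[OF _ lmn(2) True lmn(1)] v unfolding stu by blast
  next
    case False
    then have nz: "l \<noteq> 0" "m \<noteq> 0" "n \<noteq> 0" by auto
    obtain i0 where i0: "s $ i0 \<noteq> 0" using v stu by (auto simp: vec_eq_iff)
    \<comment> \<open>The normalisation at an index where \<open>s\<close> is nonzero prevents the
      second relation from being a multiple of the first.\<close>
    obtain x y z where xyz: "x \<noteq> 0 \<or> y \<noteq> 0 \<or> z \<noteq> 0" "lc a x + lc b y + lc c z = 0" "x $ i0 = 0"
      using lc_relation[of a b c i0] by blast
    define w where "w = ((1 / l) *s x, (1 / m) *s y, (1 / n) *s z)"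
    have w0: "meet a b c (line3 v w \<zeta>) = 0" for \<zeta>
    proof -
      have "l *s lc a (s + \<zeta> *s ((1 / l) *s x)) + m *s lc b (t + \<zeta> *s ((1 / m) *s y)) + n *s lc c (u + \<zeta> *s ((1 / n) *s z))
        = (l *s lc a s + m *s lc b t + n *s lc c u) + \<zeta> *s (lc a x + lc b y + lc c z)"
        using nz by (simp add: lc_add lc_scale vec4_eq_iff algebra_simps)
      then show ?thesis using meet_dependent[OF _ lmn(1)] lmn(2) xyz(2) by (simp add: stu w_def)
    qed
    show ?thesis
    proof (cases "\<exists>\<zeta>. nz3 (line3 v w \<zeta>) \<and> pt3 (line3 v w \<zeta>) \<noteq> pt3 v")
      case True
      then show ?thesis using w0 by blast
    next
      \<comment> \<open>If the line does not move the point, then \<open>x\<close>,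
        \<open>y\<close>, \<open>z\<close> are multiples of \<open>s\<close>, \<open>t\<close>,
        \<open>u\<close>. The normalisation makes the first multiple zero, so the second relation is
        one in which the pencil \<open>a\<close> does not occur.\<close>
      case const: False
      have "finite ({\<zeta>. \<not> nz3 (line3 v w \<zeta>)} \<union> {0})"
        using finite_not_nz3_line[of v w 0] v by simp
      from ex_not_in_finite[OF this] obtain \<zeta> where \<zeta>: "nz3 (line3 v w \<zeta>)" "\<zeta> \<noteq> 0" by blast
      then have e: "pt3 (line3 v w \<zeta>) = pt3 v" using const by blast
      have "\<exists>k. (1 / l) *s x = k *s s" "\<exists>k. (1 / m) *s y = k *s t" "\<exists>k. (1 / n) *s z = k *s u"
        using e \<zeta> v by (auto simp: stu w_def intro!: pt_line_const[of _ \<zeta>])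
      then obtain k1 k2 k3 where k: "(1 / l) *s x = k1 *s s" "(1 / m) *s y = k2 *s t" "(1 / n) *s z = k3 *s u"
        by blast
      have "x = l *s ((1 / l) *s x)" "y = m *s ((1 / m) *s y)" "z = n *s ((1 / n) *s z)"
        using nz by (simp_all only: vector_smult_assoc) simp_all
      then have eq: "x = (l * k1) *s s" "y = (m * k2) *s t" "z = (n * k3) *s u"
        unfolding k by (simp_all only: vector_smult_assoc)
      have "l * k1 * s $ i0 = 0" using xyz(3) unfolding eq(1) by simp
      then have x0: "l * k1 = 0" using i0 by simp
      have rel: "(l * k1) *s lc a s + (m * k2) *s lc b t + (n * k3) *s lc c u = 0"
        using xyz(2) unfolding eq lc_scale .
      have "l * k1 \<noteq> 0 \<or> m * k2 \<noteq> 0 \<or> n * k3 \<noteq> 0"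
      proof (rule ccontr)
        assume "\<not> ?thesis"
        then have "l * k1 = 0" "m * k2 = 0" "n * k3 = 0" by blast+
        then show False using xyz(1) unfolding eq by simp
      qed
      from meet_zero_line[OF _ rel _ this] show ?thesis using x0 v unfolding stu by blast
    qed
  qed
qed

text \<open>The first three conditions say that none of the three surfaces cut out by the axis forms
  is the whole product, the last that the six covectors span the dual space. Together they are
  invariant under cyclic permutation.\<close>

locale pencils =
  fixes a b c :: "2 \<Rightarrow> complex^4"
  assumes axis_a: "\<exists>t u. axis_form a b c t u \<noteq> 0"
    and axis_b: "\<exists>u s. axis_form b c a u s \<noteq> 0"
    and axis_c: "\<exists>s t. axis_form c a b s t \<noteq> 0"
    and no_common: "\<And>x. (\<And>i. dot (a i) x = 0) \<Longrightarrow> (\<And>i. dot (b i) x = 0) \<Longrightarrow> (\<And>i. dot (c i) x = 0) \<Longrightarrow> x = 0"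
begin

lemma rotate: "pencils b c a"
  by unfold_locales (use axis_a axis_b axis_c no_common in blast)+

text \<open>The values of the six covectors at the meet are coordinates of the parameters times the
  three axis forms; as the covectors have no common zero, these values decide whether the meet is
  zero.\<close>

lemma meet_zero_iff:
  assumes "nz3 (s, t, u)"
  shows "meet a b c (s, t, u) = 0 \<longleftrightarrow>
    axis_form a b c t u = 0 \<and> axis_form b c a u s = 0 \<and> axis_form c a b s t = 0"
proof -
  let ?x = "meet a b c (s, t, u)"
  have d: "dot (a 0) ?x = - (s $ 1) * axis_form a b c t u" "dot (a 1) ?x = s $ 0 * axis_form a b c t u"
    "dot (b 0) ?x = - (t $ 1) * axis_form b c a u s" "dot (b 1) ?x = t $ 0 * axis_form b c a u s"
    "dot (c 0) ?x = - (u $ 1) * axis_form c a b s t" "dot (c 1) ?x = u $ 0 * axis_form c a b s t"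
    using dot_meet[of a b c s t u] dot_meet[of b c a t u s] dot_meet[of c a b u s t]
    by (simp_all add: meet_rotate[of b c a] meet_rotate[of c a b])
  have nz: "s $ 0 \<noteq> 0 \<or> s $ 1 \<noteq> 0" "t $ 0 \<noteq> 0 \<or> t $ 1 \<noteq> 0" "u $ 0 \<noteq> 0 \<or> u $ 1 \<noteq> 0"
    using assms by (auto simp: vec2_eq_iff)
  show ?thesis
  proof
    assume "?x = 0"
    then show "axis_form a b c t u = 0 \<and> axis_form b c a u s = 0 \<and> axis_form c a b s t = 0"
      using d nz by auto
  next
    assume "axis_form a b c t u = 0 \<and> axis_form b c a u s = 0 \<and> axis_form c a b s t = 0"
    then have "\<forall>i. dot (a i) ?x = 0" "\<forall>i. dot (b i) ?x = 0" "\<forall>i. dot (c i) ?x = 0"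
      unfolding all_type_2 using d by simp_all
    then show "?x = 0" using no_common by blast
  qed
qed

definition base_curve :: "P1_3 set" where
  "base_curve = {p. meet a b c (rep3 p) = 0}"

lemma base_curve_eq:
  "base_curve = {(p, q, r). axis_form a b c (rep q) (rep r) = 0} \<inter>
    {(p, q, r). axis_form b c a (rep r) (rep p) = 0} \<inter> {(p, q, r). axis_form c a b (rep p) (rep q) = 0}"
  by (auto simp: base_curve_def meet_zero_iff)

lemma closedin_base_curve: "closedin zariski3 base_curve"
  unfolding base_curve_eq axis_form_bil
  using pure_dim_bil axis_a axis_b axis_c unfolding axis_form_bil pure_dim_def
  by (intro closedin_Int) blast+

lemma pt3_in_base_curve:
  assumes "nz3 v"
  shows "pt3 v \<in> base_curve \<longleftrightarrow> meet a b c v = 0"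
proof -
  obtain s t u where v: "v = (s, t, u)" by (cases v) auto
  from assms v obtain l m n where "l \<noteq> 0" "rep (pt s) = l *s s" "m \<noteq> 0" "rep (pt t) = m *s t"
    "n \<noteq> 0" "rep (pt u) = n *s u"
    by (auto elim!: rep_pt)
  then show ?thesis by (simp add: v base_curve_def meet_def lc_scale wedge_scale)
qed

text \<open>Three pencils offer six vectors in a space of dimension four, so a relation exists, and
  it describes a base point.\<close>

lemma base_curve_nonempty: "base_curve \<noteq> {}"
proof -
  obtain x y z where xyz: "x \<noteq> 0 \<or> y \<noteq> 0 \<or> z \<noteq> 0" "lc a x + lc b y + lc c z = 0"
    using lc_relation[of a b c 0] by blast
  \<comment> \<open>A zero parameter vector names no point; it is replaced by an arbitrary one with
    coefficient 0, which leaves the relation unchanged.\<close>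
  define f where "f x = (if x = 0 then hpair 1 0 else x)" for x :: "complex^2"
  define k where "k x = (if x = 0 then 0 else 1 :: complex)" for x :: "complex^2"
  have f: "f x \<noteq> 0" "x = k x *s f x" for x by (auto simp: f_def k_def vec2_eq_iff)
  have "k x *s lc a (f x) + k y *s lc b (f y) + k z *s lc c (f z) = 0"
    using xyz(2) unfolding lc_scale[symmetric] f(2)[symmetric] .
  moreover have "k x \<noteq> 0 \<or> k y \<noteq> 0 \<or> k z \<noteq> 0" using xyz(1) by (simp add: k_def)
  ultimately have "meet a b c (f x, f y, f z) = 0" by (rule meet_dependent)
  moreover have "nz3 (f x, f y, f z)" using f(1) by simp
  ultimately have "pt3 (f x, f y, f z) \<in> base_curve" using pt3_in_base_curve by blast
  then show ?thesis by blast
qed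

text \<open>All three axis forms vanish on the base curve. Whole lines in the first factor over
  every \<open>q\<close> would make \<open>axis_form c a b\<close> vanish identically, and over
  every \<open>r\<close> would do the same to \<open>axis_form b c a\<close>.\<close>

lemma surface_not_in_base_curve:
  assumes "(\<forall>q. \<exists>r. \<forall>p. (p, q, r) \<in> Y) \<or> (\<forall>r. \<exists>q. \<forall>p. (p, q, r) \<in> Y)"
  shows "\<not> Y \<subseteq> base_curve"
proof
  assume sub: "Y \<subseteq> base_curve"
  then have sub: "axis_form b c a (rep r) (rep p) = 0" "axis_form c a b (rep p) (rep q) = 0"
    if "(p, q, r) \<in> Y" for p q r
    using that unfolding base_curve_eq by blast+
  have zero: "bil h x y = 0" if "\<And>p q. bil h (rep p) (rep q) = 0" for h x y
  proof (rule ccontr)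
    assume n: "bil h x y \<noteq> 0"
    then have "x \<noteq> 0" "y \<noteq> 0" by (auto simp: bil_eq)
    then obtain l m where "l \<noteq> 0" "rep (pt x) = l *s x" "m \<noteq> 0" "rep (pt y) = m *s y"
      by (auto elim!: rep_pt)
    then have "bil h (rep (pt x)) (rep (pt y)) = l * m * bil h x y" by (simp add: bil_eq algebra_simps)
    then show False using that n \<open>l \<noteq> 0\<close> \<open>m \<noteq> 0\<close> by simp
  qed
  from assms show False
  proof
    assume "\<forall>q. \<exists>r. \<forall>p. (p, q, r) \<in> Y"
    then have "axis_form c a b (rep p) (rep q) = 0" for p q using sub(2) by blast
    then show False using axis_c zero unfolding axis_form_bil by blast
  next
    assume "\<forall>r. \<exists>q. \<forall>p. (p, q, r) \<in> Y"
    then have "axis_form b c a (rep r) (rep p) = 0" for p r using sub(1) by blast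
    then show False using axis_b zero unfolding axis_form_bil by blast
  qed
qed

text \<open>A component of the first surface contains \<open>Z\<close> but is not contained in the
  base curve; it supplies the intermediate set needed to bound the dimension by one.\<close>

lemma base_curve_in_surface:
  assumes Z: "irreducible_closed zariski3 Z" "Z \<subseteq> base_curve"
  shows "\<exists>Y. irreducible_closed zariski3 Y \<and> Z \<subset> Y \<and> Y \<noteq> UNIV"
proof -
  define g where "g = (\<lambda>j k. dot (a 1) (wedge (a 0) (b j) (c k)))"
  obtain x y where xy: "bil g x y \<noteq> 0" using axis_a unfolding axis_form_bil g_def by blast
  have Zg: "Z \<subseteq> bil_surface g"
    using Z(2) unfolding base_curve_eq axis_form_bil g_def bil_surface_def by blast
  show ?thesis
  proof (rule bil_surface_components[OF xy])
    fix Y1 Y2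
    assume Y: "bil_surface g = Y1 \<union> Y2"
      "\<And>Y. Y \<in> {Y1, Y2} \<Longrightarrow> irreducible_closed zariski3 Y"
      "\<And>Y. Y \<in> {Y1, Y2} \<Longrightarrow> (\<forall>q. \<exists>r. \<forall>p. (p, q, r) \<in> Y) \<or> (\<forall>r. \<exists>q. \<forall>p. (p, q, r) \<in> Y)"
    have "closedin zariski3 Y1" "closedin zariski3 Y2" using Y(2) by (simp_all add: irreducible_closed_def)
    then have "Z \<subseteq> Y1 \<or> Z \<subseteq> Y2" using irreducible_in_union[OF Z(1)] Zg Y(1) by blast
    then obtain Y where Y': "Y \<in> {Y1, Y2}" "Z \<subseteq> Y" by blast
    have "\<not> Y \<subseteq> base_curve" by (rule surface_not_in_base_curve[OF Y(3)[OF Y'(1)]])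
    then have "Z \<subset> Y" using Y'(2) Z(2) by blast
    moreover have "Y \<noteq> UNIV" using bil_surface_not_UNIV[OF xy] Y(1) Y'(1) by blast
    ultimately show ?thesis using Y(2)[OF Y'(1)] by blast
  qed
qed

text \<open>The closure of a line of base points through \<open>p\<close> is irreducible, lies in
  the base curve and is larger than the point.\<close>

lemma base_curve_no_isolated_point: "\<not> irreducible_component zariski3 base_curve {p}"
proof
  assume comp: "irreducible_component zariski3 base_curve {p}"
  then have "p \<in> base_curve" by (simp add: irreducible_component_def)
  then have "meet a b c (rep3 p) = 0" by (simp add: base_curve_def)
  from meet_zero_curve[OF nz3_rep3 this] obtain w where
    w: "\<And>z. nz3 (line3 (rep3 p) w z) \<Longrightarrow> meet a b c (line3 (rep3 p) w z) = 0"
    and other: "\<exists>z. nz3 (line3 (rep3 p) w z) \<and> pt3 (line3 (rep3 p) w z) \<noteq> p"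
    by auto
  define G where "G = {pt3 (line3 (rep3 p) w z) | z. nz3 (line3 (rep3 p) w z)}"
  \<comment> \<open>The line through two points of a given line is the same line, reparametrised so
    that 0 and 1 give these points.\<close>
  have shift: "line3 (line3 v w z1) (line3 (0, 0, 0) w (z2 - z1)) z = line3 v w (z1 + z * (z2 - z1))" for v w z1 z2 z
    by (cases v; cases w) (simp add: vec2_eq_iff algebra_simps)
  have "irreducible_closed zariski3 (zariski3 closure_of G)"
  proof (rule irreducible_closure_lines)
    show "G \<noteq> {}" unfolding G_def using other by blast
    fix x y assume "x \<in> G" "y \<in> G"
    then obtain z1 z2 where z: "x = pt3 (line3 (rep3 p) w z1)" "nz3 (line3 (rep3 p) w z1)"
      "y = pt3 (line3 (rep3 p) w z2)" "nz3 (line3 (rep3 p) w z2)" unfolding G_def by blast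
    show "\<exists>v w. nz3 v \<and> nz3 (line3 v w 1) \<and> pt3 v = x \<and> pt3 (line3 v w 1) = y \<and>
        (\<forall>z. nz3 (line3 v w z) \<longrightarrow> pt3 (line3 v w z) \<in> G)"
      by (rule exI[of _ "line3 (rep3 p) w z1"], rule exI[of _ "line3 (0, 0, 0) w (z2 - z1)"])
        (use z in \<open>auto simp: shift G_def\<close>)
  qed
  moreover have "zariski3 closure_of G \<subseteq> base_curve"
    by (rule closure_of_minimal[OF _ closedin_base_curve]) (auto simp: G_def pt3_in_base_curve w)
  moreover have "G \<subseteq> zariski3 closure_of G" by (simp add: closure_of_subset)
  moreover have "p \<in> G" unfolding G_def using nz3_rep3[of p] pt3_rep3[of p] line3_0[of "rep3 p" w]
    by (metis (mono_tags, lifting) mem_Collect_eq)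
  ultimately have "zariski3 closure_of G = {p}"
    using comp unfolding irreducible_component_def by blast
  then have "G \<subseteq> {p}" using \<open>G \<subseteq> zariski3 closure_of G\<close> by simp
  then show False using other unfolding G_def by blast
qed

lemma pure_dim_base_curve: "pure_dim zariski3 base_curve 1"
  unfolding pure_dim_def
proof (intro conjI allI impI)
  show "closedin zariski3 base_curve" "base_curve \<noteq> {}"
    by (rule closedin_base_curve base_curve_nonempty)+
  fix Z assume comp: "irreducible_component zariski3 base_curve Z"
  then have Z: "irreducible_closed zariski3 Z" "Z \<subseteq> base_curve" by (simp_all add: irreducible_component_def)
  then have cl: "closedin zariski3 Z" "Z \<noteq> {}" by (simp_all add: irreducible_closed_def)
  have "krull_dim (subtopology zariski3 Z) \<le> 1"
  proof (rule krull_dim_zariski3_le_1[OF cl(1)])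
    fix Z' assume "irreducible_closed zariski3 Z'" "Z' \<subseteq> Z"
    then show "\<exists>Y. irreducible_closed zariski3 Y \<and> Z' \<subset> Y \<and> Y \<noteq> UNIV"
      using base_curve_in_surface[of Z'] Z(2) by simp
  qed
  moreover have "enat 1 \<le> krull_dim (subtopology zariski3 Z)"
  proof -
    obtain p where p: "p \<in> Z" using cl(2) by blast
    have "Z \<noteq> {p}" using base_curve_no_isolated_point[of p] comp by auto
    then have lt: "{p} \<subset> Z" using p by blast
    show ?thesis
    proof (rule le_krull_dim[of _ _ "\<lambda>i. if i = 0 then {p} else Z"])
      show "\<forall>i<1. (if i = 0 then {p} else Z) \<subset> (if Suc i = 0 then {p} else Z)" using lt by simp
      show "\<forall>i\<le>1. irreducible_closed (subtopology zariski3 Z) (if i = 0 then {p} else Z)"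
        using irreducible_closed_subtopology[OF cl(1)] Z(1) p irreducible_closed_sing[OF closedin_zariski3_sing] by simp
    qed
  qed
  ultimately show "krull_dim (subtopology zariski3 Z) = enat 1" by (simp add: one_enat_def order_antisym)
qed

end

subsection \<open>Lines in projective 3-space\<close>

lemma span_pair: "v \<in> vec.span {x, y} \<longleftrightarrow> (\<exists>l m. v = l *s x + m *s y)"
  for v x y :: "complex^'n"
proof -
  have "v \<in> vec.span {x, y} \<longleftrightarrow> (\<exists>l. \<exists>m. v - l *s x = m *s y)"
    unfolding vec.span_insert[of x "{y}"] vec.span_singleton by (simp add: image_iff)
  also have "\<dots> \<longleftrightarrow> (\<exists>l m. v = l *s x + m *s y)" by (simp add: diff_eq_eq add.commute)
  finally show ?thesis .
qed

lemma is_lineE: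
  assumes "is_line L"
  obtains x y where "x \<noteq> 0" "y \<noteq> 0" "pt x \<noteq> pt y" "L = {p. \<exists>l m. rep p = l *s x + m *s y}"
proof -
  obtain U where U: "vec.subspace U" "vec.dim U = 2" "L = {p. rep p \<in> U}"
    using assms by (auto simp: is_line_def)
  obtain B where B: "B \<subseteq> U" "vec.independent B" "U \<subseteq> vec.span B" "card B = 2"
    using vec.basis_exists[of U] U(2) by metis
  obtain x y where xy: "B = {x, y}" "x \<noteq> y" using B(4) by (auto simp: card_2_iff)
  have nz: "x \<noteq> 0" "y \<noteq> 0" using B(2) vec.dependent_zero xy by auto
  have UB: "U = vec.span {x, y}"
    using B(1,3) U(1) xy(1) vec.span_minimal by blast
  have "pt x \<noteq> pt y"
  proof
    assume "pt x = pt y"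
    then obtain c where "y = c *s x" using pt_eq_iff[OF nz] by blast
    then have "y \<in> vec.span {x}" by (simp add: vec.span_base vec.span_scale)
    moreover have "vec.independent (insert y {x})"
    proof -
      have "insert y {x} = B" using xy(1) by blast
      then show ?thesis using B(2) by simp
    qed
    ultimately show False using xy(2) by (simp add: vec.independent_insert split: if_splits)
  qed
  moreover have "v \<in> U \<longleftrightarrow> (\<exists>l m. v = l *s x + m *s y)" for v
    unfolding UB by (rule span_pair)
  ultimately show ?thesis using nz U(3) by (intro that[of x y]) auto
qed

lemma is_lineI:
  assumes nz: "x \<noteq> 0" "y \<noteq> 0" "pt x \<noteq> pt y" and U: "\<And>v. v \<in> U \<longleftrightarrow> (\<exists>l m. v = l *s x + m *s y)"
  shows "is_line {p. rep p \<in> U}"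
proof -
  have UB: "U = vec.span {x, y}" unfolding set_eq_iff U span_pair by blast
  have "y \<notin> vec.span {x}"
  proof
    assume "y \<in> vec.span {x}"
    then obtain c where c: "y = c *s x" by (auto simp: vec.span_singleton)
    then have "c \<noteq> 0" using nz by auto
    then show False using c pt_eq_iff[OF nz(1,2)] nz(3) by blast
  qed
  moreover have "x \<noteq> y" using nz(3) by blast
  ultimately have "vec.independent {y, x}" using nz by (simp add: vec.independent_insert)
  then have "vec.dim U = 2"
    unfolding UB using vec.dim_span_eq_card_independent[of "{y, x}"] \<open>x \<noteq> y\<close> by (simp add: insert_commute)
  then show ?thesis unfolding is_line_def UB by (intro exI[of _ "vec.span {x, y}"]) (simp add: vec.subspace_span)
qed

lemma line_two_points:
  assumes "is_line L"
  obtains p q where "p \<in> L" "q \<in> L" "p \<noteq> q"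
proof -
  obtain x y where xy: "x \<noteq> 0" "y \<noteq> 0" "pt x \<noteq> pt y" "L = {p. \<exists>l m. rep p = l *s x + m *s y}"
    using is_lineE[OF assms] .
  obtain c d where "rep (pt x) = c *s x" "rep (pt y) = d *s y" using xy(1,2) by (metis rep_pt)
  then have "rep (pt x) = c *s x + 0 *s y" "rep (pt y) = 0 *s x + d *s y" by simp_all
  then have "pt x \<in> L" "pt y \<in> L" unfolding xy(4) by blast+
  then show ?thesis using xy(3) by (rule that)
qed

text \<open>Any point of the line may serve as origin: with a second point \<open>y\<close> as point
  at infinity, the remaining points have an injective affine parameter.\<close>

lemma line_param:
  assumes L: "is_line L" and p: "p \<in> L"
  obtains y where "y \<noteq> 0" "pt y \<noteq> p" "L = {pt (rep p + z *s y) | z. True} \<union> {pt y}"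
    "\<forall>z. rep p + z *s y \<noteq> 0" "inj (\<lambda>z. pt (rep p + z *s y))"
proof -
  obtain x0 x1 where x: "x0 \<noteq> 0" "x1 \<noteq> 0" "pt x0 \<noteq> pt x1" "L = {p. \<exists>l m. rep p = l *s x0 + m *s x1}"
    using is_lineE[OF L] .
  obtain l m where lm: "rep p = l *s x0 + m *s x1" using p x(4) by blast
  \<comment> \<open>Of the two given generators, one that occurs in \<open>rep p\<close> with
    nonzero coefficient is exchanged for \<open>rep p\<close>.\<close>
  have "\<exists>y. y \<noteq> 0 \<and> pt y \<noteq> p \<and> L = {q. \<exists>l m. rep q = l *s rep p + m *s y}"
  proof (cases "l = 0")
    case True
    then have m: "m \<noteq> 0" "rep p = m *s x1" using lm rep_nonzero[of p] by auto
    then have "p = pt x1" using pt_scale[OF m(1) x(2)] by (metis pt_rep)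
    moreover have "L = {q. \<exists>l m. rep q = l *s rep p + m *s x0}"
    proof -
      have "(\<exists>k n. v = k *s x0 + n *s x1) \<longleftrightarrow> (\<exists>k n. v = k *s rep p + n *s x0)" for v
      proof
        assume "\<exists>k n. v = k *s x0 + n *s x1"
        then obtain k n where "v = k *s x0 + n *s x1" by blast
        then have "v = (n / m) *s rep p + k *s x0" using m by (simp add: add.commute)
        then show "\<exists>k n. v = k *s rep p + n *s x0" by blast
      next
        assume "\<exists>k n. v = k *s rep p + n *s x0"
        then obtain k n where "v = k *s rep p + n *s x0" by blast
        then have "v = n *s x0 + (k * m) *s x1" using m(2) by (simp add: add.commute)
        then show "\<exists>k n. v = k *s x0 + n *s x1" by blast
      qed
      then show ?thesis unfolding x(4) by blast
    qed
    ultimately show ?thesis using x(1,3) by blast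
  next
    case False
    have "pt x1 \<noteq> p"
    proof
      assume "pt x1 = p"
      then obtain c where "rep p = c *s x1" using rep_pt[OF x(2)] by metis
      then have "l *s x0 = (c - m) *s x1" using lm by (simp add: vector_ssub_ldistrib algebra_simps)
      then have e: "x0 = ((c - m) / l) *s x1" using False by (metis nonzero_divide_eq_eq divide_inverse mult.commute
          vector_smult_assoc vector_smult_lid left_inverse)
      then have "(c - m) / l \<noteq> 0" using x(1) by auto
      then have "pt x1 = pt x0" using e pt_eq_iff[OF x(2,1)] by blast
      then show False using x(3) by simp
    qed
    moreover have "L = {q. \<exists>l m. rep q = l *s rep p + m *s x1}"
    proof -
      have "(\<exists>k n. v = k *s x0 + n *s x1) \<longleftrightarrow> (\<exists>k n. v = k *s rep p + n *s x1)" for v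
      proof
        assume "\<exists>k n. v = k *s x0 + n *s x1"
        then obtain k n where "v = k *s x0 + n *s x1" by blast
        then have "v = (k / l) *s rep p + (n - k * m / l) *s x1"
          using False by (simp add: lm vec_eq_iff algebra_simps)
        then show "\<exists>k n. v = k *s rep p + n *s x1" by blast
      next
        assume "\<exists>k n. v = k *s rep p + n *s x1"
        then obtain k n where "v = k *s rep p + n *s x1" by blast
        then have "v = (k * l) *s x0 + (k * m + n) *s x1" by (simp add: lm vec_eq_iff algebra_simps)
        then show "\<exists>k n. v = k *s x0 + n *s x1" by blast
      qed
      then show ?thesis unfolding x(4) by blast
    qed
    ultimately show ?thesis using x(2) by blast
  qed
  then obtain y where y: "y \<noteq> 0" "pt y \<noteq> p" "L = {q. \<exists>l m. rep q = l *s rep p + m *s y}" by blast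
  have nz: "rep p + z *s y \<noteq> 0" for z
  proof
    assume "rep p + z *s y = 0"
    then have e: "rep p = (- z) *s y" by (simp add: add_eq_0_iff)
    then have "- z \<noteq> 0" using rep_nonzero[of p] by (metis vector_smult_lzero)
    then have "pt (rep p) = pt y" unfolding e by (rule pt_scale[OF _ y(1)])
    then show False using y(2) by simp
  qed
  show ?thesis
  proof (rule that[OF y(1,2)])
    show "\<forall>z. rep p + z *s y \<noteq> 0" using nz by blast
    show "L = {pt (rep p + z *s y) | z. True} \<union> {pt y}"
    proof (intro equalityI subsetI)
      fix q assume "q \<in> L"
      then obtain k n where kn: "rep q = k *s rep p + n *s y" using y(3) by blast
      show "q \<in> {pt (rep p + z *s y) | z. True} \<union> {pt y}"
      proof (cases "k = 0")
        case True
        then have "rep q = n *s y" "n \<noteq> 0" using kn rep_nonzero[of q] by auto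
        then have "q = pt y" using pt_scale[of n y] y(1) by (metis pt_rep)
        then show ?thesis by simp
      next
        case False
        then have "rep q = k *s (rep p + (n / k) *s y)" using kn by (simp add: vec_eq_iff algebra_simps)
        then have "q = pt (rep p + (n / k) *s y)" using pt_scale[OF False nz] by (metis pt_rep)
        then show ?thesis by blast
      qed
    next
      fix q assume "q \<in> {pt (rep p + z *s y) | z. True} \<union> {pt y}"
      then show "q \<in> L"
      proof
        assume "q \<in> {pt (rep p + z *s y) | z. True}"
        then obtain z where "q = pt (rep p + z *s y)" by blast
        then obtain c where "rep q = c *s (rep p + z *s y)" using rep_pt[OF nz] by metis
        then have "rep q = c *s rep p + (c * z) *s y" by (simp add: vec_eq_iff algebra_simps)
        then show ?thesis unfolding y(3) by blast
      next
        assume "q \<in> {pt y}"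
        then obtain c where "rep q = c *s y" using rep_pt[OF y(1)] by blast
        then have "rep q = 0 *s rep p + c *s y" by simp
        then show ?thesis unfolding y(3) by blast
      qed
    qed
    show "inj (\<lambda>z. pt (rep p + z *s y))"
    proof (rule injI)
      fix z z' assume "pt (rep p + z *s y) = pt (rep p + z' *s y)"
      then obtain c where c: "rep p + z' *s y = c *s (rep p + z *s y)" using pt_eq_iff[OF nz nz] by blast
      have "(1 - c) *s rep p = (c * z - z') *s y"
      proof -
        have "rep p $ i + z' * y $ i = c * (rep p $ i + z * y $ i)" for i
          using c by (metis vector_add_component vector_smult_component)
        then show ?thesis by (simp add: vec_eq_iff algebra_simps)
      qed
      show "z = z'"
      proof (cases "c = 1")
        case True
        then show ?thesis using \<open>(1 - c) *s rep p = (c * z - z') *s y\<close> y(1) by simp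
      next
        case False
        then have n: "1 - c \<noteq> 0" by simp
        have "pt ((1 - c) *s rep p) = p" using pt_scale[OF n rep_nonzero] by simp
        moreover have "c * z - z' \<noteq> 0" using n \<open>(1 - c) *s rep p = (c * z - z') *s y\<close> rep_nonzero[of p]
          by (metis vector_mul_eq_0 vector_smult_lzero)
        ultimately have "pt y = p" using pt_scale[of "c * z - z'" y] y(1)
          unfolding \<open>(1 - c) *s rep p = (c * z - z') *s y\<close> by simp
        then show ?thesis using y(2) by simp
      qed
    qed
  qed
qed

text \<open>A form vanishing on \<open>Z\<close> but not at a point \<open>p\<close> of the line
  restricts to a nonzero polynomial in the affine parameter at \<open>p\<close>; the point at
  infinity adds at most one intersection.\<close>

lemma finite_line_Int_closed:
  assumes L: "is_line L" and Z: "closedin zariski Z" and nsub: "\<not> L \<subseteq> Z"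
  shows "finite (L \<inter> Z)"
proof -
  obtain p where p: "p \<in> L" "p \<notin> Z" using nsub by blast
  obtain f d where f: "f \<in> forms d" "f (rep p) \<noteq> 0" "\<forall>x\<in>Z. f (rep x) = 0"
    using Z[unfolded closedin_zariski, rule_format, OF p(2)] by (elim exE conjE)
  obtain y where y: "y \<noteq> 0" "pt y \<noteq> p" "L = {pt (rep p + z *s y) | z. True} \<union> {pt y}"
    "\<forall>z. rep p + z *s y \<noteq> 0" "inj (\<lambda>z. pt (rep p + z *s y))"
    using line_param[OF L p(1)] .
  have "f \<in> poly_funs coords" using f(1) by (simp add: forms_def)
  then obtain P where P: "\<And>z. f (rep p + z *s y) = poly P z" using poly_on_line by blast
  have "poly P 0 \<noteq> 0" using f(2) P[of 0] by simp
  then have fin: "finite {z. poly P z = 0}" by (intro poly_roots_finite) auto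
  have "L \<inter> Z \<subseteq> (\<lambda>z. pt (rep p + z *s y)) ` {z. poly P z = 0} \<union> {pt y}"
  proof
    fix q assume q: "q \<in> L \<inter> Z"
    then consider z where "q = pt (rep p + z *s y)" | "q = pt y" using y(3) by blast
    then show "q \<in> (\<lambda>z. pt (rep p + z *s y)) ` {z. poly P z = 0} \<union> {pt y}"
    proof cases
      case (1 z)
      then have "f (rep (pt (rep p + z *s y))) = 0" using q f(3) by blast
      then have "poly P z = 0" using forms_pt[OF f(1) y(4)[rule_format, of z]] by (simp add: P)
      then show ?thesis using 1 by blast
    qed simp
  qed
  then show ?thesis by (rule finite_subset) (simp add: fin)
qed

text \<open>In a chain of three sets the middle one is the trace of a closed set that does not
  contain the line, hence finite; finite irreducible sets are points here, so the smallest set would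
  be empty. Arbitrary subsets are allowed because the image of a surface need not be closed.\<close>

lemma krull_dim_in_line:
  assumes L: "is_line L" and R: "R \<subseteq> L"
  shows "krull_dim (subtopology zariski R) \<le> 1"
proof -
  let ?X = "subtopology zariski R"
  have "krull_dim ?X \<le> enat 1"
  proof (rule krull_dim_le)
    fix Z assume Z: "\<forall>i\<le>Suc 1. irreducible_closed ?X (Z i)" "\<forall>i<Suc 1. Z i \<subset> Z (Suc i)"
    have irr: "irreducible_closed ?X (Z 0)" "irreducible_closed ?X (Z 1)" "irreducible_closed ?X (Z 2)"
      using Z(1) by (simp_all add: numeral_2_eq_2)
    have sub: "Z 0 \<subset> Z 1" "Z 1 \<subset> Z 2" using Z(2)[rule_format, of 0] Z(2)[rule_format, of 1]
      by (simp_all add: numeral_2_eq_2)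
    obtain T where T: "closedin zariski T" "Z 1 = T \<inter> R"
      using irr(2) by (auto simp: irreducible_closed_def closedin_subtopology)
    have "Z 2 \<subseteq> R" using irr(3) by (auto simp: irreducible_closed_def closedin_subtopology)
    then have "\<not> L \<subseteq> T" using sub(2) T(2) R by blast
    from finite_line_Int_closed[OF L T(1) this] have "finite (Z 1)"
      by (rule finite_subset[rotated]) (use T(2) R in blast)
    have sing: "closedin ?X {q}" if "q \<in> R" for q
      using closedin_zariski_sing[of q] that by (auto simp: closedin_subtopology)
    have fin: "closedin ?X S" if "S \<subseteq> Z 1" for S
    proof -
      have "finite S" using \<open>finite (Z 1)\<close> that by (rule finite_subset[rotated])
      moreover have "S = (\<Union>q\<in>S. {q})" by simp
      moreover have "S \<subseteq> R" using that T(2) by blast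
      ultimately show ?thesis using closedin_Union[of "(\<lambda>q. {q}) ` S" ?X] sing by auto
    qed
    obtain q where q: "q \<in> Z 1" using irr(2) by (auto simp: irreducible_closed_def)
    have "Z 1 = {q} \<union> (Z 1 - {q})" using q by blast
    then have "Z 1 = {q} \<or> Z 1 = Z 1 - {q}"
      using irr(2)[unfolded irreducible_closed_def] fin[of "{q}"] fin[of "Z 1 - {q}"] q by blast
    then have "Z 1 = {q}" using q by blast
    then have "Z 0 \<subset> {q}" using sub(1) by simp
    then have "Z 0 = {}" by auto
    moreover have "Z 0 \<noteq> {}" using irr(1) by (simp add: irreducible_closed_def)
    ultimately show False by blast
  qed
  then show ?thesis by (simp add: one_enat_def)
qed

lemma closure_in_line:
  assumes L: "is_line L" "closedin zariski L" and R: "R \<subseteq> L" "infinite R"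
  shows "zariski closure_of R = L"
proof -
  have "zariski closure_of R \<subseteq> L" by (rule closure_of_minimal[OF R(1) L(2)])
  moreover have "L \<subseteq> zariski closure_of R"
  proof (rule ccontr)
    assume "\<not> L \<subseteq> zariski closure_of R"
    from finite_line_Int_closed[OF L(1) closedin_closure_of this]
    have "finite (L \<inter> zariski closure_of R)" .
    moreover have "R \<subseteq> L \<inter> zariski closure_of R" using R(1) closure_of_subset[of R zariski] by simp
    ultimately show False using R(2) finite_subset by blast
  qed
  ultimately show ?thesis by (rule equalityI)
qed

subsection \<open>Linear algebra of pencils\<close>

text \<open>The matrix with the six covectors as rows has trivial kernel, hence a left inverse
  \<open>B\<close>; the row vector \<open>v v* B\<close> consists of the coefficients.\<close>

lemma span_of_pencils:
  fixes a b c :: "2 \<Rightarrow> complex^4"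
  assumes "\<And>x. (\<And>i. dot (a i) x = 0) \<Longrightarrow> (\<And>i. dot (b i) x = 0) \<Longrightarrow> (\<And>i. dot (c i) x = 0) \<Longrightarrow> x = 0"
  shows "\<exists>p q r. v = lc a p + lc b q + lc c r"
proof -
  define M :: "complex^4^(2 + 2 + 2)" where
    "M = (\<chi> i. case i of Inl i \<Rightarrow> a i | Inr j \<Rightarrow> (case j of Inl i \<Rightarrow> b i | Inr i \<Rightarrow> c i))"
  have M: "(M *v x) $ Inl i = dot (a i) x" "(M *v x) $ Inr (Inl i) = dot (b i) x"
    "(M *v x) $ Inr (Inr i) = dot (c i) x" for x i
    by (simp_all add: M_def matrix_vector_mult_def dot_def)
  have "\<forall>x. M *v x = 0 \<longrightarrow> x = 0"
  proof (intro allI impI)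
    fix x assume "M *v x = 0"
    then show "x = 0" using assms[of x] M[of x] by simp
  qed
  then obtain B where B: "B ** M = mat 1" using matrix_left_invertible_ker[of M] by blast
  define k where "k = v v* B"
  have s: "(\<Sum>i\<in>UNIV. f i) = (\<Sum>i\<in>UNIV. f (Inl i)) + (\<Sum>i\<in>UNIV. f (Inr (Inl i))) + (\<Sum>i\<in>UNIV. f (Inr (Inr i)))"
    for f :: "2 + 2 + 2 \<Rightarrow> complex"
    by (simp only: UNIV_Plus_UNIV[symmetric] sum.Plus finite o_def add.assoc)
  have "v = k v* M" unfolding k_def vector_matrix_mul_assoc B by simp
  then have "v $ m = (\<Sum>i\<in>UNIV. k $ i * M $ i $ m)" for m
    by (metis (no_types, lifting) vector_matrix_mult_def vec_lambda_beta sum.cong mult.commute)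
  then have "v $ m = (lc a (\<chi> i. k $ Inl i) + lc b (\<chi> i. k $ Inr (Inl i)) + lc c (\<chi> i. k $ Inr (Inr i))) $ m" for m
    unfolding s by (simp add: M_def lc_def sum_type_2)
  then have "v = lc a (\<chi> i. k $ Inl i) + lc b (\<chi> i. k $ Inr (Inl i)) + lc c (\<chi> i. k $ Inr (Inr i))"
    unfolding vec_eq_iff by blast
  then show ?thesis by blast
qed

lemma span_of_two_pencils:
  fixes a b :: "2 \<Rightarrow> complex^4"
  assumes "\<And>x. (\<And>i. dot (a i) x = 0) \<Longrightarrow> (\<And>i. dot (b i) x = 0) \<Longrightarrow> x = 0"
  shows "\<exists>p q. v = lc a p + lc b q"
proof -
  \<comment> \<open>The first pencil is used again as the third, and its two contributions are
    added.\<close>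
  obtain p q r where "v = lc a p + lc b q + lc a r" using span_of_pencils[of a b a v] assms by blast
  then have "v = lc a (p + r) + lc b q" by (simp add: lc_add algebra_simps)
  then show ?thesis by blast
qed

lemma dual_vector:
  fixes a b :: "2 \<Rightarrow> complex^4"
  assumes "\<And>x. (\<And>i. dot (a i) x = 0) \<Longrightarrow> (\<And>i. dot (b i) x = 0) \<Longrightarrow> x = 0"
  shows "\<exists>x. (\<forall>i. dot (a i) x = y $ i) \<and> (\<forall>i. dot (b i) x = z $ i)"
proof -
  define M :: "complex^4^4" where
    "M = (\<chi> i. if i = 0 then a 0 else if i = 1 then a 1 else if i = 2 then b 0 else b 1)"
  have M: "(M *v x) $ 0 = dot (a 0) x" "(M *v x) $ 1 = dot (a 1) x" "(M *v x) $ 2 = dot (b 0) x"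
    "(M *v x) $ 3 = dot (b 1) x" for x
    by (simp_all add: M_def matrix_vector_mult_def dot_def)
  have "\<forall>x. M *v x = 0 \<longrightarrow> x = 0"
  proof (intro allI impI)
    fix x assume "M *v x = 0"
    then have "\<forall>i. dot (a i) x = 0" "\<forall>i. dot (b i) x = 0" unfolding all_type_2 using M[of x] by simp_all
    then show "x = 0" using assms by blast
  qed
  then obtain B where "B ** M = mat 1" using matrix_left_invertible_ker[of M] by blast
  then have B: "M ** B = mat 1" using matrix_left_right_inverse[of M B] by blast
  define v :: "complex^4" where "v = (\<chi> i. if i = 0 then y $ 0 else if i = 1 then y $ 1 else if i = 2 then z $ 0 else z $ 1)"
  have "M *v (B *v v) = v" by (simp add: matrix_vector_mul_assoc B)
  then have "(\<forall>i. dot (a i) (B *v v) = y $ i) \<and> (\<forall>i. dot (b i) (B *v v) = z $ i)"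
    unfolding all_type_2 M[of "B *v v", symmetric] by (simp add: v_def)
  then show ?thesis by blast
qed

subsection \<open>Ideals\<close>

lemma ideal_gen3_zero: "(\<lambda>_. 0) \<in> ideal_gen3 F"
  unfolding ideal_gen3_def by (intro CollectI exI[of _ "{}"]) auto

lemma ideal_gen3_base:
  assumes "g \<in> F"
  shows "g \<in> ideal_gen3 F"
  unfolding ideal_gen3_def
  by (intro CollectI exI[of _ "{g}"] exI[of _ "\<lambda>_ _. 1"]) (use assms in \<open>auto intro: poly_funs.const\<close>)

lemma ideal_gen3_add:
  assumes "f \<in> ideal_gen3 F" "h \<in> ideal_gen3 F"
  shows "(\<lambda>x. f x + h x) \<in> ideal_gen3 F"
proof -
  obtain G c where G: "finite G" "G \<subseteq> F" "\<forall>g\<in>G. c g \<in> poly_funs coords3" "f = (\<lambda>x. \<Sum>g\<in>G. c g x * g x)"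
    using assms(1) unfolding ideal_gen3_def by blast
  obtain H d where H: "finite H" "H \<subseteq> F" "\<forall>g\<in>H. d g \<in> poly_funs coords3" "h = (\<lambda>x. \<Sum>g\<in>H. d g x * g x)"
    using assms(2) unfolding ideal_gen3_def by blast
  define e where "e g x = (if g \<in> G then c g x else 0) + (if g \<in> H then d g x else 0)" for g x
  have "e g \<in> poly_funs coords3" for g
  proof -
    have "(\<lambda>x. if g \<in> G then c g x else 0) \<in> poly_funs coords3"
      using G(3) by (cases "g \<in> G") (simp_all add: poly_funs.const)
    moreover have "(\<lambda>x. if g \<in> H then d g x else 0) \<in> poly_funs coords3"
      using H(3) by (cases "g \<in> H") (simp_all add: poly_funs.const)
    ultimately show ?thesis unfolding e_def by (rule poly_funs.add)
  qed
  moreover have "f x + h x = (\<Sum>g\<in>G \<union> H. e g x * g x)" for x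
  proof -
    have "f x = (\<Sum>g\<in>G \<union> H. (if g \<in> G then c g x else 0) * g x)"
      unfolding G(4) using G(1) H(1) by (intro sum.mono_neutral_cong_left) auto
    moreover have "h x = (\<Sum>g\<in>G \<union> H. (if g \<in> H then d g x else 0) * g x)"
      unfolding H(4) using G(1) H(1) by (intro sum.mono_neutral_cong_left) auto
    ultimately show ?thesis by (simp only: e_def distrib_right sum.distrib)
  qed
  ultimately show ?thesis
    unfolding ideal_gen3_def using G(1,2) H(1,2)
    by (intro CollectI exI[of _ "G \<union> H"] exI[of _ e]) auto
qed

lemma ideal_gen3_mult:
  assumes "p \<in> poly_funs coords3" "f \<in> ideal_gen3 F"
  shows "(\<lambda>x. p x * f x) \<in> ideal_gen3 F"
proof -
  obtain G c where G: "finite G" "G \<subseteq> F" "\<forall>g\<in>G. c g \<in> poly_funs coords3" "f = (\<lambda>x. \<Sum>g\<in>G. c g x * g x)"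
    using assms(2) unfolding ideal_gen3_def by blast
  have "(\<lambda>x. p x * f x) = (\<lambda>x. \<Sum>g\<in>G. (p x * c g x) * g x)"
    unfolding G(4) by (simp add: sum_distrib_left mult.assoc)
  moreover have "\<forall>g\<in>G. (\<lambda>x. p x * c g x) \<in> poly_funs coords3" using G(3) assms(1) by (blast intro: poly_funs.mult)
  ultimately show ?thesis
    unfolding ideal_gen3_def using G(1,2)
    by (intro CollectI exI[of _ G] exI[of _ "\<lambda>g x. p x * c g x"]) simp
qed

lemma ideal_gen3_sum:
  assumes "\<And>i. i \<in> I \<Longrightarrow> f i \<in> ideal_gen3 F"
  shows "(\<lambda>x. \<Sum>i\<in>I. f i x) \<in> ideal_gen3 F"
  using assms
proof (induction I rule: infinite_finite_induct)
  case (insert i I)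
  have "(\<lambda>x. f i x + (\<Sum>i\<in>I. f i x)) \<in> ideal_gen3 F"
    by (rule ideal_gen3_add) (use insert in auto)
  then show ?case using insert.hyps by simp
qed (simp_all add: ideal_gen3_zero)

lemma ideal_gen3_mult_into:
  assumes h: "h \<in> ideal_gen3 G" and G: "\<And>g. g \<in> G \<Longrightarrow> (\<lambda>x. p x * g x) \<in> ideal_gen3 F"
  shows "(\<lambda>x. p x * h x) \<in> ideal_gen3 F"
proof -
  obtain H c where H: "finite H" "H \<subseteq> G" "\<forall>g\<in>H. c g \<in> poly_funs coords3" "h = (\<lambda>x. \<Sum>g\<in>H. c g x * g x)"
    using h unfolding ideal_gen3_def by blast
  have "(\<lambda>x. \<Sum>g\<in>H. c g x * (p x * g x)) \<in> ideal_gen3 F"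
    by (intro ideal_gen3_sum ideal_gen3_mult G) (use H in auto)
  moreover have "(\<lambda>x. \<Sum>g\<in>H. c g x * (p x * g x)) = (\<lambda>x. p x * h x)"
    unfolding H(4) by (simp add: sum_distrib_left mult.left_commute)
  ultimately show ?thesis by simp
qed

text \<open>It is enough that the generators in \<open>G\<close> enter the ideal of \<open>F\<close>
  after multiplication by each irrelevant generator: the saturation exponent then grows by
  one.\<close>

lemma same_subscheme3I:
  assumes F: "\<And>f. f \<in> F \<Longrightarrow> f \<in> ideal_gen3 G"
    and G: "\<And>g i j k. g \<in> G \<Longrightarrow> (\<lambda>x. (case x of (s, t, u) \<Rightarrow> s $ i * t $ j * u $ k) * g x) \<in> ideal_gen3 F"
  shows "same_subscheme3 F G"
proof -
  have e: "(\<lambda>(s, t, u). (s $ i * t $ j * u $ k) ^ n * h (s, t, u)) =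
      (\<lambda>x. (case x of (s, t, u) \<Rightarrow> s $ i * t $ j * u $ k) ^ n * h x)" for i j k n and h :: "vec_3 \<Rightarrow> complex"
    by (intro ext) (simp add: case_prod_unfold)
  have FG: "h \<in> ideal_gen3 G" if "h \<in> ideal_gen3 F" for h
    using ideal_gen3_mult_into[of h F "\<lambda>_. 1" G] that F by simp
  have "saturation3 (ideal_gen3 F) \<subseteq> saturation3 (ideal_gen3 G)"
    unfolding saturation3_def e using FG by blast
  moreover have "saturation3 (ideal_gen3 G) \<subseteq> saturation3 (ideal_gen3 F)"
  proof
    fix h assume "h \<in> saturation3 (ideal_gen3 G)"
    then obtain n where h: "h \<in> poly_funs coords3"
      "\<And>i j k. (\<lambda>x. (case x of (s, t, u) \<Rightarrow> s $ i * t $ j * u $ k) ^ n * h x) \<in> ideal_gen3 G"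
      unfolding saturation3_def e by blast
    have "(\<lambda>x. (case x of (s, t, u) \<Rightarrow> s $ i * t $ j * u $ k) ^ Suc n * h x) \<in> ideal_gen3 F" for i j k
      using ideal_gen3_mult_into[OF h(2)[of i j k] G] by (simp add: mult.assoc)
    then show "h \<in> saturation3 (ideal_gen3 F)"
      unfolding saturation3_def e using h(1) by blast
  qed
  ultimately show ?thesis unfolding same_subscheme3_def by (rule equalityI)
qed

lemma type_2_cases: "(i :: 2) = 0 \<or> i = 1"
  using UNIV_type_2 by blast

context pencils
begin

text \<open>Expanding a unit covector in the six covectors writes each coordinate of the meet in
  terms of the axis forms. Conversely, pairing the meet with a covector of a pencil gives a
  coordinate of the parameter times an axis form, so the axis forms are recovered up to saturation.
  The constants absorb the normalisation of the generators.\<close>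

lemma same_subscheme3_base_curve:
  assumes k: "k1 \<noteq> 0" "k2 \<noteq> 0" "k3 \<noteq> 0"
  shows "same_subscheme3 (range (\<lambda>m v. meet a b c v $ m))
    {\<lambda>(s, t, u). k1 * axis_form a b c t u, \<lambda>(s, t, u). k2 * axis_form b c a u s,
     \<lambda>(s, t, u). k3 * axis_form c a b s t}"
    (is "same_subscheme3 ?F {?A, ?B, ?C}")
proof (rule same_subscheme3I)
  have d: "dot (a 0) (meet a b c (s, t, u)) = - (s $ 1) * axis_form a b c t u"
    "dot (a 1) (meet a b c (s, t, u)) = s $ 0 * axis_form a b c t u"
    "dot (b 0) (meet a b c (s, t, u)) = - (t $ 1) * axis_form b c a u s"
    "dot (b 1) (meet a b c (s, t, u)) = t $ 0 * axis_form b c a u s"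
    "dot (c 0) (meet a b c (s, t, u)) = - (u $ 1) * axis_form c a b s t"
    "dot (c 1) (meet a b c (s, t, u)) = u $ 0 * axis_form c a b s t" for s t u
    using dot_meet[of a b c s t u] dot_meet[of b c a t u s] dot_meet[of c a b u s t]
    by (simp_all add: meet_rotate[of b c a] meet_rotate[of c a b])
  fix f assume "f \<in> ?F"
  then obtain m where m: "f = (\<lambda>v. meet a b c v $ m)" by blast
  obtain p q r where pqr: "axis m 1 = lc a p + lc b q + lc c r"
    using span_of_pencils[of a b c "axis m 1"] no_common by blast
  have c: "(x / k * y - z / k * w) * (k * g) = (x * y - z * w) * g" if "k \<noteq> 0" for k x y z w g :: complex
    using that by (simp add: field_simps)
  have "meet a b c (s, t, u) $ m =
      ((p $ 1 / k1) * s $ 0 - (p $ 0 / k1) * s $ 1) * (k1 * axis_form a b c t u) +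
      ((q $ 1 / k2) * t $ 0 - (q $ 0 / k2) * t $ 1) * (k2 * axis_form b c a u s) +
      ((r $ 1 / k3) * u $ 0 - (r $ 0 / k3) * u $ 1) * (k3 * axis_form c a b s t)" for s t u
  proof -
    have "meet a b c (s, t, u) $ m = dot (axis m 1) (meet a b c (s, t, u))"
      by (simp add: dot_def axis_def if_distrib[of "\<lambda>x. x * _"] cong: if_cong)
    also have "\<dots> = (p $ 1 * s $ 0 - p $ 0 * s $ 1) * axis_form a b c t u
        + (q $ 1 * t $ 0 - q $ 0 * t $ 1) * axis_form b c a u s
        + (r $ 1 * u $ 0 - r $ 0 * u $ 1) * axis_form c a b s t"
      unfolding pqr lc_def dot_add dot_scale d by (simp add: algebra_simps)
    finally show ?thesis unfolding c[OF k(1)] c[OF k(2)] c[OF k(3)] .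
  qed
  then have f: "f = (\<lambda>x. (\<lambda>(s, t, u). (p $ 1 / k1) * s $ 0 - (p $ 0 / k1) * s $ 1) x * ?A x +
      (\<lambda>(s, t, u). (q $ 1 / k2) * t $ 0 - (q $ 0 / k2) * t $ 1) x * ?B x +
      (\<lambda>(s, t, u). (r $ 1 / k3) * u $ 0 - (r $ 0 / k3) * u $ 1) x * ?C x)"
    unfolding m by (intro ext, clarify) (simp only: prod.case)
  show "f \<in> ideal_gen3 {?A, ?B, ?C}"
    unfolding f
    by (intro ideal_gen3_add ideal_gen3_mult ideal_gen3_base linear_forms3[THEN forms3_poly]) simp_all
next
  have d: "dot (a 0) (meet a b c (s, t, u)) = - (s $ 1) * axis_form a b c t u"
    "dot (a 1) (meet a b c (s, t, u)) = s $ 0 * axis_form a b c t u"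
    "dot (b 0) (meet a b c (s, t, u)) = - (t $ 1) * axis_form b c a u s"
    "dot (b 1) (meet a b c (s, t, u)) = t $ 0 * axis_form b c a u s"
    "dot (c 0) (meet a b c (s, t, u)) = - (u $ 1) * axis_form c a b s t"
    "dot (c 1) (meet a b c (s, t, u)) = u $ 0 * axis_form c a b s t" for s t u
    using dot_meet[of a b c s t u] dot_meet[of b c a t u s] dot_meet[of c a b u s t]
    by (simp_all add: meet_rotate[of b c a] meet_rotate[of c a b])
  have dot_in: "(\<lambda>x. P x * dot d (meet a b c x)) \<in> ideal_gen3 ?F" if "P \<in> poly_funs coords3" for d P
    unfolding dot_def
    by (intro ideal_gen3_mult[OF that] ideal_gen3_sum ideal_gen3_mult poly_funs.const ideal_gen3_base) blast
  note co = coord_forms3[THEN forms3_poly]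
  have into: "(\<lambda>x. (case x of (s, t, u) \<Rightarrow> s $ i * t $ j * u $ k) * h x) \<in> ideal_gen3 ?F"
    if P: "P \<in> poly_funs coords3"
      "\<And>s t u. P (s, t, u) * dot d (meet a b c (s, t, u)) = s $ i * t $ j * u $ k * h (s, t, u)" for P d h i j k
  proof -
    have "(\<lambda>x. P x * dot d (meet a b c x)) = (\<lambda>x. (case x of (s, t, u) \<Rightarrow> s $ i * t $ j * u $ k) * h x)"
    proof
      fix x :: vec_3
      obtain s t u where x: "x = (s, t, u)" by (cases x) auto
      show "P x * dot d (meet a b c x) = (case x of (s, t, u) \<Rightarrow> s $ i * t $ j * u $ k) * h x"
        unfolding x prod.case by (rule P(2))
    qed
    then show ?thesis using dot_in[OF P(1), of d] by simp
  qed
  fix g i j k assume g: "g \<in> {?A, ?B, ?C}"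
  have A: "(\<lambda>x. (case x of (s, t, u) \<Rightarrow> s $ i * t $ j * u $ k) * ?A x) \<in> ideal_gen3 ?F" for i j k
  proof -
    \<comment> \<open>The covector that produces \<open>s $ i\<close> has the opposite index;
      \<open>l\<close> is the sign, negative for \<open>i = 1\<close>.\<close>
    obtain d l where e: "\<And>s t u. l * dot d (meet a b c (s, t, u)) = s $ i * axis_form a b c t u"
    proof (cases "i = 0")
      case True
      then show ?thesis by (intro that[of 1 "a 1"]) (simp add: d)
    next
      case False
      then have "i = 1" using type_2_cases by blast
      then show ?thesis by (intro that[of "- 1" "a 0"]) (simp add: d)
    qed
    show ?thesis
    proof (rule into[where P = "\<lambda>x. (\<lambda>(s, t, u). t $ j) x * (\<lambda>(s, t, u). u $ k) x * (k1 * l)" and d = d])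
      show "(\<lambda>x. (\<lambda>(s, t, u). t $ j) x * (\<lambda>(s, t, u). u $ k) x * (k1 * l)) \<in> poly_funs coords3"
        by (intro poly_funs.mult co poly_funs.const)
      fix s t u :: "complex^2"
      have "(t $ j * u $ k * (k1 * l)) * dot d (meet a b c (s, t, u)) = t $ j * u $ k * k1 * (l * dot d (meet a b c (s, t, u)))"
        by (simp only: mult_ac)
      also have "\<dots> = s $ i * t $ j * u $ k * (k1 * axis_form a b c t u)" by (simp only: e mult_ac)
      finally show "(\<lambda>(s, t, u). t $ j) (s, t, u) * (\<lambda>(s, t, u). u $ k) (s, t, u) * (k1 * l) * dot d (meet a b c (s, t, u)) =
          s $ i * t $ j * u $ k * ?A (s, t, u)" by (simp only: prod.case)
    qed
  qed
  have B: "(\<lambda>x. (case x of (s, t, u) \<Rightarrow> s $ i * t $ j * u $ k) * ?B x) \<in> ideal_gen3 ?F" for i j k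
  proof -
    obtain d l where e: "\<And>s t u. l * dot d (meet a b c (s, t, u)) = t $ j * axis_form b c a u s"
    proof (cases "j = 0")
      case True
      then show ?thesis by (intro that[of 1 "b 1"]) (simp add: d)
    next
      case False
      then have "j = 1" using type_2_cases by blast
      then show ?thesis by (intro that[of "- 1" "b 0"]) (simp add: d)
    qed
    show ?thesis
    proof (rule into[where P = "\<lambda>x. (\<lambda>(s, t, u). s $ i) x * (\<lambda>(s, t, u). u $ k) x * (k2 * l)" and d = d])
      show "(\<lambda>x. (\<lambda>(s, t, u). s $ i) x * (\<lambda>(s, t, u). u $ k) x * (k2 * l)) \<in> poly_funs coords3"
        by (intro poly_funs.mult co poly_funs.const)
      fix s t u :: "complex^2"
      have "(s $ i * u $ k * (k2 * l)) * dot d (meet a b c (s, t, u)) = s $ i * u $ k * k2 * (l * dot d (meet a b c (s, t, u)))"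
        by (simp only: mult_ac)
      also have "\<dots> = s $ i * t $ j * u $ k * (k2 * axis_form b c a u s)" by (simp only: e mult_ac)
      finally show "(\<lambda>(s, t, u). s $ i) (s, t, u) * (\<lambda>(s, t, u). u $ k) (s, t, u) * (k2 * l) * dot d (meet a b c (s, t, u)) =
          s $ i * t $ j * u $ k * ?B (s, t, u)" by (simp only: prod.case)
    qed
  qed
  have C: "(\<lambda>x. (case x of (s, t, u) \<Rightarrow> s $ i * t $ j * u $ k) * ?C x) \<in> ideal_gen3 ?F" for i j k
  proof -
    obtain d l where e: "\<And>s t u. l * dot d (meet a b c (s, t, u)) = u $ k * axis_form c a b s t"
    proof (cases "k = 0")
      case True
      then show ?thesis by (intro that[of 1 "c 1"]) (simp add: d)
    next
      case False
      then have "k = 1" using type_2_cases by blast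
      then show ?thesis by (intro that[of "- 1" "c 0"]) (simp add: d)
    qed
    show ?thesis
    proof (rule into[where P = "\<lambda>x. (\<lambda>(s, t, u). s $ i) x * (\<lambda>(s, t, u). t $ j) x * (k3 * l)" and d = d])
      show "(\<lambda>x. (\<lambda>(s, t, u). s $ i) x * (\<lambda>(s, t, u). t $ j) x * (k3 * l)) \<in> poly_funs coords3"
        by (intro poly_funs.mult co poly_funs.const)
      fix s t u :: "complex^2"
      have "(s $ i * t $ j * (k3 * l)) * dot d (meet a b c (s, t, u)) = s $ i * t $ j * k3 * (l * dot d (meet a b c (s, t, u)))"
        by (simp only: mult_ac)
      also have "\<dots> = s $ i * t $ j * u $ k * (k3 * axis_form c a b s t)" by (simp only: e mult_ac)
      finally show "(\<lambda>(s, t, u). s $ i) (s, t, u) * (\<lambda>(s, t, u). t $ j) (s, t, u) * (k3 * l) * dot d (meet a b c (s, t, u)) =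
          s $ i * t $ j * u $ k * ?C (s, t, u)" by (simp only: prod.case)
    qed
  qed
  show "(\<lambda>x. (case x of (s, t, u) \<Rightarrow> s $ i * t $ j * u $ k) * g x) \<in> ideal_gen3 ?F"
    using g A B C by blast
qed

end

subsection \<open>The axes\<close>

lemma dot_minus: "dot d (- x) = - dot d x"
  by (simp add: dot_eq)

lemma wedge_swap: "wedge a c b = - wedge a b c"
  by (simp add: vec4_eq_iff minor3_def minor2_def algebra_simps)

definition axis_line :: "(2 \<Rightarrow> complex^4) \<Rightarrow> P3 set" where
  "axis_line a = {p. dot (a 0) (rep p) = 0 \<and> dot (a 1) (rep p) = 0}"

lemma dot_forms: "dot d \<in> forms 1"
proof -
  have "(\<lambda>x. \<Sum>m\<in>UNIV. d $ m * x $ m) \<in> poly_funs coords"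
    by (intro poly_funs_sum poly_funs.mult poly_funs.const poly_funs_coord)
  moreover have "dot d = (\<lambda>x. \<Sum>m\<in>UNIV. d $ m * x $ m)" by (rule ext) (simp add: dot_def)
  ultimately have "dot d \<in> poly_funs coords" by simp
  then show ?thesis by (simp add: forms_def dot_scale)
qed

lemma closedin_axis_line: "closedin zariski (axis_line a)"
proof -
  have "axis_line a = zeros (dot (a 0)) \<inter> zeros (dot (a 1))" by (auto simp: axis_line_def zeros_def)
  then show ?thesis using closedin_zeros[OF dot_forms] by (simp add: closedin_Int)
qed

text \<open>The points \<open>x\<close> and \<open>y\<close> are where the axis meets the planes
  \<open>lc b t\<close> and \<open>lc c u\<close>. The nonzero determinant keeps them apart, so they
  span the axis.\<close>

lemma is_line_axis_line:
  assumes "axis_form a b c t u \<noteq> 0"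
  shows "is_line (axis_line a)"
proof -
  define d where "d = axis_form a b c t u"
  define x where "x = wedge (a 0) (a 1) (lc b t)"
  define y where "y = wedge (a 0) (a 1) (lc c u)"
  have d0: "d \<noteq> 0" using assms by (simp add: d_def)
  have dd: "dot (a 1) (wedge (a 0) (lc b t) (lc c u)) = d" by (simp add: d_def axis_form_def)
  have xy: "dot (a 0) x = 0" "dot (a 1) x = 0" "dot (lc b t) x = 0" "dot (lc c u) x = d"
    "dot (a 0) y = 0" "dot (a 1) y = 0" "dot (lc c u) y = 0" "dot (lc b t) y = - d"
    using dot_wedge_swap(2)[of "lc c u" "a 0" "a 1" "lc b t"] dot_wedge_swap(2)[of "lc b t" "a 0" "a 1" "lc c u"] dd
    unfolding x_def y_def by (simp_all add: dot_wedge_self wedge_swap[of "a 0" "lc c u" "lc b t"] dot_minus)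
  have "is_line {p. rep p \<in> {v. dot (a 0) v = 0 \<and> dot (a 1) v = 0}}"
  proof (rule is_lineI[of x y])
    show "x \<noteq> 0" "y \<noteq> 0" using xy(4,8) d0 by auto
    then show "pt x \<noteq> pt y"
      using pt_eq_iff[of x y] xy(3,8) d0 by (auto simp: dot_scale)
    fix v
    show "v \<in> {v. dot (a 0) v = 0 \<and> dot (a 1) v = 0} \<longleftrightarrow> (\<exists>l m. v = l *s x + m *s y)"
    proof
      assume v: "v \<in> {v. dot (a 0) v = 0 \<and> dot (a 1) v = 0}"
      \<comment> \<open>The covectors \<open>lc c u\<close> and \<open>lc b t\<close> read off the
        coefficients of \<open>x\<close> and \<open>y\<close>; what remains is annihilated by four
        independent covectors.\<close>
      let ?v = "v - ((dot (lc c u) v / d) *s x + (- dot (lc b t) v / d) *s y)"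
      have "?v = 0"
      proof (rule dual_zero)
        show "dot (a 1) (wedge (a 0) (lc b t) (lc c u)) \<noteq> 0" using dd d0 by simp
      qed (use v xy d0 in \<open>simp_all only: dot_diff dot_add dot_scale mem_Collect_eq\<close>, simp_all)
      then show "\<exists>l m. v = l *s x + m *s y" by (metis eq_iff_diff_eq_0)
    next
      assume "\<exists>l m. v = l *s x + m *s y"
      then obtain l m where v: "v = l *s x + m *s y" by blast
      show "v \<in> {v. dot (a 0) v = 0 \<and> dot (a 1) v = 0}"
        unfolding v mem_Collect_eq dot_add dot_scale xy by simp
    qed
  qed
  then show ?thesis by (simp add: axis_line_def)
qed

lemma in_axis_line:
  assumes "x \<noteq> 0"
  shows "pt x \<in> axis_line a \<longleftrightarrow> dot (a 0) x = 0 \<and> dot (a 1) x = 0"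
proof -
  obtain k where "k \<noteq> 0" "rep (pt x) = k *s x" using rep_pt[OF assms] .
  then show ?thesis by (simp add: axis_line_def dot_scale)
qed

lemma param_scale: "param a (k *s x) = k *s param a x"
  by (simp add: param_def vec2_eq_iff dot_scale)

lemma param_eq_0: "param a x = 0 \<longleftrightarrow> dot (a 0) x = 0 \<and> dot (a 1) x = 0"
  by (auto simp: param_def vec2_eq_iff)

lemma axis_form_scale: "axis_form a b c (l *s t) (m *s u) = l * m * axis_form a b c t u"
  by (simp add: axis_form_def lc_scale wedge_scale dot_scale)

lemma meet_scale: "meet a b c (l *s s, m *s t, n *s u) = (l * m * n) *s meet a b c (s, t, u)"
  by (simp add: meet_def lc_scale wedge_scale mult_ac)

subsection \<open>The birational inverse\<close>

text \<open>The sign is the one in \<open>meet_param\<close>, so that the composite with the inverse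
  is multiplication by \<open>quad\<close> itself.\<close>

definition quad :: "(2 \<Rightarrow> complex^4) \<Rightarrow> (2 \<Rightarrow> complex^4) \<Rightarrow> (2 \<Rightarrow> complex^4) \<Rightarrow> complex^4 \<Rightarrow> complex" where
  "quad a b c x = - axis_form a b c (param b x) (param c x)"

lemma meet_param_quad: "meet a b c (param a x, param b x, param c x) = quad a b c x *s x"
  unfolding meet_param quad_def ..

text \<open>The definition singles out the pencil \<open>a\<close>, but the value is the factor of a
  composite that is invariant under rotation, and a nonzero \<open>x\<close> determines that
  factor.\<close>

lemma quad_rotate: "quad b c a x = quad a b c x"
proof (cases "x = 0")
  case True
  then show ?thesis by (simp add: quad_def param_def axis_form_def lc_def)
next
  case False
  have "quad b c a x *s x = meet b c a (param b x, param c x, param a x)" by (rule meet_param_quad[symmetric])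
  also have "\<dots> = meet a b c (param a x, param b x, param c x)" by (rule meet_rotate)
  also have "\<dots> = quad a b c x *s x" by (rule meet_param_quad)
  finally have "quad b c a x *s x = quad a b c x *s x" .
  then show ?thesis using False by simp
qed

lemma quad_scale: "quad a b c (k *s x) = k ^ 2 * quad a b c x"
  by (simp add: quad_def param_scale axis_form_scale power2_eq_square)

lemma param_poly_funs: "(\<lambda>x. param a x $ i) \<in> poly_funs coords"
proof -
  have d: "dot v \<in> poly_funs coords" for v using dot_forms[of v] by (simp add: forms_def)
  have "(\<lambda>x. - dot (a 1) x) \<in> poly_funs coords"
    using poly_funs_diff[OF poly_funs.const[of 0] d[of "a 1"]] by simp
  with d[of "a 0"] show ?thesis using type_2_cases[of i] by (elim disjE) (simp_all add: param_def)
qed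

lemma quad_forms: "quad a b c \<in> forms 2"
proof -
  have "quad a b c = (\<lambda>x. \<Sum>j\<in>UNIV. \<Sum>k\<in>UNIV. (- dot (a 1) (wedge (a 0) (b j) (c k))) * param b x $ j * param c x $ k)"
    by (intro ext) (simp add: quad_def axis_form_bilinear sum_negf)
  also have "\<dots> \<in> poly_funs coords"
    by (intro poly_funs_sum poly_funs.mult poly_funs.const param_poly_funs)
  finally show ?thesis by (simp add: forms_def quad_scale)
qed

lemma rep3_pt3:
  assumes "nz3 (s, t, u)"
  obtains l m n where "l \<noteq> 0" "m \<noteq> 0" "n \<noteq> 0" "rep3 (pt3 (s, t, u)) = (l *s s, m *s t, n *s u)"
proof -
  obtain l where "l \<noteq> 0" "rep (pt s) = l *s s" using rep_pt[of s] assms by auto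
  moreover obtain m where "m \<noteq> 0" "rep (pt t) = m *s t" using rep_pt[of t] assms by auto
  moreover obtain n where "n \<noteq> 0" "rep (pt u) = n *s u" using rep_pt[of u] assms by auto
  ultimately show ?thesis using that by simp
qed

lemma rmap_meet_pt3:
  assumes "nz3 (s, t, u)" "meet a b c (s, t, u) \<noteq> 0"
  shows "rmap (meet a b c) (pt3 (s, t, u)) = pt (meet a b c (s, t, u))"
    and "pt3 (s, t, u) \<notin> base_locus (meet a b c)"
proof -
  obtain l m n where lmn: "l \<noteq> 0" "m \<noteq> 0" "n \<noteq> 0" "rep3 (pt3 (s, t, u)) = (l *s s, m *s t, n *s u)"
    using rep3_pt3[OF assms(1)] .
  show "rmap (meet a b c) (pt3 (s, t, u)) = pt (meet a b c (s, t, u))"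
    unfolding rmap_def lmn(4) meet_scale by (rule pt_scale) (use lmn assms(2) in auto)
  show "pt3 (s, t, u) \<notin> base_locus (meet a b c)"
    unfolding base_locus_def mem_Collect_eq lmn(4) meet_scale using lmn(1-3) assms(2) by simp
qed

context pencils
begin

text \<open>The product of the three projective lines is irreducible, so three forms that are not
  identically zero have a common point of nonvanishing.\<close>

lemma axis_form_product_nonzero:
  "\<exists>p q r. axis_form a b c (rep q) (rep r) \<noteq> 0 \<and> axis_form b c a (rep r) (rep p) \<noteq> 0 \<and>
    axis_form c a b (rep p) (rep q) \<noteq> 0"
proof -
  define f where "f = (\<lambda>(s :: complex^2, t :: complex^2, u :: complex^2). axis_form a b c t u)"
  define g where "g = (\<lambda>(s :: complex^2, t :: complex^2, u :: complex^2). axis_form b c a u s)"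
  define h where "h = (\<lambda>(s :: complex^2, t :: complex^2, u :: complex^2). axis_form c a b s t)"
  have f: "f \<in> forms3 0 1 1" unfolding f_def axis_form_bil by (rule bil_forms3)
  have g: "g \<in> forms3 1 0 1"
  proof -
    have "g = (\<lambda>(s, t, u). bil (\<lambda>j k. dot (b 1) (wedge (b 0) (c k) (a j))) s u)"
      unfolding g_def axis_form_bil by (intro ext, clarify) (rule bil_swap)
    then show ?thesis using bil_forms3(2) by simp
  qed
  have h: "h \<in> forms3 1 1 0" unfolding h_def axis_form_bil by (rule bil_forms3)
  have nz: "\<exists>p. F (rep3 p) \<noteq> 0" if "F \<in> forms3 i j k" "F v \<noteq> 0" for F i j k v
    using forms3_vanish_chart[OF that(1)] that
    by (metis (no_types) chart_def forms3_pt3 hpair_nth(1) nz3.simps zero_index zero_neq_one)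
  have "\<exists>p. f (rep3 p) \<noteq> 0" "\<exists>p. g (rep3 p) \<noteq> 0" "\<exists>p. h (rep3 p) \<noteq> 0"
    using axis_a axis_b axis_c nz[OF f] nz[OF g] nz[OF h] by (auto simp: f_def g_def h_def)
  have "\<exists>p. (f (rep3 p) * g (rep3 p)) * h (rep3 p) \<noteq> 0"
  proof (rule ccontr)
    assume "\<nexists>p. (f (rep3 p) * g (rep3 p)) * h (rep3 p) \<noteq> 0"
    then have "f (rep3 p) * g (rep3 p) * h (rep3 p) = 0" for p by blast
    from irreducible_forms3_mult[OF irreducible_closed_UNIV forms3_mult[OF f g] h this]
    have "f (rep3 p) * g (rep3 p) = 0" for p using \<open>\<exists>p. h (rep3 p) \<noteq> 0\<close> by blast
    from irreducible_forms3_mult[OF irreducible_closed_UNIV f g this]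
    show False using \<open>\<exists>p. f (rep3 p) \<noteq> 0\<close> \<open>\<exists>p. g (rep3 p) \<noteq> 0\<close> by blast
  qed
  then obtain p q r where "f (rep3 (p, q, r)) * g (rep3 (p, q, r)) * h (rep3 (p, q, r)) \<noteq> 0" by auto
  then show ?thesis by (intro exI[of _ p] exI[of _ q] exI[of _ r]) (simp add: f_def g_def h_def)
qed

lemma birational_inverse_meet:
  "birational_inverse (meet a b c) (\<lambda>x. (param a x, param b x, param c x))"
proof -
  let ?g = "\<lambda>x. (param a x, param b x, param c x)"
  \<comment> \<open>Off the three surfaces every parameter pair of the image is a nonzero multiple
    of the given one; off the quadric the other composite is multiplication by a nonzero
    scalar.\<close>
  define U where "U = {(p, q, r). axis_form a b c (rep q) (rep r) \<noteq> 0 \<and>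
    axis_form b c a (rep r) (rep p) \<noteq> 0 \<and> axis_form c a b (rep p) (rep q) \<noteq> 0}"
  define W where "W = {x. quad a b c (rep x) \<noteq> 0}"
  have U_open: "openin zariski3 U"
  proof -
    have "closedin zariski3 {(p, q, r). axis_form a b c (rep q) (rep r) = 0}"
      "closedin zariski3 {(p, q, r). axis_form b c a (rep r) (rep p) = 0}"
      "closedin zariski3 {(p, q, r). axis_form c a b (rep p) (rep q) = 0}"
      using pure_dim_bil axis_a axis_b axis_c unfolding axis_form_bil pure_dim_def by blast+
    then have "closedin zariski3 ({(p, q, r). axis_form a b c (rep q) (rep r) = 0} \<union>
        {(p, q, r). axis_form b c a (rep r) (rep p) = 0} \<union> {(p, q, r). axis_form c a b (rep p) (rep q) = 0})"
      by (intro closedin_Un)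
    moreover have "U = UNIV - ({(p, q, r). axis_form a b c (rep q) (rep r) = 0} \<union>
        {(p, q, r). axis_form b c a (rep r) (rep p) = 0} \<union> {(p, q, r). axis_form c a b (rep p) (rep q) = 0})"
      by (auto simp: U_def)
    ultimately show ?thesis by (simp add: closedin_def)
  qed
  have W_open: "openin zariski W"
    unfolding openin_zariski
  proof
    fix x assume "x \<in> W"
    then show "\<exists>f. (\<exists>d. f \<in> forms d) \<and> f (rep x) \<noteq> 0 \<and> (\<forall>p. f (rep p) \<noteq> 0 \<longrightarrow> p \<in> W)"
      using quad_forms[of a b c] by (intro exI[of _ "quad a b c"]) (auto simp: W_def)
  qed
  have U_ne: "U \<noteq> {}" using axis_form_product_nonzero by (auto simp: U_def)
  have U_base: "U \<inter> base_locus (meet a b c) = {}"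
    by (auto simp: U_def base_locus_def meet_zero_iff)
  have UW: "rmap (meet a b c) p \<in> W \<and> rmap_inv ?g (rmap (meet a b c) p) = p" if "p \<in> U" for p
  proof -
    obtain p1 p2 p3 where p: "p = (p1, p2, p3)" by (cases p) auto
    define s t u where "s = rep p1" "t = rep p2" "u = rep p3"
    define A B C where "A = - axis_form a b c t u" "B = - axis_form b c a u s" "C = - axis_form c a b s t"
    have ABC: "A \<noteq> 0" "B \<noteq> 0" "C \<noteq> 0" using that by (simp_all add: U_def p s_t_u_def A_B_C_def)
    define x where "x = meet a b c (s, t, u)"
    have x0: "x \<noteq> 0" using ABC(1) meet_zero_iff[of s t u] by (simp add: x_def A_B_C_def s_t_u_def)
    have par: "param a x = A *s s" "param b x = B *s t" "param c x = C *s u"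
      using param_meet[of a b c s t u] param_meet[of b c a t u s] param_meet[of c a b u s t]
      by (simp_all only: x_def A_B_C_def meet_rotate[of b c a] meet_rotate[of c a b])
    \<comment> \<open>At an image point the quadratic form is, up to sign, the product of the three
      axis forms, hence nonzero.\<close>
    have "quad a b c x *s x = meet a b c (A *s s, B *s t, C *s u)"
      using meet_param_quad[of a b c x] unfolding par by (rule sym)
    also have "\<dots> = (A * B * C) *s x" unfolding meet_scale x_def ..
    finally have "quad a b c x *s x = (A * B * C) *s x" .
    then have Q: "quad a b c x \<noteq> 0" using x0 ABC by simp
    have px: "rmap (meet a b c) p = pt x" by (simp add: rmap_def p x_def s_t_u_def)
    obtain k where k: "k \<noteq> 0" "rep (pt x) = k *s x" using rep_pt[OF x0] .
    have "rmap (meet a b c) p \<in> W" using Q k by (simp add: px W_def quad_scale)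
    moreover have "rmap_inv ?g (rmap (meet a b c) p) = p"
      unfolding px rmap_inv_def k(2) param_scale par using k(1) ABC
      by (simp add: p pt_scale s_t_u_def vector_smult_assoc)
    ultimately show ?thesis ..
  qed
  have W_base: "W \<inter> base_locus_inv ?g = {}"
  proof -
    have "quad a b c (rep x) = 0" if "param a (rep x) = 0 \<or> param b (rep x) = 0 \<or> param c (rep x) = 0" for x
    proof -
      have "meet a b c (param a (rep x), param b (rep x), param c (rep x)) = 0"
        using that by (auto simp: meet_def lc_def)
      then have "quad a b c (rep x) *s rep x = 0" by (simp only: meet_param_quad)
      then show ?thesis by simp
    qed
    then show ?thesis by (auto simp: W_def base_locus_inv_def)
  qed
  have WU: "rmap_inv ?g x \<in> U \<and> rmap (meet a b c) (rmap_inv ?g x) = x" if x: "x \<in> W" for x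
  proof -
    define v where "v = rep x"
    have Q: "quad a b c v \<noteq> 0" using x by (simp add: W_def v_def)
    have nz: "param a v \<noteq> 0" "param b v \<noteq> 0" "param c v \<noteq> 0"
      using x W_base unfolding base_locus_inv_def v_def by auto
    have inv: "rmap_inv ?g x = pt3 (param a v, param b v, param c v)"
      by (simp add: rmap_inv_def v_def)
    obtain l m n where lmn: "l \<noteq> 0" "m \<noteq> 0" "n \<noteq> 0"
      "rep (pt (param a v)) = l *s param a v" "rep (pt (param b v)) = m *s param b v" "rep (pt (param c v)) = n *s param c v"
      using nz by (metis rep_pt)
    have "axis_form a b c (param b v) (param c v) \<noteq> 0" "axis_form b c a (param c v) (param a v) \<noteq> 0"
      "axis_form c a b (param a v) (param b v) \<noteq> 0"
      using Q quad_rotate[of b c a v] quad_rotate[of c a b v] by (simp_all add: quad_def)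
    then have "rmap_inv ?g x \<in> U" by (simp add: inv U_def lmn axis_form_scale)
    moreover have "rmap (meet a b c) (rmap_inv ?g x) = x"
    proof -
      have "meet a b c (param a v, param b v, param c v) \<noteq> 0"
        using Q by (simp add: meet_param_quad v_def)
      then have "rmap (meet a b c) (rmap_inv ?g x) = pt (quad a b c v *s v)"
        unfolding inv using rmap_meet_pt3(1) nz by (simp add: meet_param_quad)
      then show ?thesis using pt_scale[OF Q, of v] by (simp add: v_def)
    qed
    ultimately show ?thesis ..
  qed
  have "rmap (meet a b c) ` U = W"
  proof
    show "rmap (meet a b c) ` U \<subseteq> W" using UW by blast
    show "W \<subseteq> rmap (meet a b c) ` U"
    proof
      fix x assume "x \<in> W"
      then have "rmap_inv ?g x \<in> U" "x = rmap (meet a b c) (rmap_inv ?g x)" using WU by simp_all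
      then show "x \<in> rmap (meet a b c) ` U" by (rule image_eqI[rotated])
    qed
  qed
  moreover have "rmap_inv ?g ` W = U"
  proof
    show "rmap_inv ?g ` W \<subseteq> U" using WU by blast
    show "U \<subseteq> rmap_inv ?g ` W"
    proof
      fix x assume "x \<in> U"
      then have "rmap (meet a b c) x \<in> W" "x = rmap_inv ?g (rmap (meet a b c) x)" using UW by simp_all
      then show "x \<in> rmap_inv ?g ` W" by (rule image_eqI[rotated])
    qed
  qed
  moreover have "W \<noteq> {}" using U_ne UW by blast
  ultimately show ?thesis
    unfolding birational_inverse_def
    using U_open U_ne U_base W_open W_base UW WU by (intro exI[of _ U] exI[of _ W] conjI) auto
qed

subsection \<open>The contracted surfaces\<close>

definition axis_surface :: "P1_3 set" where
  "axis_surface = {(p, q, r). axis_form a b c (rep q) (rep r) = 0}"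

lemma rimage_axis_surface: "rimage (meet a b c) axis_surface \<subseteq> axis_line a"
proof
  fix y assume "y \<in> rimage (meet a b c) axis_surface"
  then obtain x where x: "x \<in> axis_surface" "x \<notin> base_locus (meet a b c)" "y = rmap (meet a b c) x"
    unfolding rimage_def by blast
  obtain p q r where "x = (p, q, r)" by (cases x) auto
  with x have pqr: "axis_form a b c (rep q) (rep r) = 0"
    "meet a b c (rep p, rep q, rep r) \<noteq> 0" "y = pt (meet a b c (rep p, rep q, rep r))"
    by (simp_all add: rmap_def axis_surface_def base_locus_def)
  then show "y \<in> axis_line a" using in_axis_line[OF pqr(2)] dot_meet[of a b c "rep p" "rep q" "rep r"] by simp
qed

lemma axis_surface_not_in_base: "\<not> axis_surface \<subseteq> base_locus (meet a b c)"
proof -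
  define g where "g = (\<lambda>j k. dot (a 1) (wedge (a 0) (b j) (c k)))"
  obtain x y where xy: "bil g x y \<noteq> 0" using axis_a unfolding axis_form_bil g_def by blast
  have e: "axis_surface = bil_surface g" by (simp add: axis_surface_def bil_surface_def axis_form_bil g_def)
  have "base_locus (meet a b c) = base_curve" by (simp add: base_locus_def base_curve_def)
  moreover have "\<not> bil_surface g \<subseteq> base_curve"
  proof (rule bil_surface_components[OF xy])
    fix Y1 Y2
    assume "bil_surface g = Y1 \<union> Y2"
      "\<And>Y. Y \<in> {Y1, Y2} \<Longrightarrow> (\<forall>q. \<exists>r. \<forall>p. (p, q, r) \<in> Y) \<or> (\<forall>r. \<exists>q. \<forall>p. (p, q, r) \<in> Y)"
    then show ?thesis using surface_not_in_base_curve[of Y1] by blast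
  qed
  ultimately show ?thesis unfolding e by simp
qed

lemma contracts_axis_surface: "contracts (meet a b c) axis_surface"
proof -
  have "krull_dim (subtopology zariski3 axis_surface) = 2"
    using pure_dim_bil(4) axis_a unfolding axis_form_bil axis_surface_def by blast
  moreover obtain t u where "axis_form a b c t u \<noteq> 0" using axis_a by blast
  then have "krull_dim (subtopology zariski (rimage (meet a b c) axis_surface)) \<le> 1"
    by (intro krull_dim_in_line[OF is_line_axis_line rimage_axis_surface])
  moreover have "(1 :: enat) < 2" by simp
  ultimately show ?thesis unfolding contracts_def using axis_surface_not_in_base by (metis order_le_less_trans)
qed

text \<open>Skewness lets \<open>lc b t\<close> be split along the pencils \<open>a\<close> and
  \<open>c\<close>. The vanishing of \<open>axis_form c a b\<close> kills the part in
  \<open>a\<close>, so this plane also belongs to the pencil \<open>c\<close>. Any other plane of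
  \<open>c\<close> meets it in the axis of \<open>c\<close>, which is disjoint from that of
  \<open>a\<close>.\<close>

lemma axis_form_vanishing:
  assumes skew: "axis_line a \<inter> axis_line c = {}"
    and t: "t \<noteq> 0" and zero: "\<And>s. axis_form c a b s t = 0"
  obtains R :: "complex^2" where "R \<noteq> 0" "\<forall>u. axis_form a b c t u = 0 \<longrightarrow> R $ 0 * u $ 1 = R $ 1 * u $ 0"
proof -
  have sk: "x = 0" if "\<And>i. dot (a i) x = 0" "\<And>i. dot (c i) x = 0" for x
    using that skew in_axis_line[of x a] in_axis_line[of x c] by blast
  obtain P R where PR: "lc b t = lc a P + lc c R" using span_of_two_pencils[of a c "lc b t"] sk by blast
  \<comment> \<open>The determinant of the four covectors of the skew pencils \<open>a\<close> and
    \<open>c\<close>, nonzero because they are independent.\<close>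
  define k where "k = dot (c 1) (wedge (c 0) (a 0) (a 1))"
  have k0: "k \<noteq> 0"
  proof
    assume k: "k = 0"
    have "wedge (c 0) (a 0) (a 1) = 0"
    proof (rule sk)
      fix i
      show "dot (a i) (wedge (c 0) (a 0) (a 1)) = 0"
        using type_2_cases[of i] by (elim disjE) (simp_all add: dot_wedge_self)
      show "dot (c i) (wedge (c 0) (a 0) (a 1)) = 0"
        using type_2_cases[of i] k by (elim disjE) (simp_all add: dot_wedge_self k_def)
    qed
    then obtain l m n where lmn: "l \<noteq> 0 \<or> m \<noteq> 0 \<or> n \<noteq> 0" "l *s c 0 + m *s a 0 + n *s a 1 = 0"
      using wedge_zero_dependent by blast
    have d: "l * dot (c 0) x + m * dot (a 0) x + n * dot (a 1) x = 0" for x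
      using arg_cong[OF lmn(2), of "\<lambda>v. dot v x"] by (simp add: dot_add dot_scale)
    have X: "\<exists>x. (\<forall>i. dot (a i) x = y $ i) \<and> (\<forall>i. dot (c i) x = z $ i)" for y z
      using dual_vector[of a c y z] sk by blast
    obtain x where "\<forall>i. dot (a i) x = (hpair 0 0) $ i" "\<forall>i. dot (c i) x = (hpair 1 0) $ i" using X by blast
    then have "l = 0" using d[of x] unfolding all_type_2 by simp
    moreover obtain x where "\<forall>i. dot (a i) x = (hpair 1 0) $ i" "\<forall>i. dot (c i) x = (hpair 0 0) $ i" using X by blast
    then have "m = 0" using d[of x] unfolding all_type_2 by simp
    moreover obtain x where "\<forall>i. dot (a i) x = (hpair 0 1) $ i" "\<forall>i. dot (c i) x = (hpair 0 0) $ i" using X by blast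
    then have "n = 0" using d[of x] unfolding all_type_2 by simp
    ultimately show False using lmn(1) by blast
  qed
  have "axis_form c a b s t = (s $ 0 * P $ 1 - s $ 1 * P $ 0) * k" for s :: "complex^2"
  proof -
    have "axis_form c a b s t = axis_form c a a s P + axis_form c a c s R"
      unfolding axis_form_def PR wedge_add dot_add ..
    also have "axis_form c a a s P = (s $ 0 * P $ 1 - s $ 1 * P $ 0) * k"
      by (simp add: axis_form_bilinear sum_type_2 wedge_same wedge_swap[of "c 0" "a 1" "a 0"] dot_minus k_def algebra_simps)
    also have "axis_form c a c s R = 0"
      by (simp add: axis_form_bilinear sum_type_2 wedge_same dot_wedge_self)
    finally show ?thesis by simp
  qed
  then have "(s $ 0 * P $ 1 - s $ 1 * P $ 0) = 0" for s :: "complex^2" using zero[of s] k0 by simp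
  from this[of "hpair 1 0"] this[of "hpair 0 1"] have "P = 0" by (simp add: vec2_eq_iff)
  then have T: "lc b t = lc c R" using PR by (simp add: lc_def)
  \<comment> \<open>Otherwise the parameter \<open>t\<close> would have no plane, and
    \<open>axis_form b c a\<close> would vanish identically.\<close>
  have R0: "R \<noteq> 0"
  proof
    assume "R = 0"
    then have "lc b t = 0" using T by (simp add: lc_def)
    then have "axis_form b c a u s = 0" for u s
      using dot_meet[of b c a t u s] t by (auto simp: meet_def vec2_eq_iff)
    then show False using axis_b by blast
  qed
  define k' where "k' = dot (a 1) (wedge (a 0) (c 0) (c 1))"
  have kk: "k' = k"
    unfolding k_def k'_def by (simp add: dot_eq minor3_def minor2_def algebra_simps)
  have "axis_form a b c t u = (R $ 0 * u $ 1 - R $ 1 * u $ 0) * k" for u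
  proof -
    have "axis_form a b c t u = axis_form a c c R u" unfolding axis_form_def T ..
    also have "\<dots> = (R $ 0 * u $ 1 - R $ 1 * u $ 0) * k'"
      by (simp add: axis_form_bilinear sum_type_2 wedge_same wedge_swap[of "a 0" "c 1" "c 0"] dot_minus k'_def algebra_simps)
    finally show ?thesis unfolding kk .
  qed
  then show ?thesis using that[of R] R0 k0 by simp
qed

text \<open>The planes of the pencil \<open>c\<close> cut the axis of \<open>a\<close> in distinct
  points, because the two axes are skew. For all but at most one \<open>z\<close> the point in the
  plane with parameter \<open>(1 : z)\<close> is the image of a point of the surface.\<close>

lemma infinite_rimage_axis_surface:
  assumes skew: "axis_line a \<inter> axis_line c = {}"
  shows "infinite (rimage (meet a b c) axis_surface)"
proof -
  define U where "U z = hpair 1 z" for z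
  have U0: "U z \<noteq> 0" for z by (simp add: U_def vec2_eq_iff)
  \<comment> \<open>Bad parameters are those for which \<open>axis_form c a b\<close> cannot certify
    that the meet is nonzero at some point of the surface over \<open>U z\<close>.\<close>
  define bad where "bad z \<longleftrightarrow> (\<forall>t. t \<noteq> 0 \<longrightarrow> axis_form a b c t (U z) = 0 \<longrightarrow> (\<forall>s. axis_form c a b s t = 0))" for z
  have ex: "\<exists>t. t \<noteq> 0 \<and> axis_form a b c t u = 0" for u
  proof -
    define l where "l j = axis_form a b c (axis j 1) u" for j
    have e: "axis_form a b c t u = t $ 0 * l 0 + t $ 1 * l 1" for t
      unfolding l_def axis_form_bil bil_eq by (simp add: axis_def algebra_simps)
    show ?thesis
    proof (cases "l 0 = 0 \<and> l 1 = 0")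
      case True
      then show ?thesis by (intro exI[of _ "hpair 1 0"]) (simp add: e vec2_eq_iff)
    next
      case False
      then show ?thesis by (intro exI[of _ "hpair (- l 1) (l 0)"]) (auto simp: e vec2_eq_iff)
    qed
  qed
  \<comment> \<open>Each bad parameter comes with a \<open>t\<close> that annihilates
    \<open>axis_form c a b\<close>. Two different points \<open>t\<close> would annihilate it
    identically, so they agree, and \<open>axis_form_vanishing\<close> then determines
    \<open>z\<close>.\<close>
  have bad_unique: "z = z'" if bad: "bad z" "bad z'" for z z'
  proof -
    obtain t where t: "t \<noteq> 0" "axis_form a b c t (U z) = 0" using ex by blast
    obtain t' where t': "t' \<noteq> 0" "axis_form a b c t' (U z') = 0" using ex by blast
    have C: "axis_form c a b s t = 0" "axis_form c a b s t' = 0" for s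
      using bad t t' by (simp_all add: bad_def)
    obtain R :: "complex^2" where R: "R \<noteq> 0" "\<forall>u. axis_form a b c t u = 0 \<longrightarrow> R $ 0 * u $ 1 = R $ 1 * u $ 0"
      using axis_form_vanishing[OF skew t(1) C(1)] .
    have "t $ 0 * t' $ 1 = t $ 1 * t' $ 0"
    proof (rule ccontr)
      assume n: "t $ 0 * t' $ 1 \<noteq> t $ 1 * t' $ 0"
      have "axis_form c a b s r = 0" for s r
      proof -
        have "(t $ 0 * t' $ 1 - t $ 1 * t' $ 0) * axis_form c a b s r =
          (r $ 0 * t' $ 1 - r $ 1 * t' $ 0) * axis_form c a b s t + (t $ 0 * r $ 1 - t $ 1 * r $ 0) * axis_form c a b s t'"
          unfolding axis_form_bil bil_eq by (simp add: algebra_simps)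
        then show ?thesis using n C by simp
      qed
      then show False using axis_c by blast
    qed
    then obtain k where k: "t' = k *s t" using parallel_2[OF t(1)] by blast
    then have "k \<noteq> 0" using t'(1) by auto
    then have "axis_form a b c t (U z') = 0"
      using t'(2) axis_form_scale[of a b c k t 1 "U z'"] unfolding k by simp
    then have "R $ 0 * z = R $ 1" "R $ 0 * z' = R $ 1" using R(2)[rule_format, of "U z"] R(2)[rule_format, of "U z'"] t(2) by (simp_all add: U_def)
    moreover from this have "R $ 0 \<noteq> 0" using R(1) by (auto simp: vec2_eq_iff)
    ultimately show ?thesis by (metis mult_cancel_left)
  qed
  have good: "\<exists>x. x \<noteq> 0 \<and> pt x \<in> rimage (meet a b c) axis_surface \<and> pt x \<in> axis_line a \<and> dot (lc c (U z)) x = 0"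
    if "\<not> bad z" for z
  proof -
    obtain t s where ts: "t \<noteq> 0" "axis_form a b c t (U z) = 0" "axis_form c a b s t \<noteq> 0"
      using \<open>\<not> bad z\<close> unfolding bad_def by blast
    have s: "s \<noteq> 0" using ts(3) by (auto simp: axis_form_bil bil_eq)
    let ?x = "meet a b c (s, t, U z)"
    have nz: "nz3 (s, t, U z)" using ts(1) s U0 by simp
    have x: "?x \<noteq> 0" using meet_zero_iff[OF nz] ts(3) by simp
    have "pt3 (s, t, U z) \<in> axis_surface"
    proof -
      obtain l m n where "rep3 (pt3 (s, t, U z)) = (l *s s, m *s t, n *s U z)" using rep3_pt3[OF nz] by metis
      then show ?thesis using ts(2) by (simp add: axis_surface_def axis_form_scale)
    qed
    then have "pt ?x \<in> rimage (meet a b c) axis_surface"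
      unfolding rimage_def using rmap_meet_pt3[OF nz x] by (intro image_eqI[of _ _ "pt3 (s, t, U z)"]) simp_all
    moreover have "dot (lc c (U z)) ?x = 0" by (simp add: meet_def dot_wedge_self)
    ultimately show ?thesis using x rimage_axis_surface by blast
  qed
  define x where "x z = (SOME x. x \<noteq> 0 \<and> pt x \<in> rimage (meet a b c) axis_surface \<and> pt x \<in> axis_line a \<and>
    dot (lc c (U z)) x = 0)" for z
  have x: "x z \<noteq> 0" "pt (x z) \<in> rimage (meet a b c) axis_surface" "pt (x z) \<in> axis_line a"
    "dot (lc c (U z)) (x z) = 0" if "\<not> bad z" for z
    using someI_ex[OF good[OF that]] unfolding x_def by simp_all
  \<comment> \<open>A point in two planes of the pencil \<open>c\<close> lies on the axis of
    \<open>c\<close>, which is impossible on the axis of \<open>a\<close>.\<close>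
  have "inj_on (\<lambda>z. pt (x z)) {z. \<not> bad z}"
  proof (rule inj_onI)
    fix z z' assume z: "z \<in> {z. \<not> bad z}" "z' \<in> {z. \<not> bad z}" and eq: "pt (x z) = pt (x z')"
    obtain k where k: "k \<noteq> 0" "x z' = k *s x z" using eq pt_eq_iff[of "x z" "x z'"] x(1) z by auto
    have e: "dot (c 0) (x z) + z * dot (c 1) (x z) = 0" using x(4)[of z] z by (simp add: lc_def U_def dot_add dot_scale)
    have "k * (dot (c 0) (x z) + z' * dot (c 1) (x z)) = 0"
      using x(4)[of z'] z unfolding k(2) by (simp add: lc_def U_def dot_add dot_scale algebra_simps)
    then have e': "dot (c 0) (x z) + z' * dot (c 1) (x z) = 0" using k(1) by simp
    show "z = z'"
    proof (rule ccontr)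
      assume n: "z \<noteq> z'"
      have "(z - z') * dot (c 1) (x z) = (dot (c 0) (x z) + z * dot (c 1) (x z)) - (dot (c 0) (x z) + z' * dot (c 1) (x z))"
        by (simp add: algebra_simps)
      then have "dot (c 1) (x z) = 0" using n e e' by simp
      then have "pt (x z) \<in> axis_line c" using e in_axis_line[of "x z" c] x(1)[of z] z by simp
      then show False using x(3)[of z] z skew by blast
    qed
  qed
  moreover have "infinite {z. \<not> bad z}"
  proof
    assume "finite {z. \<not> bad z}"
    moreover have "finite {z. bad z}"
    proof (cases "\<exists>z. bad z")
      case True
      then obtain z where "bad z" by blast
      then have "{z. bad z} \<subseteq> {z}" using bad_unique by blast
      then show ?thesis by (rule finite_subset) simp
    qed simp
    ultimately have "finite ({z. \<not> bad z} \<union> {z. bad z})" by simp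
    moreover have "{z. \<not> bad z} \<union> {z. bad z} = UNIV" by blast
    ultimately show False using infinite_UNIV_char_0[where 'a = complex] by simp
  qed
  ultimately have "infinite ((\<lambda>z. pt (x z)) ` {z. \<not> bad z})" using finite_imageD by blast
  moreover have "(\<lambda>z. pt (x z)) ` {z. \<not> bad z} \<subseteq> rimage (meet a b c) axis_surface" using x(2) by blast
  ultimately show ?thesis using infinite_super by blast
qed

text \<open>Exchanging \<open>b\<close> and \<open>c\<close> only changes signs. It reduces the case
  in which the axes of \<open>a\<close> and \<open>b\<close> are skew to that of \<open>a\<close>
  and \<open>c\<close>.\<close>

lemma reflect: "pencils a c b"
proof -
  have e: "axis_form a c b u t = - axis_form a b c t u" for a b c :: "2 \<Rightarrow> complex^4" and t u
    unfolding axis_form_def using wedge_swap[of "a 0" "lc c u" "lc b t"] by (simp add: dot_minus)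
  show ?thesis
    by unfold_locales (use axis_a axis_b axis_c no_common in \<open>auto simp: e[of _ b c] e[of _ c a] e[of _ a b]\<close>)
qed

lemma contracts_to_axis_line:
  assumes skew: "axis_line a \<inter> axis_line b = {} \<or> axis_line a \<inter> axis_line c = {}"
  shows "contracts_to (meet a b c) axis_surface (axis_line a)"
proof -
  have "infinite (rimage (meet a b c) axis_surface)"
    using skew
  proof
    assume skew: "axis_line a \<inter> axis_line b = {}"
    interpret r: pencils a c b by (rule reflect)
    have m: "meet a c b (s, u, t) = - meet a b c (s, t, u)" for s t u
      unfolding meet_def using wedge_swap[of "lc a s" "lc c u" "lc b t"] by simp
    have ax: "axis_form a c b u t = - axis_form a b c t u" for t u
      unfolding axis_form_def using wedge_swap[of "a 0" "lc c u" "lc b t"] by (simp add: dot_minus)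
    have "rimage (meet a c b) r.axis_surface \<subseteq> rimage (meet a b c) axis_surface"
    proof
      fix y assume "y \<in> rimage (meet a c b) r.axis_surface"
      then obtain x where x: "x \<in> r.axis_surface" "x \<notin> base_locus (meet a c b)" "y = rmap (meet a c b) x"
        unfolding rimage_def by blast
      obtain p r q where pqr: "x = (p, r, q)" by (cases x) auto
      have "(p, q, r) \<in> axis_surface" using x(1) by (simp add: pqr r.axis_surface_def axis_surface_def ax)
      moreover have nz: "meet a b c (rep p, rep q, rep r) \<noteq> 0" using x(2) by (simp add: pqr base_locus_def m)
      moreover have "y = rmap (meet a b c) (p, q, r)"
        using pt_scale[of "- 1" "meet a b c (rep p, rep q, rep r)"] nz by (simp add: x(3) pqr rmap_def m)
      ultimately show "y \<in> rimage (meet a b c) axis_surface"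
        unfolding rimage_def by (intro image_eqI[of _ _ "(p, q, r)"]) (simp_all add: base_locus_def)
    qed
    then show ?thesis using r.infinite_rimage_axis_surface[OF skew] infinite_super by blast
  next
    assume "axis_line a \<inter> axis_line c = {}"
    then show ?thesis by (rule infinite_rimage_axis_surface)
  qed
  moreover obtain t u where "axis_form a b c t u \<noteq> 0" using axis_a by blast
  ultimately have "zariski closure_of (rimage (meet a b c) axis_surface) = axis_line a"
    by (intro closure_in_line[OF is_line_axis_line closedin_axis_line rimage_axis_surface])
  then show ?thesis unfolding contracts_to_def using contracts_axis_surface by blast
qed

end

subsection \<open>Quadrics containing three skew lines\<close>

definition quadform :: "complex^4^4 \<Rightarrow> complex^4 \<Rightarrow> complex^4 \<Rightarrow> complex" where
  "quadform M x y = (\<Sum>i\<in>UNIV. \<Sum>j\<in>UNIV. M $ i $ j * x $ i * y $ j)"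

lemma quadform_add:
  "quadform M (x + y) z = quadform M x z + quadform M y z"
  "quadform M z (x + y) = quadform M z x + quadform M z y"
  by (simp_all add: quadform_def algebra_simps sum.distrib)

lemma quadform_scale:
  "quadform M (l *s x) z = l * quadform M x z"
  "quadform M z (l *s x) = l * quadform M z x"
  by (simp_all add: quadform_def algebra_simps sum_distrib_left)

text \<open>Taylor expansion along rays up to order two. The constant, the covector and the matrix
  are common to all \<open>x\<close>; only the remainder depends on the ray.\<close>

lemma poly_fun_expansion:
  assumes "f \<in> poly_funs (coords :: (complex^4 \<Rightarrow> complex) set)"
  shows "\<exists>c d M. \<forall>x. \<exists>p. \<forall>l. f (l *s x) = c + l * dot d x + l ^ 2 * quadform M x x + l ^ 3 * poly p l"
  using assms
proof induction
  case (const c)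
  show ?case
    by (rule exI[of _ c], rule exI[of _ 0], rule exI[of _ 0], rule allI, rule exI[of _ 0]) (simp add: quadform_def)
next
  case (coord f)
  then obtain i where f: "f = (\<lambda>x. x $ i)" by (auto simp: coords_def)
  have "dot (axis i 1) x = x $ i" for x
    by (simp add: dot_def axis_def if_distrib[of "\<lambda>x. x * _"] cong: if_cong)
  then show ?case
    by (intro exI[of _ 0] exI[of _ "axis i 1"] allI) (simp add: quadform_def f)
next
  case (add f g)
  then obtain c d M c' d' M' where
    f: "\<And>x. \<exists>p. \<forall>l. f (l *s x) = c + l * dot d x + l ^ 2 * quadform M x x + l ^ 3 * poly p l" and
    g: "\<And>x. \<exists>p. \<forall>l. g (l *s x) = c' + l * dot d' x + l ^ 2 * quadform M' x x + l ^ 3 * poly p l"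
    by blast
  have q: "quadform (M + M') x x = quadform M x x + quadform M' x x" for x
    by (simp add: quadform_def algebra_simps sum.distrib)
  have "\<exists>p. \<forall>l. f (l *s x) + g (l *s x) =
      (c + c') + l * dot (d + d') x + l ^ 2 * quadform (M + M') x x + l ^ 3 * poly p l" for x
  proof -
    obtain p p' where pp: "\<And>l. f (l *s x) = c + l * dot d x + l ^ 2 * quadform M x x + l ^ 3 * poly p l"
      "\<And>l. g (l *s x) = c' + l * dot d' x + l ^ 2 * quadform M' x x + l ^ 3 * poly p' l" using f g by blast
    show ?thesis
      by (intro exI[of _ "p + p'"] allI) (simp only: pp q dot_add poly_add, simp add: algebra_simps)
  qed
  then show ?case by blast
next
  case (mult f g)
  then obtain c d M c' d' M' where
    f: "\<And>x. \<exists>p. \<forall>l. f (l *s x) = c + l * dot d x + l ^ 2 * quadform M x x + l ^ 3 * poly p l" and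
    g: "\<And>x. \<exists>p. \<forall>l. g (l *s x) = c' + l * dot d' x + l ^ 2 * quadform M' x x + l ^ 3 * poly p l"
    by blast
  \<comment> \<open>The quadratic part of a product: each constant times the other quadratic part,
    plus the product of the linear parts.\<close>
  define N :: "complex^4^4" where "N = (\<chi> i j. c * M' $ i $ j + c' * M $ i $ j + d $ i * d' $ j)"
  have q: "quadform N x x = c * quadform M' x x + c' * quadform M x x + dot d x * dot d' x" for x
  proof -
    have "quadform N x x = (\<Sum>i\<in>UNIV. \<Sum>j\<in>UNIV. c * (M' $ i $ j * x $ i * x $ j) + c' * (M $ i $ j * x $ i * x $ j)
        + (d $ i * x $ i) * (d' $ j * x $ j))"
      unfolding quadform_def N_def by (intro sum.cong refl) (simp add: algebra_simps)
    then show ?thesis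
      by (simp only: sum.distrib sum_distrib_left[symmetric] sum_distrib_right[symmetric] quadform_def dot_def)
  qed
  have "\<exists>p. \<forall>l. f (l *s x) * g (l *s x) =
      (c * c') + l * dot (c *s d' + c' *s d) x + l ^ 2 * quadform N x x + l ^ 3 * poly p l" for x
  proof -
    obtain p p' where pp: "\<And>l. f (l *s x) = c + l * dot d x + l ^ 2 * quadform M x x + l ^ 3 * poly p l"
      "\<And>l. g (l *s x) = c' + l * dot d' x + l ^ 2 * quadform M' x x + l ^ 3 * poly p' l" using f g by blast
    define a a' b b' where "a = dot d x" "a' = dot d' x" "b = quadform M x x" "b' = quadform M' x x"
    define r where "r = smult c p' + smult c' p + [:a * b' + a' * b:] + [:0, 1:] * (smult a p' + smult a' p + [:b * b':])
      + [:0, 0, 1:] * (smult b p' + smult b' p) + [:0, 0, 0, 1:] * (p * p')"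
    have "poly r l = c * poly p' l + c' * poly p l + a * b' + a' * b + l * (a * poly p' l + a' * poly p l + b * b')
        + l ^ 2 * (b * poly p' l + b' * poly p l) + l ^ 3 * (poly p l * poly p' l)" for l
      by (simp add: r_def power2_eq_square power3_eq_cube algebra_simps)
    then show ?thesis
      by (intro exI[of _ r] allI) (simp only: pp q dot_add dot_scale a_a'_b_b'_def[symmetric],
          simp add: power2_eq_square power3_eq_cube algebra_simps)
  qed
  then show ?case by blast
qed

text \<open>Polynomials are given only as functions, so the matrix is recovered by comparing
  coefficients of \<open>l ^ 2\<close> on each ray.\<close>

lemma forms_2_quadform:
  assumes "f \<in> forms 2"
  obtains M where "\<And>x. f x = quadform M x x"
proof -
  have f: "f \<in> poly_funs coords" "\<And>l x. f (l *s x) = l ^ 2 * f x" using assms by (simp_all add: forms_def)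
  obtain c d M where M: "\<And>x. \<exists>p. \<forall>l. f (l *s x) = c + l * dot d x + l ^ 2 * quadform M x x + l ^ 3 * poly p l"
    using poly_fun_expansion[OF f(1)] by blast
  have "f x = quadform M x x" for x
  proof -
    obtain p where p: "\<And>l. f (l *s x) = c + l * dot d x + l ^ 2 * quadform M x x + l ^ 3 * poly p l" using M by blast
    define r where "r = pCons c (pCons (dot d x) (pCons (quadform M x x - f x) p))"
    have "poly r l = 0" for l
      using p[of l] f(2)[of l x] by (simp add: r_def power2_eq_square power3_eq_cube algebra_simps)
    then have "r = 0" using poly_all_0_iff_0 by blast
    then show ?thesis by (simp add: r_def)
  qed
  then show ?thesis by (rule that)
qed

text \<open>The quadric swept out by the common transversals of the axes of \<open>X\<close>, \<open>Y\<close> and \<open>X + Y\<close>.\<close>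

definition ruled :: "(2 \<Rightarrow> complex^4) \<Rightarrow> (2 \<Rightarrow> complex^4) \<Rightarrow> complex^4 \<Rightarrow> complex" where
  "ruled X Y x = dot (X 0) x * dot (Y 1) x - dot (X 1) x * dot (Y 0) x"

text \<open>The gradient of \<open>ruled X Y\<close> at \<open>x\<close>, as a covector.\<close>

definition ruled_polar :: "(2 \<Rightarrow> complex^4) \<Rightarrow> (2 \<Rightarrow> complex^4) \<Rightarrow> complex^4 \<Rightarrow> complex^4" where
  "ruled_polar X Y x = dot (X 0) x *s Y 1 + dot (Y 1) x *s X 0 - dot (X 1) x *s Y 0 - dot (Y 0) x *s X 1"

lemma ruled_line: "ruled X Y (x + z *s y) = ruled X Y x + z * dot (ruled_polar X Y x) y + z ^ 2 * ruled X Y y"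
  by (simp add: ruled_def ruled_polar_def dot_add dot_diff dot_scale power2_eq_square algebra_simps)

lemma ruled_forms: "ruled X Y \<in> forms 2"
proof -
  have d: "dot v \<in> poly_funs coords" for v using dot_forms[of v] by (simp add: forms_def)
  have "(\<lambda>x. dot (X 0) x * dot (Y 1) x - dot (X 1) x * dot (Y 0) x) \<in> poly_funs coords"
    by (intro poly_funs_diff poly_funs.mult d)
  then have "ruled X Y \<in> poly_funs coords" by (simp add: ruled_def[abs_def])
  then show ?thesis by (simp add: forms_def ruled_def dot_scale power2_eq_square algebra_simps)
qed

context
  fixes X Y :: "2 \<Rightarrow> complex^4"
  assumes indep: "\<And>x. (\<And>i. dot (X i) x = 0) \<Longrightarrow> (\<And>i. dot (Y i) x = 0) \<Longrightarrow> x = 0"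
begin

lemma ruled_dual:
  obtains v where "dot (X 0) v = p" "dot (X 1) v = q" "dot (Y 0) v = r" "dot (Y 1) v = s"
proof -
  have "\<exists>x. (\<forall>i. dot (X i) x = hpair p q $ i) \<and> (\<forall>i. dot (Y i) x = hpair r s $ i)"
    by (rule dual_vector) (rule indep)
  then obtain x where "\<forall>i. dot (X i) x = hpair p q $ i" "\<forall>i. dot (Y i) x = hpair r s $ i" by blast
  then show ?thesis unfolding all_type_2 by (intro that[of x]) simp_all
qed

lemma ruled_indep:
  assumes "dot (X 0) x = 0" "dot (X 1) x = 0" "dot (Y 0) x = 0" "dot (Y 1) x = 0"
  shows "x = 0"
proof (rule indep)
  fix i
  show "dot (X i) x = 0" using type_2_cases[of i] assms by (elim disjE) simp_all
  show "dot (Y i) x = 0" using type_2_cases[of i] assms by (elim disjE) simp_all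
qed

text \<open>Pairing the gradient with vectors dual to \<open>X\<close> and \<open>Y\<close> reads
  off, up to sign, the four values of \<open>X\<close> and \<open>Y\<close> at \<open>x\<close>, so
  it vanishes only at the origin.\<close>

lemma smooth_ruled: "smooth_surface_of_degree 2 (zeros (ruled X Y))"
  unfolding smooth_surface_of_degree_def
proof (rule bexI[OF _ ruled_forms], intro conjI allI impI)
  show "zeros (ruled X Y) = zeros (ruled X Y)" ..
next
  fix x assume x: "x \<noteq> 0 \<and> ruled X Y x = 0"
  show "\<exists>i. deriv (\<lambda>z. ruled X Y (x + z *s axis i 1)) 0 \<noteq> 0"
  proof (rule ccontr)
    assume no: "\<nexists>i. deriv (\<lambda>z. ruled X Y (x + z *s axis i 1)) 0 \<noteq> 0"
    let ?D = "ruled_polar X Y x"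
    have "?D $ i = 0" for i
    proof -
      have "((\<lambda>z. ruled X Y (x + z *s axis i 1)) has_field_derivative dot ?D (axis i 1)) (at 0)"
        unfolding ruled_line by (auto intro!: derivative_eq_intros)
      then have "dot ?D (axis i 1) = 0" using no DERIV_imp_deriv by metis
      moreover have "dot ?D (axis i 1) = ?D $ i"
        by (simp add: dot_def axis_def if_distrib[of "\<lambda>x. _ * x"] cong: if_cong)
      ultimately show ?thesis by simp
    qed
    then have D: "?D = 0" by (simp add: vec_eq_iff)
    have e: "dot (X 0) x * dot (Y 1) v + dot (Y 1) x * dot (X 0) v - dot (X 1) x * dot (Y 0) v - dot (Y 0) x * dot (X 1) v = 0" for v
    proof -
      have "dot ?D v = 0" unfolding D by simp
      then show ?thesis by (simp add: ruled_polar_def dot_add dot_diff dot_scale)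
    qed
    obtain v0 where "dot (X 0) v0 = 1" "dot (X 1) v0 = 0" "dot (Y 0) v0 = 0" "dot (Y 1) v0 = 0" by (rule ruled_dual)
    with e[of v0] have 1: "dot (Y 1) x = 0" by simp
    obtain v1 where "dot (X 0) v1 = 0" "dot (X 1) v1 = 1" "dot (Y 0) v1 = 0" "dot (Y 1) v1 = 0" by (rule ruled_dual)
    with e[of v1] have 2: "dot (Y 0) x = 0" by simp
    obtain v2 where "dot (X 0) v2 = 0" "dot (X 1) v2 = 0" "dot (Y 0) v2 = 1" "dot (Y 1) v2 = 0" by (rule ruled_dual)
    with e[of v2] have 3: "dot (X 1) x = 0" by simp
    obtain v3 where "dot (X 0) v3 = 0" "dot (X 1) v3 = 0" "dot (Y 0) v3 = 0" "dot (Y 1) v3 = 1" by (rule ruled_dual)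
    with e[of v3] have 4: "dot (X 0) x = 0" by simp
    show False using ruled_indep[OF 4 3 2 1] x by simp
  qed
qed

text \<open>In the basis dual to \<open>X\<close> and \<open>Y\<close> a quadratic form has ten
  coefficients. Each line imposes three independent conditions, and the one remaining degree of
  freedom is \<open>K\<close>.\<close>

lemma quadric_through_lines:
  assumes f: "f \<in> forms 2"
    and fX: "\<And>x. dot (X 0) x = 0 \<Longrightarrow> dot (X 1) x = 0 \<Longrightarrow> f x = 0"
    and fY: "\<And>x. dot (Y 0) x = 0 \<Longrightarrow> dot (Y 1) x = 0 \<Longrightarrow> f x = 0"
    and fXY: "\<And>x. dot (X 0) x + dot (Y 0) x = 0 \<Longrightarrow> dot (X 1) x + dot (Y 1) x = 0 \<Longrightarrow> f x = 0"
  obtains K where "\<And>x. f x = K * ruled X Y x"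
proof -
  obtain M where M: "\<And>x. f x = quadform M x x" using forms_2_quadform[OF f] by blast
  obtain x0 where x0: "dot (X 0) x0 = 1" "dot (X 1) x0 = 0" "dot (Y 0) x0 = 0" "dot (Y 1) x0 = 0" by (rule ruled_dual)
  obtain x1 where x1: "dot (X 0) x1 = 0" "dot (X 1) x1 = 1" "dot (Y 0) x1 = 0" "dot (Y 1) x1 = 0" by (rule ruled_dual)
  obtain y0 where y0: "dot (X 0) y0 = 0" "dot (X 1) y0 = 0" "dot (Y 0) y0 = 1" "dot (Y 1) y0 = 0" by (rule ruled_dual)
  obtain y1 where y1: "dot (X 0) y1 = 0" "dot (X 1) y1 = 0" "dot (Y 0) y1 = 0" "dot (Y 1) y1 = 1" by (rule ruled_dual)
  let ?q = "quadform M"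
  have 1: "?q x0 x0 = 0" "?q x1 x1 = 0" "?q y0 y0 = 0" "?q y1 y1 = 0"
    using fY[of x0] fY[of x1] fX[of y0] fX[of y1] x0 x1 y0 y1 by (simp_all add: M)
  have "?q (x0 + x1) (x0 + x1) = 0" unfolding M[symmetric] by (rule fY) (simp_all add: dot_add x0 x1)
  then have 2: "?q x0 x1 + ?q x1 x0 = 0" by (simp add: quadform_add 1 add.commute)
  have "?q (y0 + y1) (y0 + y1) = 0" unfolding M[symmetric] by (rule fX) (simp_all add: dot_add y0 y1)
  then have 3: "?q y0 y1 + ?q y1 y0 = 0" by (simp add: quadform_add 1 add.commute)
  have minus: "?q (x + (- 1) *s y) (x + (- 1) *s y) = ?q x x + ?q y y - (?q x y + ?q y x)" for x y
    by (simp only: quadform_add quadform_scale) simp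
  \<comment> \<open>The differences \<open>x0 - y0\<close> and \<open>x1 - y1\<close> span the third
    line.\<close>
  have "?q (x0 + (- 1) *s y0) (x0 + (- 1) *s y0) = 0"
    unfolding M[symmetric] by (rule fXY) (simp_all only: dot_add dot_scale x0 y0, simp_all)
  then have 4: "?q x0 y0 + ?q y0 x0 = 0" unfolding minus 1 by (simp only: add_0_left diff_0 neg_equal_0_iff_equal)
  have "?q (x1 + (- 1) *s y1) (x1 + (- 1) *s y1) = 0"
    unfolding M[symmetric] by (rule fXY) (simp_all only: dot_add dot_scale x1 y1, simp_all)
  then have 5: "?q x1 y1 + ?q y1 x1 = 0" unfolding minus 1 by (simp only: add_0_left diff_0 neg_equal_0_iff_equal)
  have 6: "(?q x0 y1 + ?q y1 x0) + (?q x1 y0 + ?q y0 x1) = 0"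
  proof -
    have e: "?q ((x0 + x1) + (- 1) *s (y0 + y1)) ((x0 + x1) + (- 1) *s (y0 + y1)) = 0"
      unfolding M[symmetric] by (rule fXY) (simp_all only: dot_add dot_scale x0 x1 y0 y1, simp_all)
    have "?q ((x0 + x1) + (- 1) *s (y0 + y1)) ((x0 + x1) + (- 1) *s (y0 + y1)) =
      (?q x0 x0 + ?q x1 x1 + ?q y0 y0 + ?q y1 y1) + (?q x0 x1 + ?q x1 x0) + (?q y0 y1 + ?q y1 y0)
      - (?q x0 y0 + ?q y0 x0) - (?q x1 y1 + ?q y1 x1) - ((?q x0 y1 + ?q y1 x0) + (?q x1 y0 + ?q y0 x1))"
      by (subst minus) (simp only: quadform_add, simp)
    from this[unfolded e 1 2 3 4 5] show ?thesis
      by (simp only: add_0_left add_0_right diff_0_right diff_0 neg_0_equal_iff_equal)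
  qed
  have "f v = (?q x0 y1 + ?q y1 x0) * ruled X Y v" for v
  proof -
    define p q r s where "p = dot (X 0) v" "q = dot (X 1) v" "r = dot (Y 0) v" "s = dot (Y 1) v"
    have "v - (p *s x0 + q *s x1 + r *s y0 + s *s y1) = 0"
      by (rule ruled_indep) (simp_all add: dot_diff dot_add dot_scale x0 x1 y0 y1 p_q_r_s_def)
    then have v: "v = p *s x0 + q *s x1 + r *s y0 + s *s y1" by (simp only: right_minus_eq)
    have "f v = p ^ 2 * ?q x0 x0 + q ^ 2 * ?q x1 x1 + r ^ 2 * ?q y0 y0 + s ^ 2 * ?q y1 y1
      + p * q * (?q x0 x1 + ?q x1 x0) + r * s * (?q y0 y1 + ?q y1 y0) + p * r * (?q x0 y0 + ?q y0 x0)
      + q * s * (?q x1 y1 + ?q y1 x1) + p * s * (?q x0 y1 + ?q y1 x0) + q * r * (?q x1 y0 + ?q y0 x1)"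
    proof -
      have "f v = ?q (p *s x0 + q *s x1 + r *s y0 + s *s y1) (p *s x0 + q *s x1 + r *s y0 + s *s y1)"
        unfolding M v[symmetric] ..
      then show ?thesis
        by (simp only: quadform_add quadform_scale) (simp add: power2_eq_square algebra_simps)
    qed
    also have "\<dots> = p * s * (?q x0 y1 + ?q y1 x0) + q * r * (?q x1 y0 + ?q y0 x1)"
      unfolding 1 2 3 4 5 by simp
    also have "?q x1 y0 + ?q y0 x1 = - (?q x0 y1 + ?q y1 x0)" by (rule add_eq_0_iff[THEN iffD1, OF 6])
    finally show ?thesis by (simp add: ruled_def p_q_r_s_def algebra_simps)
  qed
  then show ?thesis by (rule that)
qed

text \<open>On the quadric the values of \<open>X\<close> and \<open>Y\<close> at \<open>x\<close>
  are parallel, equal to \<open>k *s v\<close> and \<open>m *s v\<close>. With \<open>w\<close>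
  independent of \<open>v\<close>, directions with values \<open>k *s w\<close> and
  \<open>m *s w\<close> plus arbitrary multiples of \<open>v\<close> are tangent, and these
  multiples can be chosen to leave the quadric.\<close>

lemma ruled_tangent:
  assumes x: "x \<noteq> 0" "ruled X Y x = 0"
  obtains y where "ruled X Y y \<noteq> 0" "dot (ruled_polar X Y x) y = 0"
proof -
  have "\<exists>v k m. v \<noteq> (0 :: complex^2) \<and> (k \<noteq> 0 \<or> m \<noteq> 0) \<and> hpair (dot (X 0) x) (dot (X 1) x) = k *s v \<and>
      hpair (dot (Y 0) x) (dot (Y 1) x) = m *s v"
  proof (cases "hpair (dot (X 0) x) (dot (X 1) x) = 0")
    case True
    have "hpair (dot (Y 0) x) (dot (Y 1) x) \<noteq> 0"
      using True ruled_indep[of x] x(1) by (auto simp: vec2_eq_iff)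
    then show ?thesis using True
      by (intro exI[of _ "hpair (dot (Y 0) x) (dot (Y 1) x)"] exI[of _ 0] exI[of _ 1]) simp
  next
    case False
    obtain m where "hpair (dot (Y 0) x) (dot (Y 1) x) = m *s hpair (dot (X 0) x) (dot (X 1) x)"
      using parallel_2[OF False, of "hpair (dot (Y 0) x) (dot (Y 1) x)"] x(2) by (auto simp: ruled_def)
    then show ?thesis using False
      by (intro exI[of _ "hpair (dot (X 0) x) (dot (X 1) x)"] exI[of _ 1] exI[of _ m]) simp
  qed
  then obtain v :: "complex^2" and k m where v: "v \<noteq> 0" "k \<noteq> 0 \<or> m \<noteq> 0"
    "hpair (dot (X 0) x) (dot (X 1) x) = k *s v" "hpair (dot (Y 0) x) (dot (Y 1) x) = m *s v" by blast
  have xv: "dot (X 0) x = k * v $ 0" "dot (X 1) x = k * v $ 1" "dot (Y 0) x = m * v $ 0" "dot (Y 1) x = m * v $ 1"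
    using v(3,4) by (simp_all add: vec2_eq_iff)
  obtain w :: "complex^2" where w: "v $ 0 * w $ 1 \<noteq> v $ 1 * w $ 0" using ex_other_vec[OF v(1)] by blast
  \<comment> \<open>Chosen so that \<open>p * m - k * r\<close> is nonzero: it equals
    \<open>m\<close> if \<open>m\<close> is nonzero and \<open>- k\<close> otherwise.\<close>
  define p r where "p = (if m = 0 then 0 else 1 :: complex)" "r = (if m = 0 then 1 else 0 :: complex)"
  obtain y where y: "dot (X 0) y = p * v $ 0 + k * w $ 0" "dot (X 1) y = p * v $ 1 + k * w $ 1"
    "dot (Y 0) y = r * v $ 0 + m * w $ 0" "dot (Y 1) y = r * v $ 1 + m * w $ 1" by (rule ruled_dual)
  have "dot (ruled_polar X Y x) y = 0"
    by (simp add: ruled_polar_def dot_add dot_diff dot_scale xv y algebra_simps)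
  moreover have "ruled X Y y = (p * m - k * r) * (v $ 0 * w $ 1 - v $ 1 * w $ 0)"
    by (simp add: ruled_def y algebra_simps)
  moreover have "p * m - k * r \<noteq> 0" using v(2) by (auto simp: p_r_def)
  ultimately show ?thesis using w by (intro that[of y]) simp_all
qed

end

subsection \<open>The blow-up of the base curve\<close>

lemma axis_form_same:
  "axis_form a b a t P = 0"
  "axis_form a b b t Q = (t $ 0 * Q $ 1 - t $ 1 * Q $ 0) * dot (a 1) (wedge (a 0) (b 0) (b 1))"
  by (simp_all add: axis_form_bilinear sum_type_2 wedge_same dot_wedge_self
      wedge_swap[of "a 0" "b 1" "b 0"] dot_minus algebra_simps)

lemma poly_eq_off_zero:
  fixes p q :: "complex poly"
  assumes "\<And>z. z \<notin> S \<Longrightarrow> poly p z = poly q z" "finite S"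
  shows "p = q"
proof (rule ccontr)
  assume "p \<noteq> q"
  then have "finite {z. poly (p - q) z = 0}" by (intro poly_roots_finite) simp
  then have "finite ({z. poly (p - q) z = 0} \<union> S)" using assms(2) by simp
  from ex_not_in_finite[OF this] obtain z where "poly (p - q) z \<noteq> 0" "z \<notin> S" by blast
  then show False using assms(1)[of z] by simp
qed

lemma meet_poly_funs: "(\<lambda>v. meet a b c v $ m) \<in> poly_funs coords3"
proof -
  have co: "(\<lambda>(s, t, u). s $ i) \<in> poly_funs coords3" "(\<lambda>(s, t, u). t $ i) \<in> poly_funs coords3"
    "(\<lambda>(s, t, u). u $ i) \<in> poly_funs coords3" for i by (rule poly_funs_coord3)+
  have "(\<lambda>v. meet a b c v $ m) = (\<lambda>v. \<Sum>i\<in>UNIV. \<Sum>j\<in>UNIV. \<Sum>k\<in>UNIV.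
      (wedge (a i) (b j) (c k) $ m) * (\<lambda>(s, t, u). s $ i) v * (\<lambda>(s, t, u). t $ j) v * (\<lambda>(s, t, u). u $ k) v)"
  proof
    fix v :: vec_3
    obtain s t u where v: "v = (s, t, u)" by (cases v) auto
    show "meet a b c v $ m = (\<Sum>i\<in>UNIV. \<Sum>j\<in>UNIV. \<Sum>k\<in>UNIV.
      (wedge (a i) (b j) (c k) $ m) * (\<lambda>(s, t, u). s $ i) v * (\<lambda>(s, t, u). t $ j) v * (\<lambda>(s, t, u). u $ k) v)"
      unfolding v by (simp add: meet_def lc_def wedge_add wedge_scale sum_type_2 algebra_simps)
  qed
  also have "\<dots> \<in> poly_funs coords3"
    by (intro poly_funs_sum poly_funs.mult poly_funs.const co)
  finally show ?thesis .
qed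

text \<open>Incidence of \<open>x\<close> with a plane of a pencil is an equation on the ambient
  space of the graph; it holds on the graph and hence on its closure.\<close>

lemma lc_formsG:
  "(\<lambda>((s, t, u), x). dot (lc a s) x) \<in> formsG 1 0 0 1"
  "(\<lambda>((s, t, u), x). dot (lc a t) x) \<in> formsG 0 1 0 1"
  "(\<lambda>((s, t, u), x). dot (lc a u) x) \<in> formsG 0 0 1 1"
proof -
  have d: "(\<lambda>(v, x). dot w x) \<in> poly_funs coordsG" for w
    using poly_funs_coordG'[of "dot w"] dot_forms[of w] by (simp add: forms_def)
  note co = poly_funs_coord3[THEN poly_funs_coordG]
  have P: "(\<lambda>y. (\<lambda>(v, x). f v) y * (\<lambda>(v, x). dot (a 0) x) y + (\<lambda>(v, x). g v) y * (\<lambda>(v, x). dot (a 1) x) y) \<in> poly_funs coordsG"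
    if "f \<in> poly_funs coords3" "g \<in> poly_funs coords3" for f g
    by (intro poly_funs.add poly_funs.mult d poly_funs_coordG that)
  have "(\<lambda>((s, t, u), x). dot (lc a s) x) \<in> poly_funs coordsG"
    using P[OF poly_funs_coord3(1)[of 0] poly_funs_coord3(1)[of 1]]
    by (simp add: lc_def dot_add dot_scale case_prod_unfold)
  then show "(\<lambda>((s, t, u), x). dot (lc a s) x) \<in> formsG 1 0 0 1"
    by (simp add: formsG_def lc_scale dot_scale)
  have "(\<lambda>((s, t, u), x). dot (lc a t) x) \<in> poly_funs coordsG"
    using P[OF poly_funs_coord3(2)[of 0] poly_funs_coord3(2)[of 1]]
    by (simp add: lc_def dot_add dot_scale case_prod_unfold)
  then show "(\<lambda>((s, t, u), x). dot (lc a t) x) \<in> formsG 0 1 0 1"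
    by (simp add: formsG_def lc_scale dot_scale)
  have "(\<lambda>((s, t, u), x). dot (lc a u) x) \<in> poly_funs coordsG"
    using P[OF poly_funs_coord3(3)[of 0] poly_funs_coord3(3)[of 1]]
    by (simp add: lc_def dot_add dot_scale case_prod_unfold)
  then show "(\<lambda>((s, t, u), x). dot (lc a u) x) \<in> formsG 0 0 1 1"
    by (simp add: formsG_def lc_scale dot_scale)
qed

lemma dot_lc_zero_param:
  assumes "s \<noteq> 0" "dot (lc a s) x = 0"
  shows "\<exists>k. param a x = k *s s"
proof (rule parallel_2[OF assms(1)])
  show "s $ 0 * param a x $ 1 = s $ 1 * param a x $ 0"
    using assms(2) by (simp add: lc_def dot_add dot_scale param_def add_eq_0_iff)
qed

lemma quad_zero_on_axis:
  assumes "param a x = 0 \<or> param b x = 0 \<or> param c x = 0"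
  shows "quad a b c x = 0"
proof -
  have "meet a b c (param a x, param b x, param c x) = 0" using assms by (auto simp: meet_def lc_def)
  then have "quad a b c x = 0 \<or> x = 0" by (simp add: meet_param_quad)
  then show ?thesis by (auto simp: quad_def axis_form_def param_def lc_def)
qed

lemma param_add_scale: "param a (x + z *s y) = param a x + z *s param a y"
  by (simp add: param_def vec2_eq_iff dot_add dot_scale)

lemma skew_vectors:
  assumes "axis_line a \<inter> axis_line b = {}" "\<And>i. dot (a i) x = 0" "\<And>i. dot (b i) x = 0"
  shows "x = 0"
  using assms in_axis_line[of x a] in_axis_line[of x b] by blast

context pencils
begin

lemma quad_nonzero: "\<exists>x. quad a b c x \<noteq> 0"
proof -
  obtain p q r where *: "axis_form a b c (rep q) (rep r) \<noteq> 0" "axis_form b c a (rep r) (rep p) \<noteq> 0"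
    "axis_form c a b (rep p) (rep q) \<noteq> 0" using axis_form_product_nonzero by blast
  define s t u where "s = rep p" "t = rep q" "u = rep r"
  define A B C where "A = - axis_form a b c t u" "B = - axis_form b c a u s" "C = - axis_form c a b s t"
  have ABC: "A \<noteq> 0" "B \<noteq> 0" "C \<noteq> 0" using * by (simp_all add: s_t_u_def A_B_C_def)
  define x where "x = meet a b c (s, t, u)"
  have "x \<noteq> 0" using ABC(1) meet_zero_iff[of s t u] by (simp add: x_def A_B_C_def s_t_u_def)
  have par: "param a x = A *s s" "param b x = B *s t" "param c x = C *s u"
    using param_meet[of a b c s t u] param_meet[of b c a t u s] param_meet[of c a b u s t]
    by (simp_all only: x_def A_B_C_def meet_rotate[of b c a] meet_rotate[of c a b])
  have "quad a b c x *s x = (A * B * C) *s x"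
    using meet_param_quad[of a b c x] unfolding par meet_scale x_def[symmetric] by (rule sym)
  then have "quad a b c x \<noteq> 0" using \<open>x \<noteq> 0\<close> ABC by simp
  then show ?thesis ..
qed

text \<open>As the axes of \<open>a\<close> and \<open>b\<close> are skew, each \<open>c i\<close>
  splits into a part \<open>X i\<close> from the pencil \<open>a\<close> and a part
  \<open>Y i\<close> from \<open>b\<close>. Skewness to the axis of \<open>c\<close> makes these
  parts bases of the two pencils. The three axes become those of \<open>X\<close>, \<open>Y\<close>
  and \<open>X + Y\<close>.\<close>

lemma quad_coordinates:
  assumes ab: "axis_line a \<inter> axis_line b = {}" and ac: "axis_line a \<inter> axis_line c = {}"
    and bc: "axis_line b \<inter> axis_line c = {}"
  obtains X Y :: "2 \<Rightarrow> complex^4" and \<kappa> where "\<kappa> \<noteq> 0" "\<And>x. quad a b c x = \<kappa> * ruled X Y x"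
    "\<And>x. (\<And>i. dot (X i) x = 0) \<Longrightarrow> (\<And>i. dot (Y i) x = 0) \<Longrightarrow> x = 0"
    "\<And>x. param a x = 0 \<longleftrightarrow> dot (X 0) x = 0 \<and> dot (X 1) x = 0"
    "\<And>x. param b x = 0 \<longleftrightarrow> dot (Y 0) x = 0 \<and> dot (Y 1) x = 0"
    "\<And>x. param c x = 0 \<longleftrightarrow> dot (X 0) x + dot (Y 0) x = 0 \<and> dot (X 1) x + dot (Y 1) x = 0"
proof -
  obtain p0 q0 where pq0: "c 0 = lc a p0 + lc b q0"
    using span_of_two_pencils[of a b "c 0"] skew_vectors[OF ab] by blast
  obtain p1 q1 where pq1: "c 1 = lc a p1 + lc b q1"
    using span_of_two_pencils[of a b "c 1"] skew_vectors[OF ab] by blast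
  define X where "X i = (if i = 0 then lc a p0 else lc a p1)" for i :: 2
  define Y where "Y i = (if i = 0 then lc b q0 else lc b q1)" for i :: 2
  define \<kappa> where "\<kappa> = dot (a 1) (wedge (a 0) (b 0) (b 1))"
  have XY: "X 0 = lc a p0" "X 1 = lc a p1" "Y 0 = lc b q0" "Y 1 = lc b q1" by (simp_all add: X_def Y_def)
  have c: "c 0 = X 0 + Y 0" "c 1 = X 1 + Y 1" by (simp_all add: XY pq0 pq1)
  have Q: "quad a b c x = \<kappa> * ruled X Y x" for x
  proof -
    define u where "u = param c x"
    define P where "P = u $ 0 *s p0 + u $ 1 *s p1"
    define R where "R = u $ 0 *s q0 + u $ 1 *s q1"
    have "lc c u = lc a P + lc b R"
      by (simp add: lc_def[of c] c XY P_def R_def lc_add lc_scale vec_eq_iff algebra_simps)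
    then have "axis_form a b c (param b x) u = axis_form a b a (param b x) P + axis_form a b b (param b x) R"
      by (simp add: axis_form_def wedge_add dot_add)
    also have "\<dots> = (param b x $ 0 * R $ 1 - param b x $ 1 * R $ 0) * \<kappa>"
      by (simp add: axis_form_same \<kappa>_def)
    also have "param b x $ 0 * R $ 1 - param b x $ 1 * R $ 0 = - dot (lc b R) x"
      by (simp add: param_def lc_def dot_add dot_scale algebra_simps)
    also have "lc b R = u $ 0 *s Y 0 + u $ 1 *s Y 1"
      by (simp add: R_def XY lc_add lc_scale)
    finally have "quad a b c x = \<kappa> * dot (u $ 0 *s Y 0 + u $ 1 *s Y 1) x"
      by (simp add: quad_def u_def)
    also have "dot (u $ 0 *s Y 0 + u $ 1 *s Y 1) x = ruled X Y x"
      by (simp add: u_def param_def c dot_add dot_diff dot_scale ruled_def algebra_simps)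
    finally show ?thesis .
  qed
  have \<kappa>0: "\<kappa> \<noteq> 0" using quad_nonzero Q by auto
  \<comment> \<open>Replace \<open>x\<close> by a vector \<open>y\<close> with the same values on
    \<open>a\<close> and zero values on \<open>b\<close>; on it \<open>c\<close> agrees with
    \<open>X\<close>, so it lies on the axes of \<open>b\<close> and \<open>c\<close> and is
    zero.\<close>
  have a0: "dot (a i) x = 0" if "dot (X 0) x = 0" "dot (X 1) x = 0" for x i
  proof -
    have "\<exists>y. (\<forall>i. dot (a i) y = hpair (dot (a 0) x) (dot (a 1) x) $ i) \<and> (\<forall>i. dot (b i) y = (0 :: complex^2) $ i)"
      by (rule dual_vector) (rule skew_vectors[OF ab])
    then obtain y where y: "\<forall>i. dot (a i) y = hpair (dot (a 0) x) (dot (a 1) x) $ i" "\<forall>i. dot (b i) y = 0" by auto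
    then have ya: "dot (a 0) y = dot (a 0) x" "dot (a 1) y = dot (a 1) x" unfolding all_type_2 by simp_all
    have "dot (X 0) y = dot (X 0) x" "dot (X 1) y = dot (X 1) x" "dot (Y 0) y = 0" "dot (Y 1) y = 0"
      using y(2) ya by (simp_all add: XY lc_def dot_add dot_scale)
    then have cy: "dot (c 0) y = 0" "dot (c 1) y = 0" using that by (simp_all add: c dot_add)
    have "y = 0"
    proof (rule skew_vectors[OF bc])
      show "dot (b i) y = 0" for i using y(2) by simp
      show "dot (c i) y = 0" for i using type_2_cases[of i] cy by (elim disjE) simp_all
    qed
    then show ?thesis using ya type_2_cases[of i] by (elim disjE) simp_all
  qed
  have b0: "dot (b i) x = 0" if "dot (Y 0) x = 0" "dot (Y 1) x = 0" for x i
  proof -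
    have "\<exists>y. (\<forall>i. dot (a i) y = (0 :: complex^2) $ i) \<and> (\<forall>i. dot (b i) y = hpair (dot (b 0) x) (dot (b 1) x) $ i)"
      by (rule dual_vector) (rule skew_vectors[OF ab])
    then obtain y where y: "\<forall>i. dot (b i) y = hpair (dot (b 0) x) (dot (b 1) x) $ i" "\<forall>i. dot (a i) y = 0" by auto
    then have yb: "dot (b 0) y = dot (b 0) x" "dot (b 1) y = dot (b 1) x" unfolding all_type_2 by simp_all
    have "dot (Y 0) y = dot (Y 0) x" "dot (Y 1) y = dot (Y 1) x" "dot (X 0) y = 0" "dot (X 1) y = 0"
      using y(2) yb by (simp_all add: XY lc_def dot_add dot_scale)
    then have cy: "dot (c 0) y = 0" "dot (c 1) y = 0" using that by (simp_all add: c dot_add)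
    have "y = 0"
    proof (rule skew_vectors[OF ac])
      show "dot (a i) y = 0" for i using y(2) by simp
      show "dot (c i) y = 0" for i using type_2_cases[of i] cy by (elim disjE) simp_all
    qed
    then show ?thesis using yb type_2_cases[of i] by (elim disjE) simp_all
  qed
  show ?thesis
  proof (rule that[OF \<kappa>0 Q])
    show "x = 0" if "\<And>i. dot (X i) x = 0" "\<And>i. dot (Y i) x = 0" for x
      using skew_vectors[OF ab, of x] a0[of x] b0[of x] that by blast
    show "param a x = 0 \<longleftrightarrow> dot (X 0) x = 0 \<and> dot (X 1) x = 0" for x
    proof
      assume "param a x = 0"
      then show "dot (X 0) x = 0 \<and> dot (X 1) x = 0" by (simp add: param_eq_0 XY lc_def dot_add dot_scale)
    next
      assume "dot (X 0) x = 0 \<and> dot (X 1) x = 0"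
      then show "param a x = 0" using a0[of x 0] a0[of x 1] by (simp add: param_eq_0)
    qed
    show "param b x = 0 \<longleftrightarrow> dot (Y 0) x = 0 \<and> dot (Y 1) x = 0" for x
    proof
      assume "param b x = 0"
      then show "dot (Y 0) x = 0 \<and> dot (Y 1) x = 0" by (simp add: param_eq_0 XY lc_def dot_add dot_scale)
    next
      assume "dot (Y 0) x = 0 \<and> dot (Y 1) x = 0"
      then show "param b x = 0" using b0[of x 0] b0[of x 1] by (simp add: param_eq_0)
    qed
    show "param c x = 0 \<longleftrightarrow> dot (X 0) x + dot (Y 0) x = 0 \<and> dot (X 1) x + dot (Y 1) x = 0" for x
      by (simp add: param_eq_0 c dot_add)
  qed
qed

text \<open>The incidences force the parameters of \<open>x\<close> to be multiples, possibly zero,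
  of the coordinates of \<open>p\<close>; hence \<open>quad\<close> times \<open>x\<close> is a
  multiple of the meet at \<open>p\<close>, which is zero.\<close>

lemma closure_graph_quad:
  assumes p: "p \<in> base_curve" and px: "(p, x) \<in> zariskiG closure_of (graph_of (meet a b c))"
  shows "quad a b c (rep x) = 0"
proof -
  obtain p1 p2 p3 where p': "p = (p1, p2, p3)" by (cases p) auto
  have F: "F ((rep p1, rep p2, rep p3), rep x) = 0"
    if "F \<in> formsG i j k l" "\<And>s t u. F ((s, t, u), meet a b c (s, t, u)) = 0" for F i j k l
  proof -
    have "F (repG y) = 0" if y: "y \<in> graph_of (meet a b c)" for y
    proof -
      obtain q where q: "y = (q, rmap (meet a b c) q)" "q \<notin> base_locus (meet a b c)"
        using y by (auto simp: graph_of_def)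
      then have "meet a b c (rep3 q) \<noteq> 0" by (simp add: base_locus_def)
      from formsG_pt[OF \<open>F \<in> formsG i j k l\<close> nz3_rep3[of q] this]
      have "F (repG y) = 0 \<longleftrightarrow> F (rep3 q, meet a b c (rep3 q)) = 0" by (simp add: q(1) rmap_def)
      moreover obtain s t u where "rep3 q = (s, t, u)" by (cases "rep3 q") auto
      ultimately show ?thesis using \<open>\<And>s t u. F ((s, t, u), meet a b c (s, t, u)) = 0\<close> by simp
    qed
    then have "F (repG (p, x)) = 0" using px \<open>F \<in> formsG i j k l\<close> unfolding closure_zariskiG by blast
    then show ?thesis by (simp add: p')
  qed
  have d: "dot (lc a (rep p1)) (rep x) = 0" "dot (lc b (rep p2)) (rep x) = 0" "dot (lc c (rep p3)) (rep x) = 0"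
    using F[OF lc_formsG(1)[of a]] F[OF lc_formsG(2)[of b]] F[OF lc_formsG(3)[of c]]
    by (simp_all add: meet_def dot_wedge_self)
  obtain k l m where "param a (rep x) = k *s rep p1" "param b (rep x) = l *s rep p2" "param c (rep x) = m *s rep p3"
    using dot_lc_zero_param[OF rep_nonzero d(1)] dot_lc_zero_param[OF rep_nonzero d(2)]
      dot_lc_zero_param[OF rep_nonzero d(3)] by blast
  then have "quad a b c (rep x) *s rep x = (k * l * m) *s meet a b c (rep p1, rep p2, rep p3)"
    unfolding meet_param_quad[symmetric] by (simp only: meet_scale)
  also have "\<dots> = 0" using p by (simp add: p' base_curve_def)
  finally show ?thesis by simp
qed

text \<open>Along \<open>x + z *s y\<close> the composite is multiplication by a nonzero constant
  times \<open>z ^ 2\<close>. The parameters, freed from common factors \<open>z\<close>, form a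
  line in the product whose point at 0 is a base point, and the images along it tend to
  \<open>x\<close>.\<close>

lemma quad_in_closure_graph:
  assumes x: "x \<noteq> 0" "quad a b c x = 0"
    and one: "param a x = 0 \<Longrightarrow> param b x \<noteq> 0" "param a x = 0 \<Longrightarrow> param c x \<noteq> 0" "param b x = 0 \<Longrightarrow> param c x \<noteq> 0"
    and y: "quad a b c y \<noteq> 0" "\<And>z. quad a b c (x + z *s y) = z ^ 2 * quad a b c y"
  shows "\<exists>p\<in>base_curve. (p, pt x) \<in> zariskiG closure_of (graph_of (meet a b c))"
proof -
  have py: "param a y \<noteq> 0" "param b y \<noteq> 0" "param c y \<noteq> 0"
    using y(1) quad_zero_on_axis[of a y b c] by blast+
  \<comment> \<open>If \<open>x\<close> lies on the axis of \<open>d\<close>, its parameter pair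
    vanishes and the pair along the line is \<open>z\<close> times a constant one. This factor is
    removed and counted by \<open>e\<close>.\<close>
  define V where "V d = (if param d x = 0 then param d y else param d x)" for d
  define W where "W d = (if param d x = 0 then 0 else param d y)" for d
  define e where "e d = (if param d x = 0 then 1 else 0 :: nat)" for d
  have VW: "param d (x + z *s y) = (z ^ e d) *s (V d + z *s W d)" for d z
    by (simp add: V_def W_def e_def param_add_scale)
  define v where "v = (V a, V b, V c)"
  define w where "w = (W a, W b, W c)"
  have nzv: "nz3 v" using py by (simp add: v_def V_def)
  \<comment> \<open>The point lies on at most one axis, so at most one of the two factors
    \<open>z\<close> is used up and \<open>Suc n\<close> of them remain.\<close>
  have "e a + e b + e c \<le> 1" using one by (auto simp: e_def)
  then obtain n where n: "e a + e b + e c + Suc n = 2" by (metis add_Suc_right le_add_diff_inverse one_add_one plus_1_eq_Suc)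
  have meet: "meet a b c (line3 v w z) = (z * z ^ n * quad a b c y) *s (x + z *s y)" if z: "z \<noteq> 0" for z
  proof -
    have "z ^ (e a + e b + e c) *s meet a b c (line3 v w z) = quad a b c (x + z *s y) *s (x + z *s y)"
      unfolding meet_param_quad[symmetric] VW meet_scale by (simp add: v_def w_def power_add)
    also have "\<dots> = (z ^ (e a + e b + e c)) *s ((z * z ^ n * quad a b c y) *s (x + z *s y))"
      unfolding y(2) n[symmetric] by (simp only: power_add power_Suc vector_smult_assoc mult_ac)
    finally show ?thesis using z by (simp only: vector_mul_lcancel power_not_zero if_False) simp
  qed
  \<comment> \<open>The formula for the meet extends to \<open>z = 0\<close> as an identity of
    polynomials, and the remaining factor \<open>z\<close> makes it vanish there.\<close>
  have mono: "meet a b c v = 0"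
  proof -
    have "meet a b c v $ m = 0" for m
    proof -
      obtain P where P: "\<And>z. meet a b c (line3 v w z) $ m = poly P z"
        using poly_on_line3[OF meet_poly_funs[of a b c m]] by blast
      define R where "R = [:0, 1:] * ([:0, 1:] ^ n * ([:quad a b c y:] * [:x $ m, y $ m:]))"
      have R: "poly R z = z * z ^ n * quad a b c y * (x $ m + z * y $ m)" for z
        by (simp add: R_def poly_power) (simp add: algebra_simps)
      have "P = R"
      proof (rule poly_eq_off_zero[of "{0}"])
        fix z :: complex assume "z \<notin> {0}"
        then show "poly P z = poly R z" using meet[of z] by (simp add: R algebra_simps flip: P)
      qed simp
      then have "poly P 0 = 0" using R[of 0] by simp
      then show ?thesis using P[of 0] by simp
    qed
    then show ?thesis by (simp add: vec_eq_iff)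
  qed
  then have "pt3 v \<in> base_curve" using pt3_in_base_curve[OF nzv] by simp
  moreover have "(pt3 v, pt x) \<in> zariskiG closure_of (graph_of (meet a b c))"
    unfolding closure_zariskiG
  proof (intro allI impI)
    fix F assume F: "(\<exists>i j k l. F \<in> formsG i j k l) \<and> (\<forall>p\<in>graph_of (meet a b c). F (repG p) = 0)"
    then obtain i j k l where Fi: "F \<in> formsG i j k l" by blast
    then have "F \<in> poly_funs coordsG" by (simp add: formsG_def)
    then obtain P where P: "\<And>z. F (line3 v w z, x + z *s y) = poly P z"
      using poly_on_lineG[of F v w x y] by blast
    \<comment> \<open>The form vanishes at graph points for almost all \<open>z\<close>, hence as a
      polynomial, hence also at \<open>z = 0\<close>.\<close>
    have "P = 0"
    proof (rule poly_eq_off_zero[of "{0} \<union> {z. \<not> nz3 (line3 v w z)} \<union> {z. x + z *s y = 0}"])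
      show "finite ({0} \<union> {z. \<not> nz3 (line3 v w z)} \<union> {z. x + z *s y = 0})"
        using finite_not_nz3_line[of v w 0] nzv finite_affine_vec_zeros[of x 0 y] x(1) by simp
      fix z assume "z \<notin> {0} \<union> {z. \<not> nz3 (line3 v w z)} \<union> {z. x + z *s y = 0}"
      then have z: "z \<noteq> 0" "nz3 (line3 v w z)" "x + z *s y \<noteq> 0" by auto
      have k: "z * z ^ n * quad a b c y \<noteq> 0" using z(1) y(1) by simp
      obtain s t u where stu: "line3 v w z = (s, t, u)" by (cases "line3 v w z") auto
      have nz: "meet a b c (line3 v w z) \<noteq> 0" unfolding meet[OF z(1)] vector_mul_eq_0 using k z(3) by blast
      have pt_eq: "pt (meet a b c (line3 v w z)) = pt (x + z *s y)" unfolding meet[OF z(1)] by (rule pt_scale[OF k z(3)])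
      have g: "rmap (meet a b c) (pt3 (line3 v w z)) = pt (meet a b c (line3 v w z)) \<and>
          pt3 (line3 v w z) \<notin> base_locus (meet a b c)"
        using rmap_meet_pt3[of s t u] z(2) nz unfolding stu by blast
      have "rmap (meet a b c) (pt3 (line3 v w z)) = pt (x + z *s y)"
        using g pt_eq by (simp only:)
      moreover have "pt3 (line3 v w z) \<notin> base_locus (meet a b c)"
        using g by blast
      ultimately have "(pt3 (line3 v w z), pt (x + z *s y)) \<in> graph_of (meet a b c)"
        unfolding graph_of_def by (intro CollectI exI[of _ "pt3 (line3 v w z)"]) simp
      then have "F (repG (pt3 (line3 v w z), pt (x + z *s y))) = 0" using F by blast
      then show "poly P z = poly 0 z" using formsG_pt[OF Fi z(2,3)] by (simp flip: P)
    qed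
    then have "F (v, x) = 0" using P[of 0] by simp
    then show "F (repG (pt3 v, pt x)) = 0" using formsG_pt[OF Fi nzv x(1)] by simp
  qed
  ultimately show ?thesis by blast
qed

lemma blows_up_quadric:
  assumes ab: "axis_line a \<inter> axis_line b = {}" and ac: "axis_line a \<inter> axis_line c = {}"
    and bc: "axis_line b \<inter> axis_line c = {}"
  shows "\<exists>Q. smooth_surface_of_degree 2 Q \<and>
    (\<forall>Q'. is_quadric Q' \<and> axis_line a \<union> axis_line b \<union> axis_line c \<subseteq> Q' \<longleftrightarrow> Q' = Q) \<and>
    blows_up_to (meet a b c) base_curve Q"
proof (rule quad_coordinates[OF ab ac bc])
  fix X Y :: "2 \<Rightarrow> complex^4" and \<kappa> :: complex
  assume \<kappa>: "\<kappa> \<noteq> 0" and Q: "\<And>x. quad a b c x = \<kappa> * ruled X Y x"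
    and indep: "\<And>x. (\<And>i. dot (X i) x = 0) \<Longrightarrow> (\<And>i. dot (Y i) x = 0) \<Longrightarrow> x = 0"
    and a: "\<And>x. param a x = 0 \<longleftrightarrow> dot (X 0) x = 0 \<and> dot (X 1) x = 0"
    and b: "\<And>x. param b x = 0 \<longleftrightarrow> dot (Y 0) x = 0 \<and> dot (Y 1) x = 0"
    and c: "\<And>x. param c x = 0 \<longleftrightarrow> dot (X 0) x + dot (Y 0) x = 0 \<and> dot (X 1) x + dot (Y 1) x = 0"
  have axis: "p \<in> axis_line d \<longleftrightarrow> param d (rep p) = 0" for p d by (simp add: axis_line_def param_eq_0)
  have Qz: "p \<in> zeros (ruled X Y) \<longleftrightarrow> quad a b c (rep p) = 0" for p using \<kappa> by (simp add: zeros_def Q)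
  have "is_quadric Q' \<and> axis_line a \<union> axis_line b \<union> axis_line c \<subseteq> Q' \<longleftrightarrow> Q' = zeros (ruled X Y)" for Q'
  proof
    assume "is_quadric Q' \<and> axis_line a \<union> axis_line b \<union> axis_line c \<subseteq> Q'"
    then obtain f where f: "f \<in> forms 2" "f \<noteq> (\<lambda>_. 0)" "Q' = zeros f"
      and sub: "axis_line a \<subseteq> Q'" "axis_line b \<subseteq> Q'" "axis_line c \<subseteq> Q'" by (auto simp: is_quadric_def)
    have f0: "f x = 0" if "axis_line d \<subseteq> Q'" "param d x = 0" for x d
    proof (cases "x = 0")
      case True
      have "f (0 *s x) = 0 ^ 2 * f x" using f(1) unfolding forms_def mem_Collect_eq by blast
      then show ?thesis using True by simp
    next
      case False
      then have "pt x \<in> axis_line d" using in_axis_line[of x d] that(2) by (simp add: param_eq_0)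
      then have "f (rep (pt x)) = 0" using that(1) by (auto simp: f(3) zeros_def)
      then show ?thesis using forms_pt[OF f(1) False] by simp
    qed
    have fX: "f x = 0" if "dot (X 0) x = 0" "dot (X 1) x = 0" for x
      by (rule f0[OF sub(1)]) (simp add: a that)
    have fY: "f x = 0" if "dot (Y 0) x = 0" "dot (Y 1) x = 0" for x
      by (rule f0[OF sub(2)]) (simp add: b that)
    have fXY: "f x = 0" if "dot (X 0) x + dot (Y 0) x = 0" "dot (X 1) x + dot (Y 1) x = 0" for x
      by (rule f0[OF sub(3)]) (simp add: c that)
    obtain K where K: "\<And>x. f x = K * ruled X Y x"
      using quadric_through_lines[OF indep f(1) fX fY fXY] by blast
    have "K \<noteq> 0" using f(2) K by auto
    then show "Q' = zeros (ruled X Y)" unfolding f(3) zeros_def K by simp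
  next
    assume Q': "Q' = zeros (ruled X Y)"
    obtain x where "quad a b c x \<noteq> 0" using quad_nonzero by blast
    then have "ruled X Y x \<noteq> 0" by (simp add: Q)
    then have "ruled X Y \<noteq> (\<lambda>_. 0)" by (metis (no_types))
    then have "is_quadric Q'" unfolding is_quadric_def Q' using ruled_forms by blast
    moreover have "axis_line a \<union> axis_line b \<union> axis_line c \<subseteq> Q'"
    proof
      fix p assume "p \<in> axis_line a \<union> axis_line b \<union> axis_line c"
      then have "param a (rep p) = 0 \<or> param b (rep p) = 0 \<or> param c (rep p) = 0" by (simp add: axis disj_assoc)
      then show "p \<in> Q'" unfolding Q' Qz by (rule quad_zero_on_axis)
    qed
    ultimately show "is_quadric Q' \<and> axis_line a \<union> axis_line b \<union> axis_line c \<subseteq> Q'" ..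
  qed
  moreover have "blows_up_to (meet a b c) base_curve (zeros (ruled X Y))"
    unfolding blows_up_to_def
  proof
    show "base_curve \<subseteq> base_locus (meet a b c)" by (simp add: base_curve_def base_locus_def)
    show "zeros (ruled X Y) = {x. \<exists>p\<in>base_curve. (p, x) \<in> zariskiG closure_of graph_of (meet a b c)}"
    proof (intro equalityI subsetI)
      fix x assume "x \<in> {x. \<exists>p\<in>base_curve. (p, x) \<in> zariskiG closure_of graph_of (meet a b c)}"
      then show "x \<in> zeros (ruled X Y)" unfolding Qz using closure_graph_quad by blast
    next
      fix x assume x: "x \<in> zeros (ruled X Y)"
      then have x0: "ruled X Y (rep x) = 0" by (simp add: zeros_def)
      obtain y where y: "ruled X Y y \<noteq> 0" "dot (ruled_polar X Y (rep x)) y = 0"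
        using ruled_tangent[OF indep rep_nonzero x0] by blast
      have "\<exists>p\<in>base_curve. (p, pt (rep x)) \<in> zariskiG closure_of (graph_of (meet a b c))"
      proof (rule quad_in_closure_graph[OF rep_nonzero])
        show "quad a b c (rep x) = 0" by (simp add: Q x0)
        show "param b (rep x) \<noteq> 0" if "param a (rep x) = 0" using that ab axis by blast
        show "param c (rep x) \<noteq> 0" if "param a (rep x) = 0" using that ac axis by blast
        show "param c (rep x) \<noteq> 0" if "param b (rep x) = 0" using that bc axis by blast
        show "quad a b c y \<noteq> 0" using \<kappa> y(1) by (simp add: Q)
        show "quad a b c (rep x + z *s y) = z ^ 2 * quad a b c y" for z
          by (simp add: Q ruled_line x0 y(2))
      qed
      then show "x \<in> {x. \<exists>p\<in>base_curve. (p, x) \<in> zariskiG closure_of graph_of (meet a b c)}" by simp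
    qed
  qed
  moreover have "smooth_surface_of_degree 2 (zeros (ruled X Y))" by (rule smooth_ruled) (rule indep)
  ultimately show ?thesis by (intro exI[of _ "zeros (ruled X Y)"]) blast
qed

end

subsection \<open>Cyclic symmetry of the contractions\<close>

lemma rimage_meet_rotate: "rimage (meet a b c) (rot3 -` V) = rimage (meet b c a) V"
proof -
  have m: "meet b c a (rep3 (rot3 x)) = meet a b c (rep3 x)" for x
    by (cases x) (simp add: meet_rotate)
  have bl: "rot3 x \<in> base_locus (meet b c a) \<longleftrightarrow> x \<in> base_locus (meet a b c)" for x
    by (simp add: base_locus_def m)
  have "rimage (meet a b c) (rot3 -` V) = rmap (meet b c a) ` rot3 ` (rot3 -` V - base_locus (meet a b c))"
    unfolding rimage_def image_image by (simp add: rmap_def m)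
  also have "rot3 ` (rot3 -` V - base_locus (meet a b c)) = V - base_locus (meet b c a)"
  proof (intro equalityI subsetI)
    fix y assume "y \<in> V - base_locus (meet b c a)"
    then show "y \<in> rot3 ` (rot3 -` V - base_locus (meet a b c))"
      using bl[of "rot3 (rot3 y)"] by (intro image_eqI[of _ _ "rot3 (rot3 y)"]) auto
  next
    fix y assume "y \<in> rot3 ` (rot3 -` V - base_locus (meet a b c))"
    then obtain x where x: "y = rot3 x" "rot3 x \<in> V" "x \<notin> base_locus (meet a b c)" by blast
    then show "y \<in> V - base_locus (meet b c a)" unfolding x(1) using bl[of x] by simp
  qed
  finally show ?thesis unfolding rimage_def .
qed

lemma contracts_meet_rotate:
  assumes "contracts (meet b c a) V"
    and "krull_dim (subtopology zariski3 (rot3 -` V)) = krull_dim (subtopology zariski3 V)"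
  shows "contracts (meet a b c) (rot3 -` V)"
proof -
  have "\<not> rot3 -` V \<subseteq> base_locus (meet a b c)"
  proof
    assume "rot3 -` V \<subseteq> base_locus (meet a b c)"
    then have "rimage (meet b c a) V = {}" unfolding rimage_meet_rotate[of a b c, symmetric] by (simp add: rimage_def)
    then show False using assms(1) unfolding contracts_def rimage_def by blast
  qed
  then show ?thesis using assms unfolding contracts_def rimage_meet_rotate by simp
qed

text \<open>Everything claimed about one contracted surface, bundled so that it can be carried along
  the cyclic shift as a whole.\<close>

definition contraction :: "(vec_3 \<Rightarrow> complex^4) \<Rightarrow> P1_3 set \<Rightarrow> P3 set \<Rightarrow> P3 set \<Rightarrow> P3 set \<Rightarrow> bool" where
  "contraction f V L L1 L2 \<longleftrightarrow> pure_dim zariski3 V 2 \<and> contracts f V \<and> rimage f V \<subseteq> L \<and>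
     (L \<inter> L1 = {} \<or> L \<inter> L2 = {} \<longrightarrow> contracts_to f V L)"

lemma contraction_rotate:
  assumes "contraction (meet b c a) V L L1 L2" "pure_dim zariski3 (rot3 -` V) 2"
    and "krull_dim (subtopology zariski3 (rot3 -` V)) = krull_dim (subtopology zariski3 V)"
  shows "contraction (meet a b c) (rot3 -` V) L L2 L1"
  using assms contracts_meet_rotate[of b c a V] unfolding contraction_def contracts_to_def rimage_meet_rotate by blast

context pencils
begin

lemma contraction_axis_surface: "contraction (meet a b c) axis_surface (axis_line a) (axis_line b) (axis_line c)"
proof -
  have "pure_dim zariski3 axis_surface 2"
    using pure_dim_bil(1) axis_a unfolding axis_form_bil axis_surface_def by blast
  then show ?thesis
    unfolding contraction_def using contracts_axis_surface rimage_axis_surface contracts_to_axis_line by blast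
qed

lemma contractions:
  "contraction (meet a b c) {(p, q, r). axis_form a b c (rep q) (rep r) = 0} (axis_line a) (axis_line b) (axis_line c)"
  "contraction (meet a b c) {(p, q, r). axis_form b c a (rep r) (rep p) = 0} (axis_line b) (axis_line a) (axis_line c)"
  "contraction (meet a b c) {(p, q, r). axis_form c a b (rep p) (rep q) = 0} (axis_line c) (axis_line a) (axis_line b)"
proof -
  show "contraction (meet a b c) {(p, q, r). axis_form a b c (rep q) (rep r) = 0} (axis_line a) (axis_line b) (axis_line c)"
    using contraction_axis_surface unfolding axis_surface_def .
  interpret b: pencils b c a by (rule rotate)
  interpret c: pencils c a b by (rule b.rotate)
  have krull: "krull_dim (subtopology zariski3 {(p, q, r). axis_form b c a (rep r) (rep p) = 0}) = 2"
    "krull_dim (subtopology zariski3 {(p, q, r). axis_form b c a (rep q) (rep r) = 0}) = 2"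
    "krull_dim (subtopology zariski3 {(p, q, r). axis_form c a b (rep q) (rep r) = 0}) = 2"
    "krull_dim (subtopology zariski3 {(p, q, r). axis_form c a b (rep r) (rep p) = 0}) = 2"
    "krull_dim (subtopology zariski3 {(p, q, r). axis_form c a b (rep p) (rep q) = 0}) = 2"
    using pure_dim_bil(4-6) axis_b axis_c unfolding axis_form_bil by blast+
  have pure: "pure_dim zariski3 {(p, q, r). axis_form b c a (rep r) (rep p) = 0} 2"
    "pure_dim zariski3 {(p, q, r). axis_form c a b (rep r) (rep p) = 0} 2"
    "pure_dim zariski3 {(p, q, r). axis_form c a b (rep p) (rep q) = 0} 2"
    using pure_dim_bil(2,3) axis_b axis_c unfolding axis_form_bil by blast+
  have v: "rot3 -` {(p, q, r). f (rep q) (rep r) = 0} = {(p, q, r). f (rep r) (rep p) = 0}"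
    "rot3 -` {(p, q, r). f (rep r) (rep p) = 0} = {(p, q, r). f (rep p) (rep q) = 0}"
    for f :: "complex^2 \<Rightarrow> complex^2 \<Rightarrow> complex" by auto
  show "contraction (meet a b c) {(p, q, r). axis_form b c a (rep r) (rep p) = 0} (axis_line b) (axis_line a) (axis_line c)"
    using contraction_rotate[OF b.contraction_axis_surface] krull pure unfolding b.axis_surface_def v by simp
  have "contraction (meet b c a) {(p, q, r). axis_form c a b (rep r) (rep p) = 0} (axis_line c) (axis_line b) (axis_line a)"
    using contraction_rotate[OF c.contraction_axis_surface] krull pure unfolding c.axis_surface_def v by simp
  from contraction_rotate[OF this]
  show "contraction (meet a b c) {(p, q, r). axis_form c a b (rep p) (rep q) = 0} (axis_line c) (axis_line a) (axis_line b)"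
    using krull pure unfolding v by simp
qed

end

subsection \<open>Hexahedral maps\<close>

lemma linear_form_dot: "linear_form v = dot (cvec v)"
  by (intro ext) (simp add: linear_form_def dot_def cvec_def)

lemma dot_cvec: "dot (cvec v) (cvec x) = of_real (v \<bullet> x)"
  by (simp add: dot_def cvec_def inner_vec_def)

lemma dot_commute: "dot a x = dot x a"
  by (simp add: dot_eq mult.commute)

lemma wedge_cvec_0: "wedge (cvec a) (cvec b) (cvec c) $ 0 = of_real (Delta a b c)"
  by (simp add: minor3_def minor2_def Delta_def det_3 cvec_def algebra_simps)

lemma in_zeros_linear_form:
  assumes "x \<noteq> 0"
  shows "pt x \<in> zeros (linear_form v) \<longleftrightarrow> dot (cvec v) x = 0"
proof -
  obtain k where "k \<noteq> 0" "rep (pt x) = k *s x" using rep_pt[OF assms] .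
  then show ?thesis by (simp add: zeros_def linear_form_dot dot_scale)
qed

lemma is_plane_not_UNIV: "\<not> is_plane UNIV"
proof
  assume "is_plane UNIV"
  then obtain f x where f: "f \<in> forms 1" "f x \<noteq> 0" "UNIV = zeros f" unfolding is_plane_def by blast
  have s: "f (l *s x) = l * f x" for l x using f(1) by (simp add: forms_def)
  have "x \<noteq> 0"
  proof
    assume "x = 0"
    then show False using s[of 0 x] f(2) by simp
  qed
  then obtain k where "k \<noteq> 0" "rep (pt x) = k *s x" using rep_pt by blast
  then have "pt x \<notin> zeros f" using f(2) by (simp add: zeros_def s)
  then show False using f(3) by blast
qed

text \<open>A zero covector would describe the whole space instead of a plane, and proportional
  nonzero ones the same plane.\<close>

lemma distinct_planes_independent:
  fixes v :: "2 \<Rightarrow> real^4" and k :: "real^2"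
  assumes plane: "is_plane (zeros (linear_form (v 0)))" "is_plane (zeros (linear_form (v 1)))"
    and ne: "zeros (linear_form (v 0)) \<noteq> zeros (linear_form (v 1))"
    and k: "k $ 0 \<noteq> 0" "k $ 1 \<noteq> 0"
    and rel: "l *s (of_real (k $ 0) *s cvec (v 0)) + m *s (of_real (k $ 1) *s cvec (v 1)) = 0"
  shows "l = 0 \<and> m = 0"
proof -
  have nz: "cvec (v i) \<noteq> 0" for i
  proof
    assume "cvec (v i) = 0"
    then have "zeros (linear_form (v i)) = UNIV" by (simp add: zeros_def linear_form_dot)
    then show False using plane is_plane_not_UNIV type_2_cases[of i] by auto
  qed
  have e: "(l * of_real (k $ 0)) * dot (cvec (v 0)) x + (m * of_real (k $ 1)) * dot (cvec (v 1)) x = 0" for x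
  proof -
    have "dot (l *s (of_real (k $ 0) *s cvec (v 0)) + m *s (of_real (k $ 1) *s cvec (v 1))) x = 0"
      unfolding rel by simp
    then show ?thesis by (simp only: dot_add dot_scale mult.assoc)
  qed
  have "l = 0"
  proof (rule ccontr)
    assume l: "l \<noteq> 0"
    have "m \<noteq> 0" using rel nz[of 0] l k(1) by auto
    then have "dot (cvec (v 0)) x = 0 \<longleftrightarrow> dot (cvec (v 1)) x = 0" for x
      using e[of x] l k by auto
    then show False using ne by (simp add: zeros_def linear_form_dot)
  qed
  moreover have "m = 0" using rel nz[of 1] k(2) \<open>l = 0\<close> by simp
  ultimately show ?thesis ..
qed

text \<open>Dependent vectors span at most a single projective point, whereas a line has
  two.\<close>

lemma line_join_independent:
  assumes L: "is_line (line_join x y)" and rel: "l *s cvec x + m *s cvec y = 0"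
  shows "l = 0 \<and> m = 0"
proof (rule ccontr)
  assume n: "\<not> (l = 0 \<and> m = 0)"
  have "\<exists>z. \<forall>v \<in> vec.span {cvec x, cvec y}. \<exists>k. v = k *s z"
  proof (cases "l = 0")
    case True
    then have "cvec y = 0" using rel n by simp
    then have "\<forall>v \<in> vec.span {cvec x, cvec y}. \<exists>k. v = k *s cvec x" unfolding Ball_def span_pair by auto
    then show ?thesis by blast
  next
    case False
    have "cvec x = (- m / l) *s cvec y"
    proof -
      have "l *s cvec x = (- m) *s cvec y" using rel by (simp add: eq_neg_iff_add_eq_0)
      then have "inverse l *s (l *s cvec x) = inverse l *s ((- m) *s cvec y)" by simp
      then show ?thesis using False by (simp add: vector_smult_assoc divide_inverse mult.commute)
    qed
    then have "p *s cvec x + q *s cvec y = (p * (- m / l) + q) *s cvec y" for p q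
      by (simp add: vector_smult_assoc vector_sadd_rdistrib)
    then have "\<forall>v \<in> vec.span {cvec x, cvec y}. \<exists>k. v = k *s cvec y" unfolding Ball_def span_pair by metis
    then show ?thesis by blast
  qed
  then obtain z where z: "\<And>v. v \<in> vec.span {cvec x, cvec y} \<Longrightarrow> \<exists>k. v = k *s z" by blast
  have "p = pt z" if "p \<in> line_join x y" for p
  proof -
    obtain k where k: "rep p = k *s z" using z \<open>p \<in> line_join x y\<close> unfolding line_join_def by blast
    have "k *s z \<noteq> 0" unfolding k[symmetric] by simp
    then have "k \<noteq> 0" "z \<noteq> 0" unfolding vector_mul_eq_0 by simp_all
    then have "pt (rep p) = pt z" unfolding k by (rule pt_scale)
    then show ?thesis by simp
  qed
  then show False using line_two_points[OF L] by metis
qed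

text \<open>Points and planes change roles: for \<open>v\<close> on the axis, the wedge of
  \<open>x\<close>, \<open>y\<close>, \<open>v\<close> is a multiple of both \<open>a 0\<close> and
  \<open>a 1\<close>, so it is zero by independence, and \<open>v\<close> depends on
  \<open>x\<close> and \<open>y\<close>.\<close>

lemma line_join_eq_axis_line:
  fixes a :: "2 \<Rightarrow> complex^4"
  assumes L: "is_line (line_join x y)"
    and indep: "\<And>l m. l *s a 0 + m *s a 1 = 0 \<Longrightarrow> l = 0 \<and> m = 0"
    and x: "\<And>i. dot (a i) (cvec x) = 0" and y: "\<And>i. dot (a i) (cvec y) = 0"
  shows "line_join x y = axis_line a"
proof (intro equalityI subsetI)
  fix p assume "p \<in> line_join x y"
  then obtain l m where "rep p = l *s cvec x + m *s cvec y"
    unfolding line_join_def span_pair by blast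
  then show "p \<in> axis_line a" by (simp add: axis_line_def dot_add dot_scale x y)
next
  fix p assume p: "p \<in> axis_line a"
  define v where "v = rep p"
  have v: "dot (a i) v = 0" for i using p type_2_cases[of i] by (auto simp: axis_line_def v_def)
  have nz: "a 0 \<noteq> 0" "a 1 \<noteq> 0" using indep[of 1 0] indep[of 0 1] by auto
  have "\<exists>k. wedge (cvec x) (cvec y) v = k *s a i" for i
  proof -
    have "a i \<noteq> 0" using nz type_2_cases[of i] by auto
    moreover have "dot (cvec x) (a i) = 0" "dot (cvec y) (a i) = 0" "dot v (a i) = 0"
      using x y v dot_commute by metis+
    ultimately show ?thesis using wedge_unique_scale by metis
  qed
  then obtain k k' where k: "wedge (cvec x) (cvec y) v = k *s a 0" "wedge (cvec x) (cvec y) v = k' *s a 1"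
    by blast
  then have "k *s a 0 + (- k') *s a 1 = 0" by simp
  then have "k = 0" using indep by blast
  then have "wedge (cvec x) (cvec y) v = 0" using k(1) by simp
  then obtain l m n where lmn: "l \<noteq> 0 \<or> m \<noteq> 0 \<or> n \<noteq> 0" "l *s cvec x + m *s cvec y + n *s v = 0"
    using wedge_zero_dependent by blast
  have n: "n \<noteq> 0"
  proof
    assume "n = 0"
    then have "l *s cvec x + m *s cvec y = 0" using lmn(2) by simp
    from line_join_independent[OF L this] show False using lmn(1) \<open>n = 0\<close> by simp
  qed
  have "v = (- l / n) *s cvec x + (- m / n) *s cvec y"
  proof -
    have "n *s v = (- l) *s cvec x + (- m) *s cvec y" using lmn(2) by (simp add: eq_neg_iff_add_eq_0 algebra_simps)
    then have "inverse n *s (n *s v) = inverse n *s ((- l) *s cvec x + (- m) *s cvec y)" by simp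
    then show ?thesis using n
      by (simp add: vector_smult_assoc divide_inverse mult.commute vector_add_ldistrib)
  qed
  then show "p \<in> line_join x y" unfolding line_join_def mem_Collect_eq v_def[symmetric] span_pair by blast
qed

lemma trilinear_vertex:
  "trilinear w P (l *s axis i 1, m *s axis j 1, n *s axis k 1) = (of_real (w i j k) * l * m * n) *s cvec (P i j k)"
  using type_2_cases[of i] type_2_cases[of j] type_2_cases[of k]
  by (elim disjE) (simp_all add: trilinear_def sum_type_2 axis_def)

lemma rep_vertex: obtains l where "l \<noteq> 0" "rep (vertex i) = l *s axis i 1"
  unfolding vertex_def using rep_pt[of "axis i 1 :: complex^2"] by (auto simp: axis_eq_0_iff)

section \<open>The hexahedral map as the meet of three pencils\<close>

locale hexahedral_map =
  fixes w :: "2 \<Rightarrow> 2 \<Rightarrow> 2 \<Rightarrow> real" and P :: "2 \<Rightarrow> 2 \<Rightarrow> 2 \<Rightarrow> real^4"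
    and \<sigma> \<tau> \<upsilon> :: "2 \<Rightarrow> real^4" and \<alpha> \<beta> \<gamma> :: "real^2"
  assumes P_affine: "\<And>i j k. P i j k $ 0 = 1"
    and nondeg: "nondegenerate w P"
    and hex: "hexahedral (trilinear w P)"
    and \<sigma>: "\<And>i. Sigma_surface (trilinear w P) i = zeros (linear_form (\<sigma> i))"
    and \<tau>: "\<And>j. T_surface (trilinear w P) j = zeros (linear_form (\<tau> j))"
    and \<upsilon>: "\<And>k. Y_surface (trilinear w P) k = zeros (linear_form (\<upsilon> k))"
    and weights: "\<And>i j k. w i j k = \<alpha> $ i * \<beta> $ j * \<gamma> $ k * Delta (\<sigma> i) (\<tau> j) (\<upsilon> k)"
begin

definition a :: "2 \<Rightarrow> complex^4" where "a i = of_real (\<alpha> $ i) *s cvec (\<sigma> i)"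
definition b :: "2 \<Rightarrow> complex^4" where "b j = of_real (\<beta> $ j) *s cvec (\<tau> j)"
definition c :: "2 \<Rightarrow> complex^4" where "c k = of_real (\<gamma> $ k) *s cvec (\<upsilon> k)"

lemma P_0: "cvec (P i j k) $ 0 = 1"
  by (simp add: cvec_def P_affine)

lemma P_nonzero: "cvec (P i j k) \<noteq> 0"
proof
  assume "cvec (P i j k) = 0"
  then show False using P_0[of i j k] by simp
qed

lemma lines: "is_line (s_line P j k)" "is_line (t_line P i k)" "is_line (u_line P i j)"
proof -
  have "list_all is_line (boundary_lines P)" using nondeg unfolding nondegenerate_def by (elim conjE)
  then have *: "is_line (s_line P j k) \<and> is_line (t_line P j k) \<and> is_line (u_line P j k)" for j k
    using type_2_cases[of j] type_2_cases[of k] by (elim disjE) (simp_all add: boundary_lines_def)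
  show "is_line (s_line P j k)" "is_line (t_line P i k)" "is_line (u_line P i j)" using * by blast+
qed

text \<open>With a vanishing weight the coordinate line through the vertex in the first factor would
  have at most one image point, whereas the closure of its image is a line.\<close>

lemma weight_nonzero: "w i j k \<noteq> 0"
proof
  assume w0: "w i j k = 0"
  obtain i' where i': "{i, i'} = (UNIV :: 2 set)" "i \<noteq> i'"
  proof (cases "i = 0")
    case True
    then show ?thesis using that[of 1] UNIV_type_2 by auto
  next
    case False
    then show ?thesis using that[of 0] type_2_cases[of i] UNIV_type_2 by auto
  qed
  let ?V = "{(p, q, r). q = vertex j \<and> r = vertex k}"
  obtain m n where mn: "rep (vertex j) = m *s axis j 1" "rep (vertex k) = n *s axis k 1"
    using rep_vertex by metis
  have "rimage (trilinear w P) ?V \<subseteq> {pt (cvec (P i' j k))}"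
  proof
    fix x assume "x \<in> rimage (trilinear w P) ?V"
    then obtain p where p: "trilinear w P (rep p, rep (vertex j), rep (vertex k)) \<noteq> 0"
      "x = pt (trilinear w P (rep p, rep (vertex j), rep (vertex k)))"
      unfolding rimage_def base_locus_def rmap_def by fastforce
    have "trilinear w P (s, m *s axis j 1, n *s axis k 1) =
      (\<Sum>i\<in>UNIV. (of_real (w i j k) * s $ i * m * n) *s cvec (P i j k))" for s
      using type_2_cases[of j] type_2_cases[of k]
      by (elim disjE) (simp_all add: trilinear_def sum_type_2 axis_def)
    then have e: "trilinear w P (rep p, rep (vertex j), rep (vertex k)) =
      (of_real (w i' j k) * rep p $ i' * m * n) *s cvec (P i' j k)"
      unfolding mn i'(1)[symmetric] using i'(2) w0 by simp
    have "x = pt (cvec (P i' j k))"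
      unfolding p(2) e by (rule pt_scale[OF _ P_nonzero]) (use p(1) in \<open>auto simp: e\<close>)
    then show "x \<in> {pt (cvec (P i' j k))}" by simp
  qed
  then have "s_line P j k \<subseteq> {pt (cvec (P i' j k))}"
    using closure_of_minimal[OF _ closedin_zariski_sing] nondeg unfolding nondegenerate_def by metis
  then show False using line_two_points[OF lines(1)] by (metis singletonD subsetD)
qed

lemma params_nonzero: "\<alpha> $ i \<noteq> 0" "\<beta> $ i \<noteq> 0" "\<gamma> $ i \<noteq> 0"
  using weight_nonzero[of i i i] weights[of i i i] by auto

text \<open>The vertex with indices \<open>i\<close>, \<open>j\<close>, \<open>k\<close> is mapped
  to \<open>P i j k\<close>, because the weight is nonzero.\<close>

lemma P_in_surfaces:
  "dot (cvec (\<sigma> i)) (cvec (P i j k)) = 0" "dot (cvec (\<tau> j)) (cvec (P i j k)) = 0"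
  "dot (cvec (\<upsilon> k)) (cvec (P i j k)) = 0"
proof -
  let ?x = "(vertex i, vertex j, vertex k)"
  obtain l m n where lmn: "l \<noteq> 0" "rep (vertex i) = l *s axis i 1" "m \<noteq> 0" "rep (vertex j) = m *s axis j 1"
    "n \<noteq> 0" "rep (vertex k) = n *s axis k 1"
    using rep_vertex by metis
  have e: "trilinear w P (rep3 ?x) = (of_real (w i j k) * l * m * n) *s cvec (P i j k)"
    by (simp only: rep3.simps lmn trilinear_vertex)
  have nz: "of_real (w i j k) * l * m * n \<noteq> 0" using lmn weight_nonzero[of i j k] by simp
  have "trilinear w P (rep3 ?x) \<noteq> 0" unfolding e vector_mul_eq_0 using nz P_nonzero by blast
  moreover have "rmap (trilinear w P) ?x = pt (cvec (P i j k))"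
    unfolding rmap_def e by (rule pt_scale[OF nz P_nonzero])
  ultimately have r: "pt (cvec (P i j k)) \<in> rimage (trilinear w P) V" if "?x \<in> V" for V
    using that unfolding rimage_def base_locus_def by (intro image_eqI[of _ _ ?x]) auto
  have cl: "S \<subseteq> zariski closure_of S" for S :: "P3 set"
    by (rule closure_of_subset) (simp add: topspace_zariski)
  have "pt (cvec (P i j k)) \<in> Sigma_surface (trilinear w P) i"
    unfolding Sigma_surface_def by (rule subsetD[OF cl r]) simp
  then show "dot (cvec (\<sigma> i)) (cvec (P i j k)) = 0" unfolding \<sigma> in_zeros_linear_form[OF P_nonzero] .
  have "pt (cvec (P i j k)) \<in> T_surface (trilinear w P) j"
    unfolding T_surface_def by (rule subsetD[OF cl r]) simp
  then show "dot (cvec (\<tau> j)) (cvec (P i j k)) = 0" unfolding \<tau> in_zeros_linear_form[OF P_nonzero] .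
  have "pt (cvec (P i j k)) \<in> Y_surface (trilinear w P) k"
    unfolding Y_surface_def by (rule subsetD[OF cl r]) simp
  then show "dot (cvec (\<upsilon> k)) (cvec (P i j k)) = 0" unfolding \<upsilon> in_zeros_linear_form[OF P_nonzero] .
qed

text \<open>The point lies on the three planes, so their wedge is a multiple of it. Comparing the
  entries \<open>0\<close>, which are 1 and \<open>Delta\<close>, gives the factor; the parameters
  then turn \<open>Delta\<close> into the weight.\<close>

lemma wedge_eq: "wedge (a i) (b j) (c k) = of_real (w i j k) *s cvec (P i j k)"
proof -
  let ?W = "wedge (cvec (\<sigma> i)) (cvec (\<tau> j)) (cvec (\<upsilon> k))"
  have "?W $ n = of_real (Delta (\<sigma> i) (\<tau> j) (\<upsilon> k)) * cvec (P i j k) $ n" for n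
    using wedge_unique[OF P_in_surfaces(1)[of i j k] P_in_surfaces(2)[of j i k] P_in_surfaces(3)[of k i j], of 0 n] unfolding P_0 wedge_cvec_0
    by (metis mult_1_left mult.commute)
  then have "?W = of_real (Delta (\<sigma> i) (\<tau> j) (\<upsilon> k)) *s cvec (P i j k)" by (simp add: vec_eq_iff)
  then show ?thesis
    by (simp add: a_def b_def c_def wedge_scale vector_smult_assoc weights mult_ac)
qed

lemma trilinear_eq_meet: "trilinear w P = meet a b c"
proof (intro ext, clarify)
  fix s t u :: "complex^2"
  have e: "(of_real (w i j k) * s $ i * t $ j * u $ k) *s cvec (P i j k) =
    (s $ i * t $ j * u $ k) *s wedge (a i) (b j) (c k)" for i j k
    by (simp add: wedge_eq vector_smult_assoc mult_ac)
  show "trilinear w P (s, t, u) = meet a b c (s, t, u)"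
    unfolding trilinear_def prod.case e meet_def lc_def sum_type_2 wedge_add wedge_scale
    by (simp add: vector_smult_assoc mult_ac add_ac)
qed

lemma dot_wedge_P: "dot (cvec v) (wedge (a i) (b j) (c k)) = of_real (w i j k * (v \<bullet> P i j k))"
  by (simp add: wedge_eq dot_scale dot_cvec)

text \<open>The generators pair with \<open>\<sigma> 1\<close>, the axis forms with
  \<open>a 1\<close>, which is \<open>\<alpha> $ 1\<close> times it; likewise for the other
  two.\<close>

lemma generators:
  "gen_s w P (\<sigma> 1) = (\<lambda>(s, t, u). (1 / of_real (\<alpha> $ 1)) * axis_form a b c t u)"
  "gen_t w P (\<tau> 1) = (\<lambda>(s, t, u). (1 / of_real (\<beta> $ 1)) * axis_form b c a u s)"
  "gen_u w P (\<upsilon> 1) = (\<lambda>(s, t, u). (1 / of_real (\<gamma> $ 1)) * axis_form c a b s t)"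
proof -
  have w: "wedge (b j) (c k) (a i) = wedge (a i) (b j) (c k)" "wedge (c k) (a i) (b j) = wedge (a i) (b j) (c k)" for i j k
    by (rule wedge_cyc) (simp only: wedge_cyc)
  have d: "dot (a 1) x = of_real (\<alpha> $ 1) * dot (cvec (\<sigma> 1)) x" "dot (b 1) x = of_real (\<beta> $ 1) * dot (cvec (\<tau> 1)) x"
    "dot (c 1) x = of_real (\<gamma> $ 1) * dot (cvec (\<upsilon> 1)) x" for x
    by (simp_all add: a_def b_def c_def dot_scale)
  show "gen_s w P (\<sigma> 1) = (\<lambda>(s, t, u). (1 / of_real (\<alpha> $ 1)) * axis_form a b c t u)"
    "gen_t w P (\<tau> 1) = (\<lambda>(s, t, u). (1 / of_real (\<beta> $ 1)) * axis_form b c a u s)"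
    "gen_u w P (\<upsilon> 1) = (\<lambda>(s, t, u). (1 / of_real (\<gamma> $ 1)) * axis_form c a b s t)"
    unfolding gen_s_def gen_t_def gen_u_def axis_form_bilinear w d dot_wedge_P sum_type_2
    using params_nonzero[of 1] by (auto simp: field_simps)
qed

lemma surfaces_distinct:
  "zeros (linear_form (\<sigma> 0)) \<noteq> zeros (linear_form (\<sigma> 1))"
  "zeros (linear_form (\<tau> 0)) \<noteq> zeros (linear_form (\<tau> 1))"
  "zeros (linear_form (\<upsilon> 0)) \<noteq> zeros (linear_form (\<upsilon> 1))"
proof -
  have "distinct (boundary_surfaces (trilinear w P))" using nondeg unfolding nondegenerate_def by (elim conjE)
  then show "zeros (linear_form (\<sigma> 0)) \<noteq> zeros (linear_form (\<sigma> 1))"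
    "zeros (linear_form (\<tau> 0)) \<noteq> zeros (linear_form (\<tau> 1))"
    "zeros (linear_form (\<upsilon> 0)) \<noteq> zeros (linear_form (\<upsilon> 1))"
    unfolding boundary_surfaces_def \<sigma> \<tau> \<upsilon> by simp_all
qed

lemma planes:
  "is_plane (zeros (linear_form (\<sigma> i)))" "is_plane (zeros (linear_form (\<tau> i)))"
  "is_plane (zeros (linear_form (\<upsilon> i)))"
  using hex type_2_cases[of i] unfolding hexahedral_def boundary_surfaces_def \<sigma> \<tau> \<upsilon>
  by (elim disjE; simp)+

lemma a_independent: "l *s a 0 + m *s a 1 = 0 \<Longrightarrow> l = 0 \<and> m = 0"
  unfolding a_def by (rule distinct_planes_independent[OF planes(1) planes(1) surfaces_distinct(1) params_nonzero(1) params_nonzero(1)])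

lemma b_independent: "l *s b 0 + m *s b 1 = 0 \<Longrightarrow> l = 0 \<and> m = 0"
  unfolding b_def by (rule distinct_planes_independent[OF planes(2) planes(2) surfaces_distinct(2) params_nonzero(2) params_nonzero(2)])

lemma c_independent: "l *s c 0 + m *s c 1 = 0 \<Longrightarrow> l = 0 \<and> m = 0"
  unfolding c_def by (rule distinct_planes_independent[OF planes(3) planes(3) surfaces_distinct(3) params_nonzero(3) params_nonzero(3)])

lemma dot_P:
  "dot (a i) (cvec (P i j k)) = 0" "dot (b j) (cvec (P i j k)) = 0" "dot (c k) (cvec (P i j k)) = 0"
  by (simp_all add: a_def b_def c_def dot_scale P_in_surfaces)

lemma axis_form_axis: "axis_form a b c (axis j 1) (axis k 1) = dot (a 1) (wedge (a 0) (b j) (c k))"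
  for a b c :: "2 \<Rightarrow> complex^4"
  using type_2_cases[of j] type_2_cases[of k]
  by (elim disjE) (simp_all add: axis_form_bilinear sum_type_2 axis_def)

lemma dot_P_0:
  assumes "dot d (wedge (a i) (b j) (c k)) = 0"
  shows "dot d (cvec (P i j k)) = 0"
  using assms weight_nonzero[of i j k] by (simp add: wedge_eq dot_scale)

lemma lines_distinct:
  "t_line P 0 0 \<noteq> t_line P 0 1" "s_line P 0 0 \<noteq> s_line P 0 1" "s_line P 0 0 \<noteq> s_line P 1 0"
proof -
  have "distinct (boundary_lines P)" using nondeg unfolding nondegenerate_def by (elim conjE)
  then show "t_line P 0 0 \<noteq> t_line P 0 1" "s_line P 0 0 \<noteq> s_line P 0 1" "s_line P 0 0 \<noteq> s_line P 1 0"
    unfolding boundary_lines_def by simp_all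
qed

text \<open>If the axis form of \<open>a\<close> vanished identically, all \<open>P 0 j k\<close>
  would lie on both planes of the pencil, so \<open>t_line P 0 0\<close> and
  \<open>t_line P 0 1\<close> would both be its axis, although they are distinct. The other two
  pencils are treated in the same way.\<close>

lemma pencils: "pencils a b c"
proof
  show "\<exists>t u. axis_form a b c t u \<noteq> 0"
  proof (rule ccontr)
    assume "\<nexists>t u. axis_form a b c t u \<noteq> 0"
    then have "dot (a 1) (wedge (a 0) (b j) (c k)) = 0" for j k by (metis axis_form_axis)
    then have "dot (a 1) (cvec (P 0 j k)) = 0" for j k by (rule dot_P_0)
    then have "dot (a i) (cvec (P 0 j k)) = 0" for i j k using dot_P(1)[of 0] type_2_cases[of i] by metis
    then have "t_line P 0 k = axis_line a" for k
      using lines(2)[of 0 k] unfolding t_line_def by (intro line_join_eq_axis_line a_independent) simp_all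
    then show False using lines_distinct(1) by simp
  qed
  show "\<exists>u s. axis_form b c a u s \<noteq> 0"
  proof (rule ccontr)
    assume "\<nexists>u s. axis_form b c a u s \<noteq> 0"
    then have "dot (b 1) (wedge (b 0) (c k) (a i)) = 0" for i k by (metis axis_form_axis)
    then have "dot (b 1) (wedge (a i) (b 0) (c k)) = 0" for i k by (simp only: wedge_cyc[of "b 0" "c k" "a i", symmetric])
    then have "dot (b 1) (cvec (P i 0 k)) = 0" for i k by (rule dot_P_0)
    then have "dot (b j) (cvec (P i 0 k)) = 0" for i j k using dot_P(2)[of 0] type_2_cases[of j] by metis
    then have "s_line P 0 k = axis_line b" for k
      using lines(1)[of 0 k] unfolding s_line_def by (intro line_join_eq_axis_line b_independent) simp_all
    then show False using lines_distinct(2) by simp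
  qed
  show "\<exists>s t. axis_form c a b s t \<noteq> 0"
  proof (rule ccontr)
    assume "\<nexists>s t. axis_form c a b s t \<noteq> 0"
    then have "dot (c 1) (wedge (c 0) (a i) (b j)) = 0" for i j by (metis axis_form_axis)
    then have "dot (c 1) (wedge (a i) (b j) (c 0)) = 0" for i j by (simp only: wedge_cyc[of "a i" "b j" "c 0"])
    then have "dot (c 1) (cvec (P i j 0)) = 0" for i j by (rule dot_P_0)
    then have "dot (c k) (cvec (P i j 0)) = 0" for i j k using dot_P(3)[of 0] type_2_cases[of k] by metis
    then have "s_line P j 0 = axis_line c" for j
      using lines(1)[of j 0] unfolding s_line_def by (intro line_join_eq_axis_line c_independent) simp_all
    then show False using lines_distinct(3) by simp
  qed
  show "x = 0" if x: "\<And>i. dot (a i) x = 0" "\<And>i. dot (b i) x = 0" "\<And>i. dot (c i) x = 0" for x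
  proof (rule ccontr)
    assume "x \<noteq> 0"
    \<comment> \<open>A common point of all planes would be proportional to each of these control
      points; the entry \<open>0\<close> being 1 makes two of them equal, and they span no
      line.\<close>
    have *: "\<exists>k. cvec (P i 0 0) = k *s x" for i
    proof -
      obtain k where k: "wedge (a i) (b 0) (c 0) = k *s x" using wedge_unique_scale[OF x(1-3) \<open>x \<noteq> 0\<close>] .
      have "inverse (of_real (w i 0 0)) *s (of_real (w i 0 0) *s cvec (P i 0 0)) = inverse (of_real (w i 0 0)) *s (k *s x)"
        using k unfolding wedge_eq by simp
      then show ?thesis using weight_nonzero[of i 0 0] by (auto simp: vector_smult_assoc)
    qed
    obtain k k' where k: "cvec (P 0 0 0) = k *s x" "cvec (P 1 0 0) = k' *s x" using * by meson
    have "k * x $ 0 = 1" "k' * x $ 0 = 1" using P_0[of 0 0 0] P_0[of 1 0 0] unfolding k by simp_all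
    then have "k = k'" by (metis mult_cancel_right mult_zero_right zero_neq_one)
    then have "1 *s cvec (P 0 0 0) + (- 1) *s cvec (P 1 0 0) = 0" unfolding k by simp
    from line_join_independent[OF lines(1)[unfolded s_line_def] this] show False by simp
  qed
qed

sublocale pencils a b c by (rule pencils)

lemma inverse_map_eq: "inverse_map \<alpha> \<beta> \<gamma> \<sigma> \<tau> \<upsilon> = (\<lambda>x. (param a x, param b x, param c x))"
  by (simp add: inverse_map_def param_def a_def b_def c_def linear_form_dot dot_scale)

lemma axis_lines:
  "Sigma_surface (trilinear w P) 0 \<inter> Sigma_surface (trilinear w P) 1 = axis_line a"
  "T_surface (trilinear w P) 0 \<inter> T_surface (trilinear w P) 1 = axis_line b"
  "Y_surface (trilinear w P) 0 \<inter> Y_surface (trilinear w P) 1 = axis_line c"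
  unfolding \<sigma> \<tau> \<upsilon> using params_nonzero
  by (auto simp: axis_line_def zeros_def linear_form_dot a_def b_def c_def dot_scale)

lemma zeros_generators:
  "zeros3 {gen_s w P (\<sigma> 1)} = {(p, q, r). axis_form a b c (rep q) (rep r) = 0}"
  "zeros3 {gen_t w P (\<tau> 1)} = {(p, q, r). axis_form b c a (rep r) (rep p) = 0}"
  "zeros3 {gen_u w P (\<upsilon> 1)} = {(p, q, r). axis_form c a b (rep p) (rep q) = 0}"
  unfolding generators zeros3_def set_eq_iff split_paired_all using params_nonzero[of 1] by simp_all

lemma base_curve_zeros: "zeros3 {gen_s w P (\<sigma> 1), gen_t w P (\<tau> 1), gen_u w P (\<upsilon> 1)} = base_curve"
proof -
  have "zeros3 {gen_s w P (\<sigma> 1), gen_t w P (\<tau> 1), gen_u w P (\<upsilon> 1)} =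
    zeros3 {gen_s w P (\<sigma> 1)} \<inter> zeros3 {gen_t w P (\<tau> 1)} \<inter> zeros3 {gen_u w P (\<upsilon> 1)}"
    by (auto simp: zeros3_def)
  then show ?thesis unfolding zeros_generators base_curve_eq .
qed

lemma same_subscheme:
  "same_subscheme3 (range (\<lambda>m p. trilinear w P p $ m)) {gen_s w P (\<sigma> 1), gen_t w P (\<tau> 1), gen_u w P (\<upsilon> 1)}"
  unfolding generators trilinear_eq_meet
  by (rule same_subscheme3_base_curve) (use params_nonzero in simp_all)

lemma base_locus_inverse:
  "base_locus_inv (inverse_map \<alpha> \<beta> \<gamma> \<sigma> \<tau> \<upsilon>) = axis_line a \<union> axis_line b \<union> axis_line c"
  unfolding inverse_map_eq base_locus_inv_def axis_line_def prod.case param_eq_0 by blast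

lemma is_line_axes: "is_line (axis_line a)" "is_line (axis_line b)" "is_line (axis_line c)"
  using axis_a axis_b axis_c is_line_axis_line by blast+

end

theorem theorem3p7:
  fixes w :: "2 \<Rightarrow> 2 \<Rightarrow> 2 \<Rightarrow> real"
    and P :: "2 \<Rightarrow> 2 \<Rightarrow> 2 \<Rightarrow> real^4"
    and \<phi> :: "vec_3 \<Rightarrow> complex^4"
    and \<sigma> \<tau> \<upsilon> :: "2 \<Rightarrow> real^4"
    and \<alpha> \<beta> \<gamma> :: "real^2"
    and A B D :: "vec_3 \<Rightarrow> complex"
    and s t u :: "P3 set"
    and C :: "P1_3 set"
  assumes P_affine: "\<And>i j k. P i j k $ 0 = 1"
    and \<phi>: "\<phi> = trilinear w P"
    and nondeg: "nondegenerate w P"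
    and hex: "hexahedral \<phi>"
    and \<sigma>: "\<And>i. Sigma_surface \<phi> i = zeros (linear_form (\<sigma> i))"
    and \<tau>: "\<And>j. T_surface \<phi> j = zeros (linear_form (\<tau> j))"
    and \<upsilon>: "\<And>k. Y_surface \<phi> k = zeros (linear_form (\<upsilon> k))"
    and params: "\<alpha> \<noteq> 0" "\<beta> \<noteq> 0" "\<gamma> \<noteq> 0"
    and weights: "\<And>i j k. w i j k = \<alpha> $ i * \<beta> $ j * \<gamma> $ k * Delta (\<sigma> i) (\<tau> j) (\<upsilon> k)"
    and s: "s = Sigma_surface \<phi> 0 \<inter> Sigma_surface \<phi> 1"
    and t: "t = T_surface \<phi> 0 \<inter> T_surface \<phi> 1"
    and u: "u = Y_surface \<phi> 0 \<inter> Y_surface \<phi> 1"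
    and A: "A = gen_s w P (\<sigma> 1)"
    and B: "B = gen_t w P (\<tau> 1)"
    and D: "D = gen_u w P (\<upsilon> 1)"
    and C: "C = zeros3 {A, B, D}"
  shows "birational_inverse \<phi> (inverse_map \<alpha> \<beta> \<gamma> \<sigma> \<tau> \<upsilon>)
    \<and> (base_locus \<phi> = C \<and> same_subscheme3 (range (\<lambda>m p. \<phi> p $ m)) {A, B, D} \<and>
       pure_dim zariski3 C 1)
    \<and> (is_line s \<and> is_line t \<and> is_line u \<and>
       base_locus_inv (inverse_map \<alpha> \<beta> \<gamma> \<sigma> \<tau> \<upsilon>) = s \<union> t \<union> u)
    \<and> (pure_dim zariski3 (zeros3 {A}) 2 \<and> contracts \<phi> (zeros3 {A}) \<and> rimage \<phi> (zeros3 {A}) \<subseteq> s \<and>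
       (s \<inter> t = {} \<or> s \<inter> u = {} \<longrightarrow> contracts_to \<phi> (zeros3 {A}) s))
    \<and> (pure_dim zariski3 (zeros3 {B}) 2 \<and> contracts \<phi> (zeros3 {B}) \<and> rimage \<phi> (zeros3 {B}) \<subseteq> t \<and>
       (t \<inter> s = {} \<or> t \<inter> u = {} \<longrightarrow> contracts_to \<phi> (zeros3 {B}) t))
    \<and> (pure_dim zariski3 (zeros3 {D}) 2 \<and> contracts \<phi> (zeros3 {D}) \<and> rimage \<phi> (zeros3 {D}) \<subseteq> u \<and>
       (u \<inter> s = {} \<or> u \<inter> t = {} \<longrightarrow> contracts_to \<phi> (zeros3 {D}) u))
    \<and> (s \<inter> t = {} \<and> s \<inter> u = {} \<and> t \<inter> u = {} \<longrightarrow>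
       (\<exists>Q. smooth_surface_of_degree 2 Q \<and>
            (\<forall>Q'. is_quadric Q' \<and> s \<union> t \<union> u \<subseteq> Q' \<longleftrightarrow> Q' = Q) \<and>
            blows_up_to \<phi> C Q))"
proof -
  interpret hexahedral_map w P \<sigma> \<tau> \<upsilon> \<alpha> \<beta> \<gamma>
    by (rule hexahedral_map.intro) (fact P_affine nondeg hex[unfolded \<phi>] \<sigma>[unfolded \<phi>] \<tau>[unfolded \<phi>] \<upsilon>[unfolded \<phi>] weights)+
  have axes: "s = axis_line a" "t = axis_line b" "u = axis_line c"
    unfolding s t u \<phi> by (rule axis_lines)+
  have C_eq: "C = base_curve" unfolding C A B D by (rule base_curve_zeros)
  have surfaces: "zeros3 {A} = {(p, q, r). axis_form a b c (rep q) (rep r) = 0}"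
    "zeros3 {B} = {(p, q, r). axis_form b c a (rep r) (rep p) = 0}"
    "zeros3 {D} = {(p, q, r). axis_form c a b (rep p) (rep q) = 0}"
    unfolding A B D by (rule zeros_generators)+
  have \<phi>_eq: "\<phi> = meet a b c" unfolding \<phi> by (rule trilinear_eq_meet)
  have "birational_inverse \<phi> (inverse_map \<alpha> \<beta> \<gamma> \<sigma> \<tau> \<upsilon>)"
    unfolding \<phi>_eq inverse_map_eq by (rule birational_inverse_meet)
  moreover have "base_locus \<phi> = C" unfolding \<phi>_eq C_eq by (simp add: base_locus_def base_curve_def)
  moreover have "same_subscheme3 (range (\<lambda>m p. \<phi> p $ m)) {A, B, D}"
    unfolding \<phi> A B D by (rule same_subscheme)
  moreover have "pure_dim zariski3 C 1" unfolding C_eq by (rule pure_dim_base_curve)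
  moreover have "is_line s" "is_line t" "is_line u" unfolding axes by (rule is_line_axes)+
  moreover have "base_locus_inv (inverse_map \<alpha> \<beta> \<gamma> \<sigma> \<tau> \<upsilon>) = s \<union> t \<union> u"
    unfolding axes by (rule base_locus_inverse)
  moreover have "contraction \<phi> (zeros3 {A}) s t u" "contraction \<phi> (zeros3 {B}) t s u"
    "contraction \<phi> (zeros3 {D}) u s t"
    unfolding \<phi>_eq axes surfaces by (rule contractions)+
  moreover have "s \<inter> t = {} \<and> s \<inter> u = {} \<and> t \<inter> u = {} \<longrightarrow>
       (\<exists>Q. smooth_surface_of_degree 2 Q \<and>
            (\<forall>Q'. is_quadric Q' \<and> s \<union> t \<union> u \<subseteq> Q' \<longleftrightarrow> Q' = Q) \<and>
            blows_up_to \<phi> C Q)"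
    unfolding axes \<phi>_eq C_eq using blows_up_quadric by blast
  ultimately show ?thesis unfolding contraction_def by (intro conjI) simp_all
qed

end
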